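(* Let $M$ be a finite-dimensional analytic manifold over a complete ultrametric field $\mathbb{K}$, $M_0\subseteq M$ an open subset, $f\colon M_0\to M$ an analytic map and $p\in M_0$ a fixed point of $f$ such that $\alpha:=T_p(f)\colon T_p(M)\to T_p(M)$ is an automorphism. Then: (a) $R(\alpha)\subseteq(0,1]$ if and only if each neighbourhood $P$ of $p$ in $M_0$ contains a neighbourhood $Q$ of $p$ such that $f(Q)\subseteq Q$. (b) $R(\alpha)\subseteq\{1\}$ if and only if each neighbourhood $P$ of $p$ in $M_0$ contains a neighbourhood $Q$ of $p$ such that $f(Q)=Q$. (c) $R(\alpha)\subseteq(0,1)$ if and only if $p$ is a uniformly attractive fixed point of $f$.
   Context: A complete ultrametric field $(\mathbb{K},|\cdot|)$ is a field with an absolute value satisfying the ultrametric inequality whose metric is complete and defines a non-discrete topology. Analytic maps are the locally analytic ones (locally given by convergent power series, as in Serre and Bourbaki). $R(\alpha)$ is the set of all $|\lambda|$, where $\lambda$ runs through the eigenvalues of $\alpha\otimes_{\mathbb{K}}\mathrm{id}_{\overline{\mathbb{K}}}$ in an algebraic closure $\overline{\mathbb{K}}$ of $\mathbb{K}$, equipped with the unique absolute value extending $|\cdot|$. A fixed point $p\in M_0$ of $f\colon M_0\to M$ is uniformly attractive if each neighbourhood of $p$ in $M_0$ contains a neighbourhood $Q$ of $p$ in $M_0$ such that $f(Q)\subseteq Q$ and $\lim_{n\to\infty}f^n(x)=p$ for all $x\in Q$, where $f^n$ is the $n$-fold iterate of $f$. *)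

theory Defs
  imports
    "HOL-Analysis.Analysis"
    "HOL-Algebra.Algebraic_Closure_Type"
    "HOL-Library.Poly_Mapping"
    "HOL-Library.Function_Algebras"
begin

text \<open>The absolute value is a separate class parameter because \<open>norm\<close> is constrained to
  real normed vector spaces. Non-discreteness of the topology is expressed by
  \<^class>\<open>perfect_space\<close>; as translations are homeomorphisms, this is the same as the
  topology not being discrete. The definiteness of \<open>av\<close> follows from the metric axioms.\<close>

class complete_ultrametric_field = field + complete_space + perfect_space +
  fixes av :: "'a \<Rightarrow> real"
  assumes dist_av: "dist x y = av (x - y)"
    and av_mult: "av (x * y) = av x * av y"
    and av_ultrametric: "av (x + y) \<le> max (av x) (av y)"

definition absolute_value :: "('l::field \<Rightarrow> real) \<Rightarrow> bool" where
  "absolute_value v \<longleftrightarrow>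
     (\<forall>x. 0 \<le> v x) \<and> (\<forall>x. v x = 0 \<longleftrightarrow> x = 0) \<and>
     (\<forall>x y. v (x * y) = v x * v y) \<and> (\<forall>x y. v (x + y) \<le> v x + v y)"

definition ac_av :: "'k::complete_ultrametric_field alg_closure \<Rightarrow> real" where
  "ac_av = (THE v. absolute_value v \<and> (\<forall>x. v (to_ac x) = av x))"

text \<open>\<open>K\<^sup>n\<close> is the set of sequences vanishing from index \<open>n\<close> on. Its subspace topology in
  the product topology of \<^typ>\<open>nat \<Rightarrow> 'k\<close> is the product topology of \<open>K\<^sup>n\<close>.
  Carriers instead of index types allow dimension 0 and charts of different dimensions.\<close>

definition coord_space :: "nat \<Rightarrow> (nat \<Rightarrow> 'k::zero) set" where
  "coord_space n = {x. \<forall>i\<ge>n. x i = 0}"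

definition multi_indices :: "nat \<Rightarrow> (nat \<Rightarrow> nat) set" where
  "multi_indices n = {\<nu>. \<forall>i\<ge>n. \<nu> i = 0}"

text \<open>Locally given by convergent power series. The condition includes that \<open>U\<close> is open in
  \<open>K\<^sup>n\<close>. By ultrametricity, the radius can be shrunk so that the series converges in the
  sense \<open>\<bar>c\<^sub>\<nu>\<bar> r\<^bsup>\<bar>\<nu>\<bar>\<^esup> \<rightarrow> 0\<close>.\<close>

definition analytic_between ::
    "nat \<Rightarrow> nat \<Rightarrow> (nat \<Rightarrow> 'k::complete_ultrametric_field) set
      \<Rightarrow> ((nat \<Rightarrow> 'k) \<Rightarrow> (nat \<Rightarrow> 'k)) \<Rightarrow> bool" where
  "analytic_between n m U g \<longleftrightarrow>
     U \<subseteq> coord_space n \<and> g ` U \<subseteq> coord_space m \<and>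
     (\<forall>a\<in>U. \<exists>r>0. \<exists>c :: nat \<Rightarrow> (nat \<Rightarrow> nat) \<Rightarrow> 'k.
        \<forall>x\<in>coord_space n. (\<forall>i<n. av (x i - a i) < r) \<longrightarrow>
          x \<in> U \<and>
          (\<forall>j<m. ((\<lambda>\<nu>. c j \<nu> * (\<Prod>i<n. (x i - a i) ^ \<nu> i)) has_sum g x j) (multi_indices n)))"

text \<open>The directional derivative of \<open>g\<close> at \<open>a\<close> along \<open>h\<close>, which for analytic \<open>g\<close> is the
  value at \<open>h\<close> of the total derivative.\<close>

definition differential ::
    "((nat \<Rightarrow> 'k::complete_ultrametric_field) \<Rightarrow> (nat \<Rightarrow> 'k))
      \<Rightarrow> (nat \<Rightarrow> 'k) \<Rightarrow> (nat \<Rightarrow> 'k) \<Rightarrow> (nat \<Rightarrow> 'k)" where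
  "differential g a h = (\<lambda>j. Lim (at 0) (\<lambda>t. (g (\<lambda>i. a i + t * h i) j - g a j) / t))"

record ('m, 'k) chart =
  chart_dim :: nat
  chart_dom :: "'m set"
  chart_map :: "'m \<Rightarrow> nat \<Rightarrow> 'k"

definition chart_inv :: "('m, 'k) chart \<Rightarrow> (nat \<Rightarrow> 'k) \<Rightarrow> 'm" where
  "chart_inv \<phi> = inv_into (chart_dom \<phi>) (chart_map \<phi>)"

definition is_chart :: "('m::topological_space, 'k::complete_ultrametric_field) chart \<Rightarrow> bool" where
  "is_chart \<phi> \<longleftrightarrow> open (chart_dom \<phi>) \<and>
     openin (top_of_set (coord_space (chart_dim \<phi>))) (chart_map \<phi> ` chart_dom \<phi>) \<and>
     homeomorphism (chart_dom \<phi>) (chart_map \<phi> ` chart_dom \<phi>) (chart_map \<phi>) (chart_inv \<phi>)"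

text \<open>The manifold is the whole type \<open>'m\<close>. The atlas need not be maximal, and the dimension
  may differ between components.\<close>

definition analytic_atlas ::
    "('m::topological_space, 'k::complete_ultrametric_field) chart set \<Rightarrow> bool" where
  "analytic_atlas \<A> \<longleftrightarrow>
     (\<forall>\<phi>\<in>\<A>. is_chart \<phi>) \<and> (\<Union>\<phi>\<in>\<A>. chart_dom \<phi>) = UNIV \<and>
     (\<forall>\<phi>\<in>\<A>. \<forall>\<psi>\<in>\<A>. analytic_between (chart_dim \<phi>) (chart_dim \<psi>)
        (chart_map \<phi> ` (chart_dom \<phi> \<inter> chart_dom \<psi>)) (chart_map \<psi> \<circ> chart_inv \<phi>))"

definition analytic_map ::
    "('m::topological_space, 'k::complete_ultrametric_field) chart set
      \<Rightarrow> 'm set \<Rightarrow> ('m \<Rightarrow> 'm) \<Rightarrow> bool" where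
  "analytic_map \<A> M\<^sub>0 f \<longleftrightarrow> continuous_on M\<^sub>0 f \<and>
     (\<forall>\<phi>\<in>\<A>. \<forall>\<psi>\<in>\<A>. analytic_between (chart_dim \<phi>) (chart_dim \<psi>)
        (chart_map \<phi> ` {x \<in> M\<^sub>0 \<inter> chart_dom \<phi>. f x \<in> chart_dom \<psi>})
        (chart_map \<psi> \<circ> f \<circ> chart_inv \<phi>))"

definition charts_at :: "('m, 'k) chart set \<Rightarrow> 'm \<Rightarrow> ('m, 'k) chart set" where
  "charts_at \<A> p = {\<phi>\<in>\<A>. p \<in> chart_dom \<phi>}"

text \<open>A tangent vector assigns to each chart around the point its coordinate vector in that
  chart, compatibly with the differentials of the chart changes (and 0 to all other charts).
  Vector space operations are pointwise.\<close>

definition tangent_space ::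
    "('m::topological_space, 'k::complete_ultrametric_field) chart set \<Rightarrow> 'm
      \<Rightarrow> (('m, 'k) chart \<Rightarrow> nat \<Rightarrow> 'k) set" where
  "tangent_space \<A> p = {v.
     (\<forall>\<phi>\<in>charts_at \<A> p. v \<phi> \<in> coord_space (chart_dim \<phi>)) \<and>
     (\<forall>\<phi>. \<phi> \<notin> charts_at \<A> p \<longrightarrow> v \<phi> = (\<lambda>_. 0)) \<and>
     (\<forall>\<phi>\<in>charts_at \<A> p. \<forall>\<psi>\<in>charts_at \<A> p.
        v \<psi> = differential (chart_map \<psi> \<circ> chart_inv \<phi>) (chart_map \<phi> p) (v \<phi>))}"

definition tangent_scale ::
    "'k::times \<Rightarrow> (('m, 'k) chart \<Rightarrow> nat \<Rightarrow> 'k) \<Rightarrow> (('m, 'k) chart \<Rightarrow> nat \<Rightarrow> 'k)" where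
  "tangent_scale a v = (\<lambda>\<phi> i. a * v \<phi> i)"

definition tangent_map ::
    "('m::topological_space, 'k::complete_ultrametric_field) chart set \<Rightarrow> 'm \<Rightarrow> ('m \<Rightarrow> 'm)
      \<Rightarrow> (('m, 'k) chart \<Rightarrow> nat \<Rightarrow> 'k) \<Rightarrow> (('m, 'k) chart \<Rightarrow> nat \<Rightarrow> 'k)" where
  "tangent_map \<A> p f v = (THE w. w \<in> tangent_space \<A> (f p) \<and>
     (\<forall>\<phi>\<in>charts_at \<A> p. \<forall>\<psi>\<in>charts_at \<A> (f p).
        w \<psi> = differential (chart_map \<psi> \<circ> f \<circ> chart_inv \<phi>) (chart_map \<phi> p) (v \<phi>)))"

text \<open>The tensor product of a \<open>K\<close>-vector space \<open>V\<close> (a subspace of the type \<open>'v\<close> with scalar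
  multiplication \<open>s\<close>) with the algebraic closure \<open>L\<close>: a formal sum \<open>x\<close> of type
  \<open>'v \<Rightarrow>\<^sub>0 L\<close> with keys in \<open>V\<close> represents the sum of all \<open>v \<otimes> x\<^sub>v\<close>. The following set
  consists of the formal sums representing 0. Additivity in \<open>L\<close> holds by construction.\<close>

inductive_set tensor_null ::
    "('k::field \<Rightarrow> 'v::ab_group_add \<Rightarrow> 'v) \<Rightarrow> 'v set \<Rightarrow> ('v \<Rightarrow>\<^sub>0 'k alg_closure) set"
  for s V where
    zero: "0 \<in> tensor_null s V"
  | diff: "x \<in> tensor_null s V \<Longrightarrow> y \<in> tensor_null s V \<Longrightarrow> x - y \<in> tensor_null s V"
  | additive: "u \<in> V \<Longrightarrow> v \<in> V \<Longrightarrow>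
      Poly_Mapping.single (u + v) l - Poly_Mapping.single u l - Poly_Mapping.single v l
        \<in> tensor_null s V"
  | balanced: "v \<in> V \<Longrightarrow>
      Poly_Mapping.single (s a v) l - Poly_Mapping.single v (to_ac a * l) \<in> tensor_null s V"

text \<open>\<open>\<alpha> \<otimes> id\<close> on representatives.\<close>

definition tensor_map :: "('v \<Rightarrow> 'v) \<Rightarrow> ('v \<Rightarrow>\<^sub>0 'l::comm_monoid_add) \<Rightarrow> ('v \<Rightarrow>\<^sub>0 'l)" where
  "tensor_map \<alpha> x =
     (\<Sum>v\<in>Poly_Mapping.keys x. Poly_Mapping.single (\<alpha> v) (Poly_Mapping.lookup x v))"

definition ac_eigenvalue ::
    "('k::field \<Rightarrow> 'v::ab_group_add \<Rightarrow> 'v) \<Rightarrow> 'v set \<Rightarrow> ('v \<Rightarrow> 'v) \<Rightarrow> 'k alg_closure \<Rightarrow> bool" where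
  "ac_eigenvalue s V \<alpha> \<mu> \<longleftrightarrow>
     (\<exists>x. Poly_Mapping.keys x \<subseteq> V \<and> x \<notin> tensor_null s V \<and>
        tensor_map \<alpha> x - Poly_Mapping.map (\<lambda>l. \<mu> * l) x \<in> tensor_null s V)"

definition eigenvalue_avs ::
    "('k::complete_ultrametric_field \<Rightarrow> 'v::ab_group_add \<Rightarrow> 'v) \<Rightarrow> 'v set \<Rightarrow> ('v \<Rightarrow> 'v) \<Rightarrow> real set"
  where "eigenvalue_avs s V \<alpha> = ac_av ` {\<mu>. ac_eigenvalue s V \<alpha> \<mu>}"

text \<open>Neighbourhoods of \<open>p\<close> in an open set \<open>M\<^sub>0\<close>; they need not be open.\<close>

definition nbhd_in :: "'m::topological_space set \<Rightarrow> 'm \<Rightarrow> 'm set \<Rightarrow> bool" where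
  "nbhd_in M\<^sub>0 p Q \<longleftrightarrow> Q \<subseteq> M\<^sub>0 \<and> p \<in> interior Q"

definition uniformly_attractive ::
    "'m::topological_space set \<Rightarrow> ('m \<Rightarrow> 'm) \<Rightarrow> 'm \<Rightarrow> bool" where
  "uniformly_attractive M\<^sub>0 f p \<longleftrightarrow> f p = p \<and>
     (\<forall>P. nbhd_in M\<^sub>0 p P \<longrightarrow>
        (\<exists>Q. nbhd_in M\<^sub>0 p Q \<and> Q \<subseteq> P \<and> f ` Q \<subseteq> Q \<and> (\<forall>x\<in>Q. (\<lambda>n. (f ^^ n) x) \<longlonglongrightarrow> p)))"

end

theory Submission
  imports Defs
begin

text \<open>In a chart around \<open>p\<close> the map is \<open>g(x) = a + A(x - a) + e(x)\<close>, where \<open>e\<close> is Lipschitz with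
  arbitrarily small constant near \<open>a\<close>. If \<open>s \<le> |\<mu>| \<le> r\<close> for all eigenvalues \<open>\<mu>\<close> of \<open>A\<close> in the algebraic
  closure, then \<open>K\<^sup>n\<close> carries an ultrametric norm \<open>q\<close> with \<open>s q(x) \<le> q(A x) \<le> r q(x)\<close>: take a weighted
  maximum of linear forms over the algebraic closure that triangularise \<open>A\<close>. Balls of \<open>q\<close> are the
  invariant neighbourhoods. Conversely, for an eigenvalue with \<open>|\<mu>| = r\<close> a left eigenvector is a form \<open>l\<close>
  with \<open>l(A x) = \<mu> l(x)\<close>; on the cone where \<open>|l|\<close> is comparable to \<open>q\<close>, the error \<open>e\<close> is negligible, so
  \<open>|l|\<close> grows exactly by the factor \<open>r\<close> along orbits. The same works for \<open>|\<mu>| = s\<close> along backward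
  orbits. This needs no splitting of \<open>K\<^sup>n\<close> into spectral subspaces, hence no factorisation over \<open>K\<close>.\<close>

section \<open>Ultrametric absolute values\<close>

text \<open>K need not be locally compact, so completeness takes the place of compactness of
  spheres, and the eigenvalues lie outside K in general. As \<open>ac_av\<close> is a definite
  description, existence and uniqueness of the extended absolute value have to be settled before
  eigenvalues can be measured at all.

  A right eigenvector has entries in the algebraic closure and is not a displacement between points
  of the manifold. A linear form over the closure can be evaluated at displacements in
  \<open>coord_space n\<close>; hence the change to the transposed matrix.

  There are finitely many eigenvalues, so the extremal absolute values are attained and serve as r
  and s themselves. No constants are lost, because a strictly smaller summand does not alter the
  absolute value of an ultrametric sum. This is what allows the borderline value 1, which separates
  the three statements, to be treated exactly.\<close>

lemma av_zero [simp]: "av (0::'k::complete_ultrametric_field) = 0"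
  using dist_av[of "0::'k" 0] by simp

lemma av_eq_0_iff [simp]: "av x = 0 \<longleftrightarrow> x = (0::'k::complete_ultrametric_field)"
  using dist_av[of x 0] by (metis diff_zero dist_eq_0_iff)

lemma av_nonneg [simp]: "0 \<le> av (x::'k::complete_ultrametric_field)"
  using dist_av[of x 0] by (metis diff_zero zero_le_dist)

lemma av_pos_iff [simp]: "0 < av x \<longleftrightarrow> x \<noteq> (0::'k::complete_ultrametric_field)"
  by (metis av_eq_0_iff av_nonneg less_eq_real_def less_irrefl)

lemma av_one [simp]: "av (1::'k::complete_ultrametric_field) = 1"
  using av_mult[of "1::'k" 1] by simp

lemma av_minus [simp]: "av (- x) = av (x::'k::complete_ultrametric_field)"
  by (metis dist_av dist_commute diff_0 diff_zero)

lemma av_minus_commute: "av (x - y) = av (y - x::'k::complete_ultrametric_field)"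
  by (metis av_minus minus_diff_eq)

lemma av_diff: "av (x - y) \<le> max (av x) (av (y::'k::complete_ultrametric_field))"
  using av_ultrametric[of x "-y"] by simp

lemma av_inverse: "av (inverse x) = inverse (av (x::'k::complete_ultrametric_field))"
proof (cases "x = 0")
  case False
  then have "av x * av (inverse x) = 1" by (metis av_mult av_one right_inverse)
  then show ?thesis by (metis inverse_unique)
qed simp

lemma av_divide: "av (x / y) = av x / av (y::'k::complete_ultrametric_field)"
  by (simp add: divide_inverse av_mult av_inverse)

lemma av_power: "av (x ^ n) = av (x::'k::complete_ultrametric_field) ^ n"
  by (induction n) (auto simp: av_mult)

lemma av_prod: "av (\<Prod>i\<in>F. f i) = (\<Prod>i\<in>F. av (f i :: 'k::complete_ultrametric_field))"
  by (induction F rule: infinite_finite_induct) (auto simp: av_mult)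

lemma av_sum_le:
  fixes f :: "'i \<Rightarrow> 'k::complete_ultrametric_field"
  assumes "0 \<le> B" "\<And>i. i \<in> F \<Longrightarrow> av (f i) \<le> B"
  shows "av (\<Sum>i\<in>F. f i) \<le> B"
  using assms(2)
  by (induction F rule: infinite_finite_induct)
    (auto simp: assms(1) intro: order_trans[OF av_ultrametric])

text \<open>Ultrametricity and \<open>av 1 = 1\<close>. This makes binomial coefficients harmless in
  \<open>power_growth_add\<close>.\<close>

lemma av_of_nat_le: "av (of_nat n :: 'k::complete_ultrametric_field) \<le> 1"
  by (induction n) (auto intro: order_trans[OF av_ultrametric])

text \<open>Non-discreteness in usable form: points can be scaled towards a centre by nonzero
  scalars of arbitrarily small absolute value.\<close>

lemma ex_av_small:
  assumes "0 < e" obtains t :: "'k::complete_ultrametric_field" where "t \<noteq> 0" "av t < e"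
proof -
  have "\<not> open {0::'k}" by (rule not_open_singleton)
  then obtain t :: 'k where "t \<noteq> 0" "dist t 0 < e"
    using assms unfolding open_dist by auto
  then show ?thesis using that[of t] by (simp add: dist_av)
qed

section \<open>The absolute value on the algebraic closure\<close>

text \<open>The image of a coefficient ball under linear combination. E may be linearly dependent,
  so products of generators can simply be adjoined without any change of basis.\<close>

definition bounded_span ::
    "'k::complete_ultrametric_field alg_closure set \<Rightarrow> real \<Rightarrow> 'k alg_closure set" where
  "bounded_span E c = {x. \<exists>a. (\<forall>e\<in>E. av (a e) \<le> c) \<and> x = (\<Sum>e\<in>E. to_ac (a e) * e)}"

lemma bounded_span_mono: "c \<le> d \<Longrightarrow> x \<in> bounded_span E c \<Longrightarrow> x \<in> bounded_span E d"
  unfolding bounded_span_def by (blast intro: order_trans)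

lemma bounded_span_zero: "0 \<le> c \<Longrightarrow> 0 \<in> bounded_span E c"
  unfolding bounded_span_def by (auto intro!: exI[of _ "\<lambda>_. 0"])

lemma bounded_span_base:
  assumes "finite E" "g \<in> E" "av t \<le> c"
  shows "to_ac t * g \<in> bounded_span E c"
proof -
  have "0 \<le> c" using assms(3) av_nonneg[of t] by linarith
  moreover have "(\<Sum>e\<in>E. to_ac (if e = g then t else 0) * e) = (\<Sum>e\<in>E. if e = g then to_ac t * g else 0)"
    by (intro sum.cong) auto
  then have "(\<Sum>e\<in>E. to_ac (if e = g then t else 0) * e) = to_ac t * g"
    using assms(1,2) by (simp add: sum.delta)
  ultimately show ?thesis
    using assms(3) unfolding bounded_span_def
    by (auto intro!: exI[of _ "\<lambda>e. if e = g then t else 0"])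
qed

lemma bounded_span_add:
  assumes "x \<in> bounded_span E c" "y \<in> bounded_span E c"
  shows "x + y \<in> bounded_span E c"
proof -
  obtain a b where "\<forall>e\<in>E. av (a e) \<le> c" "x = (\<Sum>e\<in>E. to_ac (a e) * e)"
    "\<forall>e\<in>E. av (b e) \<le> c" "y = (\<Sum>e\<in>E. to_ac (b e) * e)"
    using assms unfolding bounded_span_def by auto
  then show ?thesis unfolding bounded_span_def
    by (auto intro!: exI[of _ "\<lambda>e. a e + b e"] simp: sum.distrib algebra_simps
        intro: order_trans[OF av_ultrametric])
qed

lemma bounded_span_sum:
  assumes "0 \<le> c" "\<And>i. i \<in> I \<Longrightarrow> f i \<in> bounded_span E c"
  shows "(\<Sum>i\<in>I. f i) \<in> bounded_span E c"
  using assms(2)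
  by (induction I rule: infinite_finite_induct)
    (auto simp: assms(1) bounded_span_zero intro: bounded_span_add)

lemma bounded_span_scale:
  assumes "x \<in> bounded_span E c" shows "to_ac t * x \<in> bounded_span E (av t * c)"
proof -
  obtain a where "\<forall>e\<in>E. av (a e) \<le> c" "x = (\<Sum>e\<in>E. to_ac (a e) * e)"
    using assms unfolding bounded_span_def by auto
  then show ?thesis unfolding bounded_span_def
    by (auto intro!: exI[of _ "\<lambda>e. t * a e"] mult_left_mono
        simp: sum_distrib_left mult.assoc av_mult)
qed

text \<open>M bounds the structure constants of the multiplication. By ultrametricity the bounds
  just multiply, with no factor counting the summands.\<close>

lemma bounded_span_bilinear:
  assumes "x \<in> bounded_span E c" "y \<in> bounded_span F d" "0 \<le> c" "0 \<le> d"
    and "\<And>e f. e \<in> E \<Longrightarrow> f \<in> F \<Longrightarrow> e * f \<in> bounded_span G M" "0 \<le> M"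
  shows "x * y \<in> bounded_span G (c * d * M)"
proof -
  obtain a b where a: "\<forall>e\<in>E. av (a e) \<le> c" "x = (\<Sum>e\<in>E. to_ac (a e) * e)"
    and b: "\<forall>e\<in>F. av (b e) \<le> d" "y = (\<Sum>e\<in>F. to_ac (b e) * e)"
    using assms unfolding bounded_span_def by auto
  have "x * y = (\<Sum>e\<in>E. \<Sum>f\<in>F. to_ac (a e * b f) * (e * f))"
    by (simp add: a b sum_product algebra_simps)
  also have "\<dots> \<in> bounded_span G (c * d * M)"
  proof (intro bounded_span_sum)
    fix e f assume ef: "e \<in> E" "f \<in> F"
    show "to_ac (a e * b f) * (e * f) \<in> bounded_span G (c * d * M)"
      using a b ef assms
      by (intro bounded_span_mono[OF _ bounded_span_scale[OF assms(5)[OF ef]]])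
        (auto simp: av_mult intro!: mult_mono)
  qed (use assms in auto)
  finally show ?thesis .
qed

lemma bounded_span_mult:
  assumes "x \<in> bounded_span E c" "y \<in> bounded_span F d" "0 \<le> c" "0 \<le> d" "finite E" "finite F"
  shows "x * y \<in> bounded_span ((\<lambda>(e, f). e * f) ` (E \<times> F)) (c * d)"
proof -
  have "e * f \<in> bounded_span ((\<lambda>(e, f). e * f) ` (E \<times> F)) 1" if "e \<in> E" "f \<in> F" for e f
    using bounded_span_base[of "(\<lambda>(e, f). e * f) ` (E \<times> F)" "e * f" 1 1] that assms(5,6) by auto
  from bounded_span_bilinear[OF assms(1-4) this] show ?thesis by simp
qed

text \<open>The infimum of all \<open>r\<close> with \<open>power_growth x r\<close> is the spectral radius of
  multiplication by \<open>x\<close>, written without reference to a finite subextension.\<close>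

definition power_growth :: "'k::complete_ultrametric_field alg_closure \<Rightarrow> real \<Rightarrow> bool" where
  "power_growth x r \<longleftrightarrow> 0 < r \<and>
     (\<exists>E C. finite E \<and> 0 \<le> C \<and> (\<forall>k. x ^ k \<in> bounded_span E (C * r ^ k)))"

lemma power_growth_pos: "power_growth x r \<Longrightarrow> 0 < r"
  by (simp add: power_growth_def)

lemma power_growthE:
  assumes "power_growth x r"
  obtains E C where "finite E" "0 \<le> C" "\<And>k. x ^ k \<in> bounded_span E (C * r ^ k)"
  using assms unfolding power_growth_def by auto

lemma power_growthI:
  assumes "0 < r" "finite E" "0 \<le> C" "\<And>k. x ^ k \<in> bounded_span E (C * r ^ k)"
  shows "power_growth x r"
  using assms unfolding power_growth_def by blast

lemma power_growth_mono:
  assumes "power_growth x r" "r \<le> s" shows "power_growth x s"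
proof -
  have r: "0 < r" using assms by (simp add: power_growth_pos)
  from assms(1) show ?thesis
  proof (elim power_growthE)
    fix E C assume "finite E" "0 \<le> C" "\<And>k. x ^ k \<in> bounded_span E (C * r ^ k)"
    then show ?thesis using r assms(2)
      by (intro power_growthI[where E = E and C = C])
        (auto intro: bounded_span_mono[OF mult_left_mono[OF power_mono]])
  qed
qed

lemma power_growth_mult:
  assumes "power_growth x r" "power_growth y s" shows "power_growth (x * y) (r * s)"
proof -
  obtain E C F D where E: "finite E" "0 \<le> C" "\<And>k. x ^ k \<in> bounded_span E (C * r ^ k)"
    and F: "finite F" "0 \<le> D" "\<And>k. y ^ k \<in> bounded_span F (D * s ^ k)"
    using assms by (auto elim!: power_growthE)
  have p: "0 < r" "0 < s" using assms by (auto dest: power_growth_pos)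
  show ?thesis
  proof (rule power_growthI)
    fix k
    show "(x * y) ^ k \<in> bounded_span ((\<lambda>(e, f). e * f) ` (E \<times> F)) (C * D * (r * s) ^ k)"
      using bounded_span_mult[OF E(3)[of k] F(3)[of k]] E F p
      by (simp add: power_mult_distrib mult_ac)
  qed (use E F p in auto)
qed

text \<open>In the binomial expansion the coefficients have absolute value at most 1, and sums do
  not enlarge a bounded span. So \<open>C * D\<close> serves for every k, and the rate is the
  maximum instead of the sum.\<close>

lemma power_growth_add:
  assumes "power_growth x r" "power_growth y s" shows "power_growth (x + y) (max r s)"
proof -
  obtain E C F D where E: "finite E" "0 \<le> C" "\<And>k. x ^ k \<in> bounded_span E (C * r ^ k)"
    and F: "finite F" "0 \<le> D" "\<And>k. y ^ k \<in> bounded_span F (D * s ^ k)"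
    using assms by (auto elim!: power_growthE)
  have p: "0 < r" "0 < s" using assms by (auto dest: power_growth_pos)
  define m where "m = max r s"
  have m: "r \<le> m" "s \<le> m" by (auto simp: m_def)
  show ?thesis unfolding m_def[symmetric]
  proof (rule power_growthI)
    fix k
    let ?G = "(\<lambda>(e, f). e * f) ` (E \<times> F)"
    have "of_nat (k choose i) * x ^ i * y ^ (k - i) \<in> bounded_span ?G (C * D * m ^ k)"
      if "i \<le> k" for i
    proof -
      have "(C * r ^ i) * (D * s ^ (k - i)) \<le> (C * m ^ i) * (D * m ^ (k - i))"
        using p m E F by (intro mult_mono power_mono mult_nonneg_nonneg) auto
      also have "\<dots> = C * D * m ^ k" using that by (simp flip: power_add)
      finally have le: "(C * r ^ i) * (D * s ^ (k - i)) \<le> C * D * m ^ k" .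
      have "x ^ i * y ^ (k - i) \<in> bounded_span ?G ((C * r ^ i) * (D * s ^ (k - i)))"
        using bounded_span_mult[OF E(3)[of i] F(3)[of "k - i"]] E F p by simp
      then have "x ^ i * y ^ (k - i) \<in> bounded_span ?G (C * D * m ^ k)"
        by (rule bounded_span_mono[OF le])
      then have "to_ac (of_nat (k choose i)) * (x ^ i * y ^ (k - i))
          \<in> bounded_span ?G (av (of_nat (k choose i) :: 'a) * (C * D * m ^ k))"
        by (rule bounded_span_scale)
      then have "of_nat (k choose i) * x ^ i * y ^ (k - i)
          \<in> bounded_span ?G (av (of_nat (k choose i) :: 'a) * (C * D * m ^ k))"
        by (simp add: mult.assoc)
      moreover have "av (of_nat (k choose i) :: 'a) * (C * D * m ^ k) \<le> C * D * m ^ k"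
        using av_of_nat_le E F p m by (intro mult_left_le_one_le) auto
      ultimately show ?thesis by (rule bounded_span_mono[rotated])
    qed
    then have "(\<Sum>i\<le>k. of_nat (k choose i) * x ^ i * y ^ (k - i)) \<in> bounded_span ?G (C * D * m ^ k)"
      using E F p m by (intro bounded_span_sum) auto
    then show "(x + y) ^ k \<in> bounded_span ?G (C * D * m ^ k)"
      by (simp add: binomial_ring)
  qed (use E F p m in auto)
qed

lemma power_growth_to_ac:
  assumes "0 < r" "av a \<le> r" shows "power_growth (to_ac a) r"
proof (rule power_growthI)
  fix k
  show "to_ac a ^ k \<in> bounded_span {1} (1 * r ^ k)"
    using bounded_span_base[of "{1}" 1 "a ^ k" "r ^ k"] assms
    by (auto simp: av_power power_mono)
qed (use assms in auto)

text \<open>Division with remainder by m: every power of x is a power of \<open>x ^ m\<close> times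
  one of the finitely many \<open>x ^ j\<close> with j < m, which become additional
  generators.\<close>

lemma power_growth_root:
  assumes "power_growth (x ^ m) (r ^ m)" "0 < m" "0 < r" shows "power_growth x r"
  using assms(1)
proof (elim power_growthE)
  fix E C assume E: "finite E" "0 \<le> C" "\<And>k. (x ^ m) ^ k \<in> bounded_span E (C * (r ^ m) ^ k)"
  define F where "F = (\<lambda>j. x ^ j) ` {..<m}"
  \<comment> \<open>\<open>\<rho> ^ m\<close> bounds every factor \<open>1 / r ^ (k mod m)\<close>
    that is lost when k is rounded down to a multiple of m.\<close>
  define \<rho> where "\<rho> = max 1 (1 / r)"
  let ?G = "(\<lambda>(e, f). e * f) ` (E \<times> F)"
  show ?thesis
  proof (rule power_growthI)
    fix k
    have "x ^ (k mod m) \<in> bounded_span F 1"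
      using bounded_span_base[of F "x ^ (k mod m)" 1 1] assms(2) by (auto simp: F_def)
    then have "(x ^ m) ^ (k div m) * x ^ (k mod m) \<in> bounded_span ?G (C * (r ^ m) ^ (k div m) * 1)"
      using E assms by (intro bounded_span_mult) (auto simp: F_def)
    moreover have "(x ^ m) ^ (k div m) * x ^ (k mod m) = x ^ k"
      by (simp only: power_mult[symmetric] power_add[symmetric] mult_div_mod_eq)
    moreover have "(r ^ m) ^ (k div m) \<le> \<rho> ^ m * r ^ k"
    proof -
      have rr: "r ^ k = (r ^ m) ^ (k div m) * r ^ (k mod m)"
        by (simp only: power_mult[symmetric] power_add[symmetric] mult_div_mod_eq)
      have "(1 / r) ^ (k mod m) \<le> \<rho> ^ (k mod m)" using assms by (intro power_mono) (auto simp: \<rho>_def)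
      also have "\<dots> \<le> \<rho> ^ m" using assms by (intro power_increasing) (auto simp: \<rho>_def)
      finally have "1 / r ^ (k mod m) \<le> \<rho> ^ m" by (simp add: power_divide)
      then have "1 \<le> \<rho> ^ m * r ^ (k mod m)" using assms(3) by (simp add: pos_divide_le_eq)
      then have "(r ^ m) ^ (k div m) * 1 \<le> (r ^ m) ^ (k div m) * (\<rho> ^ m * r ^ (k mod m))"
        using assms by (intro mult_left_mono) auto
      then show ?thesis by (simp add: rr mult_ac)
    qed
    then have "C * (r ^ m) ^ (k div m) * 1 \<le> (C * \<rho> ^ m) * r ^ k"
      using E(2) by (simp add: mult_left_mono mult.assoc)
    ultimately show "x ^ k \<in> bounded_span ?G ((C * \<rho> ^ m) * r ^ k)"
      by (metis bounded_span_mono)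
  qed (use E assms in \<open>auto simp: F_def \<rho>_def\<close>)
qed

lemma alg_closure_power_reduction:
  fixes x :: "'k::complete_ultrametric_field alg_closure"
  obtains d and c :: "nat \<Rightarrow> 'k" where "0 < d" "x ^ d = (\<Sum>i<d. to_ac (c i) * x ^ i)"
proof -
  obtain p :: "'k poly" where p: "p \<noteq> 0" "poly (map_poly to_ac p) x = 0"
    by (rule alg_closure_algebraic)
  define d where "d = Polynomial.degree p"
  define l where "l = Polynomial.coeff p d"
  have l: "l \<noteq> 0" using p by (simp add: l_def d_def)
  have "Polynomial.degree (map_poly to_ac p) = d" by (simp add: d_def degree_map_poly)
  then have s: "(\<Sum>i\<le>d. to_ac (Polynomial.coeff p i) * x ^ i) = 0"
    using p(2) by (simp add: poly_altdef coeff_map_poly)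
  have t: "(\<Sum>i\<le>d. to_ac (Polynomial.coeff p i) * x ^ i)
      = (\<Sum>i<d. to_ac (Polynomial.coeff p i) * x ^ i) + to_ac l * x ^ d"
    by (simp only: l_def lessThan_Suc_atMost[symmetric] sum.lessThan_Suc)
  have e: "to_ac l * x ^ d = - (\<Sum>i<d. to_ac (Polynomial.coeff p i) * x ^ i)"
    using s unfolding t by (rule minus_unique[symmetric])
  have "to_ac (inverse l) * (to_ac l * x ^ d) = to_ac (inverse l * l) * x ^ d"
    by (simp only: to_ac_mult mult.assoc)
  then have "x ^ d = to_ac (inverse l) * (to_ac l * x ^ d)" using l by simp
  then have e2: "x ^ d = (\<Sum>i<d. to_ac (- (inverse l * Polynomial.coeff p i)) * x ^ i)"
    unfolding e by (simp only: mult_minus_right mult_minus_left to_ac_mult to_ac_minus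
        sum_distrib_left sum_negf mult.assoc)
  \<comment> \<open>For d = 0 the sum is empty and the relation would read 1 = 0.\<close>
  have "d \<noteq> 0"
  proof
    assume "d = 0"
    then show False using e2 by simp
  qed
  then have "0 < d" by simp
  from this e2 show ?thesis by (rule that)
qed

text \<open>Multiplication by x maps the powers below d into a bounded span of these same powers, so
  iterating it costs at most a factor M each time.\<close>

lemma ex_power_growth: "\<exists>r. power_growth x r"
proof -
  obtain d c where d: "0 < d" "x ^ d = (\<Sum>i<d. to_ac (c i) * x ^ i)"
    by (rule alg_closure_power_reduction[of x])
  define S where "S = (\<lambda>i. x ^ i) ` {..<d}"
  \<comment> \<open>The inserted 1 covers the shift from \<open>x ^ i\<close> to
    \<open>x ^ Suc i\<close>, whose only coefficient is 1, and makes M positive.\<close>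
  define M where "M = Max (insert 1 ((\<lambda>i. av (c i)) ` {..<d}))"
  have M: "1 \<le> M" "\<And>i. i < d \<Longrightarrow> av (c i) \<le> M" by (auto simp: M_def)
  have fS: "finite S" by (simp add: S_def)
  have step: "x * s \<in> bounded_span S M" if s: "s \<in> S" for s
  proof -
    obtain i where i: "i < d" "s = x ^ i" using s unfolding S_def by blast
    show ?thesis
    proof (cases "Suc i < d")
      case True
      then have "x ^ Suc i \<in> S" unfolding S_def by blast
      from bounded_span_base[OF fS this, of 1 M] show ?thesis using M i by simp
    next
      case False
      then have "x * s = x ^ d" using i by (metis Suc_lessI power_Suc)
      also have "\<dots> \<in> bounded_span S M" unfolding d(2)
        using M unfolding S_def
        by (intro bounded_span_sum bounded_span_base) (auto intro: order_trans[OF zero_le_one])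
      finally show ?thesis .
    qed
  qed
  have "x ^ k \<in> bounded_span S (M ^ k)" for k
  proof (induction k)
    case 0
    have "x ^ 0 \<in> S" unfolding S_def using d(1) by blast
    from bounded_span_base[OF fS this, of 1 1] show ?case by simp
  next
    case (Suc k)
    have "x \<in> bounded_span {x} 1" using bounded_span_base[of "{x}" x 1 1] by simp
    then have "x * x ^ k \<in> bounded_span S (1 * M ^ k * M)"
      using Suc by (rule bounded_span_bilinear) (use M(1) step in auto)
    then show ?case by (simp add: mult.commute)
  qed
  then have pow: "\<And>k. x ^ k \<in> bounded_span S (1 * M ^ k)" by (simp only: mult_1)
  have "0 < M" using M(1) by linarith
  from power_growthI[OF this fS zero_le_one pow] show ?thesis by (rule exI)
qed

interpretation ac: vector_space
  "\<lambda>(a::'k::complete_ultrametric_field) (x::'k alg_closure). to_ac a * x"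
  by standard (auto simp: algebra_simps)

text \<open>Each coordinate of 1 in a basis of the span of E is bounded by a fixed multiple of
  \<open>r ^ k\<close> for every k. For r < 1 all of them would vanish.\<close>

lemma power_growth_one_ge:
  assumes "power_growth (1::'k::complete_ultrametric_field alg_closure) r" shows "1 \<le> r"
proof (rule ccontr)
  assume "\<not> 1 \<le> r"
  then have r: "r < 1" "0 < r" using assms power_growth_pos by auto
  obtain E C where E: "finite E" "0 \<le> C" "\<And>k. (1::'k alg_closure) ^ k \<in> bounded_span E (C * r ^ k)"
    using assms by (rule power_growthE) blast
  obtain B where B: "B \<subseteq> E" "ac.independent B" "E \<subseteq> ac.span B"
    using ac.maximal_independent_subset[of E] by blast
  have fB: "finite B" using B E finite_subset by blast
  have one: "1 \<in> ac.span B"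
  proof -
    have "(1::'k alg_closure) \<in> bounded_span E C" using E(3)[of 0] by simp
    then obtain a where "1 = (\<Sum>e\<in>E. to_ac (a e) * e)" unfolding bounded_span_def by auto
    moreover have "(\<Sum>e\<in>E. to_ac (a e) * e) \<in> ac.span B"
      using B(3) by (auto intro!: ac.span_sum ac.span_scale)
    ultimately show ?thesis by simp
  qed
  have "ac.representation B 1 b = 0" for b
  proof -
    \<comment> \<open>M converts a coefficient bound over the possibly dependent E into a bound for
      the coordinate at b.\<close>
    define M where "M = Max (insert 0 ((\<lambda>e. av (ac.representation B e b)) ` E))"
    have M: "0 \<le> M" "\<And>e. e \<in> E \<Longrightarrow> av (ac.representation B e b) \<le> M"
      using E(1) by (auto simp: M_def)
    have le: "av (ac.representation B 1 b) \<le> C * r ^ k * M" for k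
    proof -
      obtain a where a: "\<forall>e\<in>E. av (a e) \<le> C * r ^ k" "1 = (\<Sum>e\<in>E. to_ac (a e) * e)"
        using E(3)[of k] unfolding bounded_span_def by auto
      have "ac.representation B 1 b = ac.representation B (\<Sum>e\<in>E. to_ac (a e) * e) b"
        using a by simp
      also have "\<dots> = (\<Sum>e\<in>E. a e * ac.representation B e b)"
        using B by (subst ac.representation_sum)
          (auto simp: ac.representation_scale intro!: ac.span_scale sum.cong)
      also have "av \<dots> \<le> C * r ^ k * M"
        using a M E r by (intro av_sum_le) (auto simp: av_mult intro!: mult_mono)
      finally show ?thesis .
    qed
    have "(\<lambda>k. C * r ^ k * M) \<longlonglongrightarrow> C * 0 * M"
      using r by (intro tendsto_intros LIMSEQ_power_zero) auto
    then have "av (ac.representation B 1 b) \<le> 0"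
      using le by (intro LIMSEQ_le_const[of "\<lambda>k. C * r ^ k * M"]) auto
    then show ?thesis by (metis av_eq_0_iff av_nonneg order_antisym)
  qed
  then have "(1::'k alg_closure) = 0"
    using ac.sum_representation_eq[OF B(2) one fB] by simp
  then show False by simp
qed

section \<open>The spectral norm as a power-multiplicative norm\<close>

definition spectral_norm :: "'k::complete_ultrametric_field alg_closure \<Rightarrow> real" where
  "spectral_norm x = Inf {r. power_growth x r}"

lemma spectral_norm_le: "power_growth x r \<Longrightarrow> spectral_norm x \<le> r"
  unfolding spectral_norm_def
  by (intro cInf_lower) (auto intro!: bdd_belowI[of _ 0] less_imp_le dest: power_growth_pos)

lemma spectral_norm_greatest: "(\<And>r. power_growth x r \<Longrightarrow> m \<le> r) \<Longrightarrow> m \<le> spectral_norm x"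
  unfolding spectral_norm_def using ex_power_growth by (intro cInf_greatest) auto

lemma power_growth_if_less: "spectral_norm x < s \<Longrightarrow> power_growth x s"
  unfolding spectral_norm_def using ex_power_growth[of x] cInf_lessD[of "{r. power_growth x r}" s]
  by (auto intro: power_growth_mono)

lemma spectral_norm_nonneg [simp]: "0 \<le> spectral_norm x"
  by (intro spectral_norm_greatest) (auto dest: power_growth_pos)

lemma spectral_norm_to_ac_le: "spectral_norm (to_ac a) \<le> av a"
proof (rule dense_ge)
  fix r assume "av a < r"
  then show "spectral_norm (to_ac a) \<le> r"
    using av_nonneg[of a] by (intro spectral_norm_le power_growth_to_ac) linarith+
qed

lemma spectral_norm_zero [simp]: "spectral_norm 0 = 0"
  using spectral_norm_to_ac_le[of 0] by (intro order_antisym) auto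

lemma spectral_norm_one [simp]: "spectral_norm 1 = 1"
proof (rule order_antisym)
  show "spectral_norm 1 \<le> 1" using spectral_norm_to_ac_le[of 1] by simp
qed (intro spectral_norm_greatest power_growth_one_ge)

lemma spectral_norm_mult_le: "spectral_norm (x * y) \<le> spectral_norm x * spectral_norm y"
proof -
  have "spectral_norm (x * y) \<le> (spectral_norm x + e) * (spectral_norm y + e)" if "0 < e" for e
    using that by (intro spectral_norm_le power_growth_mult power_growth_if_less) auto
  then have "eventually (\<lambda>e. spectral_norm (x * y) \<le> (spectral_norm x + e) * (spectral_norm y + e))
      (at_right 0)"
    by (rule eventually_mono[OF eventually_at_right_less])
  moreover have "((\<lambda>e. (spectral_norm x + e) * (spectral_norm y + e))
      \<longlongrightarrow> (spectral_norm x + 0) * (spectral_norm y + 0)) (at_right 0)"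
    by (intro tendsto_intros)
  ultimately show ?thesis
    by (intro tendsto_lowerbound[of "\<lambda>e. (spectral_norm x + e) * (spectral_norm y + e)"]) auto
qed

lemma spectral_norm_add_le: "spectral_norm (x + y) \<le> max (spectral_norm x) (spectral_norm y)"
proof (rule dense_ge)
  fix s assume s: "max (spectral_norm x) (spectral_norm y) < s"
  then have "power_growth (x + y) (max s s)" by (intro power_growth_add power_growth_if_less) auto
  then show "spectral_norm (x + y) \<le> s" by (simp add: spectral_norm_le)
qed

text \<open>One inequality is submultiplicativity; the other extracts m-th roots of growth rates
  with \<open>power_growth_root\<close>. Full multiplicativity will be derived from this special
  case.\<close>

lemma spectral_norm_power: "spectral_norm (x ^ m) = spectral_norm x ^ m"
proof (rule order_antisym)
  show "spectral_norm (x ^ m) \<le> spectral_norm x ^ m"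
  proof (induction m)
    case (Suc m)
    have "spectral_norm (x * x ^ m) \<le> spectral_norm x * spectral_norm (x ^ m)"
      by (rule spectral_norm_mult_le)
    also have "\<dots> \<le> spectral_norm x * spectral_norm x ^ m"
      using Suc by (intro mult_left_mono) auto
    finally show ?case by simp
  qed simp
  show "spectral_norm x ^ m \<le> spectral_norm (x ^ m)"
  proof (cases "m = 0")
    case False
    show ?thesis
    proof (rule spectral_norm_greatest)
      fix r assume r: "power_growth (x ^ m) r"
      then have rp: "0 < r" by (rule power_growth_pos)
      have "power_growth x (root m r)"
      proof (rule power_growth_root)
        show "power_growth (x ^ m) (root m r ^ m)" using r rp False by simp
      qed (use rp False in auto)
      then have "spectral_norm x ^ m \<le> root m r ^ m"
        by (intro power_mono spectral_norm_le) auto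
      then show "spectral_norm x ^ m \<le> r" using rp False by simp
    qed
  qed simp
qed

text \<open>The upper bound is applied to a and also to its inverse.\<close>

lemma spectral_norm_scale: "spectral_norm (to_ac a * x) = av a * spectral_norm x"
proof (cases "a = 0")
  case False
  have le: "spectral_norm (to_ac b * y) \<le> av b * spectral_norm y" for b :: 'a and y
    using spectral_norm_mult_le[of "to_ac b" y] spectral_norm_to_ac_le[of b]
    by (intro order_trans[OF spectral_norm_mult_le mult_right_mono]) auto
  have "to_ac (inverse a) * (to_ac a * x) = to_ac (inverse a * a) * x"
    by (simp only: to_ac_mult mult.assoc)
  also have "\<dots> = x" using False by simp
  finally have "spectral_norm x = spectral_norm (to_ac (inverse a) * (to_ac a * x))"
    by (rule arg_cong[where f = spectral_norm, OF sym])
  also have "\<dots> \<le> inverse (av a) * spectral_norm (to_ac a * x)"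
    using le[of "inverse a" "to_ac a * x"] by (simp only: av_inverse)
  finally have "av a * spectral_norm x \<le> spectral_norm (to_ac a * x)"
    using False by (simp add: field_simps)
  with le[of a x] show ?thesis by simp
qed simp

text \<open>In a field, 1 = x * inverse x already bounds the product of the two values from
  below.\<close>

lemma spectral_norm_pos:
  assumes "x \<noteq> 0" shows "0 < spectral_norm x"
proof -
  have "1 \<le> spectral_norm x * spectral_norm (inverse x)"
    using spectral_norm_mult_le[of x "inverse x"] assms by simp
  then have "spectral_norm x \<noteq> 0" by auto
  then show ?thesis using spectral_norm_nonneg[of x] by linarith
qed

text \<open>Half of the equivalence of norms on a finite-dimensional space. Completeness of K makes
  the span of the earlier basis vectors closed, so the next basis vector has positive distance from
  it.\<close>

lemma ac_norm_lower_bound: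
  fixes B :: "'k::complete_ultrametric_field alg_closure set" and N :: "'k alg_closure \<Rightarrow> real"
  assumes "finite B" "ac.independent B"
    and add: "\<And>x y. N (x + y) \<le> N x + N y"
    and scale: "\<And>a x. N (to_ac a * x) = av a * N x"
    and pos: "\<And>x. x \<noteq> 0 \<Longrightarrow> 0 < N x"
  shows "\<exists>c>0. \<forall>a. \<forall>b\<in>B. c * av (a b) \<le> N (\<Sum>b\<in>B. to_ac (a b) * b)"
  using assms(1,2)
proof (induction B rule: finite_induct)
  case empty
  show ?case by (auto intro: exI[of _ 1])
next
  case (insert e B)
  have ind: "ac.independent B" using insert.prems by (rule ac.independent_mono) auto
  then obtain c where c: "0 < c" "\<And>a b. b \<in> B \<Longrightarrow> c * av (a b) \<le> N (\<Sum>b\<in>B. to_ac (a b) * b)"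
    using insert.IH by auto
  have N0: "N 0 = 0" using scale[of 0 0] by simp
  have nn: "0 \<le> N x" for x using pos[of x] N0 by (cases "x = 0") auto
  have Nminus: "N (- x) = N x" for x using scale[of "-1" x] by simp
  have e: "e \<notin> ac.span B" using insert by (simp add: ac.independent_insert)
  \<comment> \<open>If the distance were 0, the coefficients of an approximating sequence would be
    Cauchy by the induction hypothesis, and their limits would place e in the span of B.\<close>
  have "\<exists>d>0. \<forall>a. d \<le> N (e + (\<Sum>b\<in>B. to_ac (a b) * b))"
  proof (rule ccontr)
    assume neg: "\<not> ?thesis"
    have "\<exists>a. N (e + (\<Sum>b\<in>B. to_ac (a b) * b)) < 1 / real (Suc n)" for n
    proof (rule ccontr)
      assume "\<not> (\<exists>a. N (e + (\<Sum>b\<in>B. to_ac (a b) * b)) < 1 / real (Suc n))"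
      then have "0 < 1 / real (Suc n) \<and> (\<forall>a. 1 / real (Suc n) \<le> N (e + (\<Sum>b\<in>B. to_ac (a b) * b)))"
        by (simp add: not_less)
      then have "\<exists>d>0. \<forall>a. d \<le> N (e + (\<Sum>b\<in>B. to_ac (a b) * b))" by (rule exI)
      with neg show False by (rule notE)
    qed
    then obtain a where a: "\<And>n. N (e + (\<Sum>b\<in>B. to_ac (a n b) * b)) < 1 / real (Suc n)"
      by metis
    define w where "w = (\<lambda>n. \<Sum>b\<in>B. to_ac (a n b) * b)"
    have aw: "N (e + w n) < 1 / real (Suc n)" for n using a by (simp add: w_def)
    have small: "\<exists>M. \<forall>n\<ge>M. N (e + w n) < \<epsilon>" if eps: "0 < \<epsilon>" for \<epsilon>
    proof -
      obtain M where M: "1 / real (Suc M) < \<epsilon>" by (rule nat_approx_posE[OF eps])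
      have "N (e + w n) < \<epsilon>" if "M \<le> n" for n
      proof -
        have "1 / real (Suc n) \<le> 1 / real (Suc M)" using that by (simp add: frac_le)
        then show ?thesis using aw[of n] M by linarith
      qed
      then show ?thesis by blast
    qed
    have diff: "w m - w n = (\<Sum>b\<in>B. to_ac (a m b - a n b) * b)" for m n
      by (simp add: w_def sum_subtractf algebra_simps)
    have "Cauchy (\<lambda>n. a n b)" if b: "b \<in> B" for b
    proof (rule metric_CauchyI)
      fix \<epsilon> :: real assume "0 < \<epsilon>"
      then have "0 < \<epsilon> * c / 2" using c(1) by simp
      from small[OF this] obtain M where M: "\<And>n. n \<ge> M \<Longrightarrow> N (e + w n) < \<epsilon> * c / 2" by auto
      have "dist (a m b) (a n b) < \<epsilon>" if "m \<ge> M" "n \<ge> M" for m n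
      proof -
        have "c * av (a m b - a n b) \<le> N (w m - w n)"
          unfolding diff using c(2)[OF b, of "\<lambda>b. a m b - a n b"] .
        moreover have "N (w m - w n) \<le> N (e + w m) + N (e + w n)"
          using add[of "e + w m" "- (e + w n)"] unfolding Nminus by simp
        ultimately have "c * av (a m b - a n b) < \<epsilon> * c"
          using M[OF that(1)] M[OF that(2)] by linarith
        then show ?thesis using c(1) by (simp add: dist_av)
      qed
      then show "\<exists>M. \<forall>m\<ge>M. \<forall>n\<ge>M. dist (a m b) (a n b) < \<epsilon>" by blast
    qed
    then have "\<forall>b\<in>B. \<exists>l. (\<lambda>n. a n b) \<longlonglongrightarrow> l"
      by (simp add: Cauchy_convergent_iff convergent_def)
    then obtain l where l: "\<And>b. b \<in> B \<Longrightarrow> (\<lambda>n. a n b) \<longlonglongrightarrow> l b" by metis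
    define v where "v = (\<Sum>b\<in>B. to_ac (l b) * b)"
    have Nsum: "N (\<Sum>b\<in>F. g b) \<le> (\<Sum>b\<in>F. N (g b))" for F and g :: "'k alg_closure \<Rightarrow> 'k alg_closure"
    proof (induction F rule: infinite_finite_induct)
      case (insert x F)
      have "N (g x + sum g F) \<le> N (g x) + N (sum g F)" by (rule add)
      with insert show ?case by simp
    qed (simp_all add: N0)
    have "N (e + v) \<le> 1 / real (Suc n) + (\<Sum>b\<in>B. dist (l b) (a n b) * N b)" for n
    proof -
      have "v - w n = (\<Sum>b\<in>B. to_ac (l b - a n b) * b)"
        by (simp add: w_def v_def sum_subtractf algebra_simps)
      then have "N (v - w n) \<le> (\<Sum>b\<in>B. dist (l b) (a n b) * N b)"
        using Nsum[of "\<lambda>b. to_ac (l b - a n b) * b" B] unfolding scale dist_av by (simp only:)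
      moreover have "N (e + v) \<le> N (e + w n) + N (v - w n)"
        using add[of "e + w n" "v - w n"] by (simp add: algebra_simps)
      ultimately show ?thesis using aw[of n] by linarith
    qed
    moreover have "(\<lambda>n. 1 / real (Suc n) + (\<Sum>b\<in>B. dist (l b) (a n b) * N b))
        \<longlonglongrightarrow> 0 + (\<Sum>b\<in>B. dist (l b) (l b) * N b)"
      using l by (intro tendsto_intros LIMSEQ_Suc[OF lim_1_over_n]) auto
    ultimately have "N (e + v) \<le> 0 + (\<Sum>b\<in>B. dist (l b) (l b) * N b)"
      by (intro LIMSEQ_le_const) auto
    then have "N (e + v) \<le> 0" by simp
    then have "e + v = 0" using pos[of "e + v"] by fastforce
    then have "e = - v" by (simp add: eq_neg_iff_add_eq_0)
    moreover have "v \<in> ac.span B" unfolding v_def by (intro ac.span_sum ac.span_scale ac.span_base)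
    ultimately show False using e ac.span_neg by blast
  qed
  then obtain d where d: "0 < d" "\<And>a. d \<le> N (e + (\<Sum>b\<in>B. to_ac (a b) * b))" by auto
  \<comment> \<open>Division by s reduces a general coefficient of e to the coefficient 1.\<close>
  have low: "d * av s \<le> N (to_ac s * e + (\<Sum>b\<in>B. to_ac (a b) * b))" for s a
  proof (cases "s = 0")
    case True
    then show ?thesis using nn by simp
  next
    case False
    have "to_ac s * (e + (\<Sum>b\<in>B. to_ac (a b / s) * b)) = to_ac s * e + (\<Sum>b\<in>B. to_ac (a b) * b)"
      using False by (simp add: distrib_left sum_distrib_left)
    then have "N (to_ac s * e + (\<Sum>b\<in>B. to_ac (a b) * b))
        = av s * N (e + (\<Sum>b\<in>B. to_ac (a b / s) * b))"
      unfolding scale[symmetric] by (simp only:)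
    moreover have "av s * d \<le> av s * N (e + (\<Sum>b\<in>B. to_ac (a b / s) * b))"
      by (intro mult_left_mono d) auto
    ultimately show ?thesis by (simp add: mult.commute)
  qed
  \<comment> \<open>If z is the norm of the whole combination, its e-part has norm at most
    \<open>z / d * N e\<close>; removing that part leaves norm at most \<open>z * K\<close>.\<close>
  define K where "K = 1 + N e / d"
  have K: "0 < K" using nn[of e] d(1) unfolding K_def by (simp add: add_pos_nonneg)
  show ?case
  proof (intro exI[of _ "min d (c / K)"] conjI allI ballI)
    show "0 < min d (c / K)" using d c K by simp
    fix a b assume b: "b \<in> insert e B"
    define y where "y = (\<Sum>b\<in>B. to_ac (a b) * b)"
    have sum: "(\<Sum>b\<in>insert e B. to_ac (a b) * b) = to_ac (a e) * e + y"
      using insert.hyps by (simp add: y_def)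
    have l1: "d * av (a e) \<le> N (to_ac (a e) * e + y)" unfolding y_def by (rule low)
    show "min d (c / K) * av (a b) \<le> N (\<Sum>b\<in>insert e B. to_ac (a b) * b)"
    proof (cases "b = e")
      case True
      have "min d (c / K) * av (a e) \<le> d * av (a e)" by (intro mult_right_mono) auto
      then show ?thesis using l1 unfolding sum True by linarith
    next
      case False
      define z where "z = N (to_ac (a e) * e + y)"
      from False b have "b \<in> B" by simp
      then have "c * av (a b) \<le> N y" unfolding y_def by (rule c(2))
      moreover have "N y \<le> z + av (a e) * N e"
        using add[of "to_ac (a e) * e + y" "- (to_ac (a e) * e)"] unfolding Nminus scale z_def by simp
      moreover have "av (a e) \<le> z / d" using l1 d(1) unfolding z_def by (simp add: field_simps)
      then have "av (a e) * N e \<le> z / d * N e"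
        using nn by (intro mult_right_mono)
      moreover have "z * K = z + z / d * N e" by (simp add: K_def algebra_simps)
      ultimately have "c * av (a b) \<le> z * K" by linarith
      then have "c / K * av (a b) \<le> N (to_ac (a e) * e + y)"
        using K unfolding z_def by (simp add: field_simps)
      moreover have "min d (c / K) * av (a b) \<le> c / K * av (a b)" by (intro mult_right_mono) auto
      ultimately show ?thesis unfolding sum by linarith
    qed
  qed
qed

lemma alg_closure_powers_in_span:
  fixes x :: "'k::complete_ultrametric_field alg_closure"
  obtains B where "finite B" "ac.independent B" "\<And>k. x ^ k \<in> ac.span B"
proof -
  obtain d and c :: "nat \<Rightarrow> 'k" where d: "0 < d" "x ^ d = (\<Sum>i<d. to_ac (c i) * x ^ i)"
    by (rule alg_closure_power_reduction[of x])
  define S where "S = (\<lambda>i. x ^ i) ` {..<d}"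
  have mem: "x ^ i \<in> ac.span S" if "i < d" for i
    using that unfolding S_def by (intro ac.span_base) blast
  have "x ^ d \<in> ac.span S" unfolding d(2) by (intro ac.span_sum ac.span_scale mem) auto
  then have mem': "x ^ i \<in> ac.span S" if "i \<le> d" for i using that mem by (cases "i = d") auto
  have step: "x * y \<in> ac.span S" if "y \<in> ac.span S" for y
    using that
  proof (induction rule: ac.span_induct_alt)
    case base
    show ?case by (simp add: ac.span_zero)
  next
    case (step a s z)
    then obtain i where i: "i < d" "s = x ^ i" unfolding S_def by blast
    have "x ^ Suc i \<in> ac.span S" using i by (intro mem') simp
    then have "to_ac a * x ^ Suc i + x * z \<in> ac.span S"
      using step by (intro ac.span_add ac.span_scale)
    moreover have "x * (to_ac a * s + z) = to_ac a * x ^ Suc i + x * z"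
      by (simp add: i algebra_simps)
    ultimately show ?case by simp
  qed
  have pow: "x ^ k \<in> ac.span S" for k
  proof (induction k)
    case 0
    show ?case using d(1) by (rule mem)
  next
    case (Suc k)
    from step[OF this] show ?case by simp
  qed
  obtain B where B: "B \<subseteq> S" "ac.independent B" "S \<subseteq> ac.span B"
    using ac.maximal_independent_subset[of S] by blast
  show ?thesis
  proof (rule that)
    show "finite B" using B(1) by (rule finite_subset) (simp add: S_def)
    show "ac.independent B" by fact
    have "ac.span S \<subseteq> ac.span B" using B(3) by (rule ac.span_minimal) (rule ac.subspace_span)
    then show "x ^ k \<in> ac.span B" for k using pow by blast
  qed
qed

text \<open>Multiplicativity by smoothing: \<open>S x = lim N(x y\<^sup>n) / N(y)\<^sup>n\<close> is again a norm below the
  spectral norm \<open>N\<close>, and \<open>S (x y) = S x \<cdot> N y\<close>. As all norms on \<open>K[x]\<close> are equivalent,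
  the powers of \<open>x\<close> grow no faster than those of \<open>S x\<close>, hence \<open>N \<le> S\<close>.\<close>

lemma spectral_norm_mult:
  "spectral_norm (x * y) = spectral_norm x * spectral_norm (y :: 'k::complete_ultrametric_field alg_closure)"
proof (cases "x = 0 \<or> y = 0")
  case True
  then show ?thesis by auto
next
  case False
  then have nz: "x \<noteq> 0" "y \<noteq> 0" by auto
  define N where "N = (spectral_norm :: 'k alg_closure \<Rightarrow> real)"
  have Ny: "0 < N y" unfolding N_def using nz by (intro spectral_norm_pos)
  have N_nonneg: "0 \<le> N z" for z by (simp add: N_def)
  define T where "T = (\<lambda>z n. N (z * y ^ n) / N y ^ n)"
  define S where "S = (\<lambda>z. lim (T z))"
  have T_nonneg: "0 \<le> T z n" for z n using N_nonneg Ny by (simp add: T_def)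
  have "T z (Suc n) \<le> T z n" for z n
  proof -
    have "N (z * y ^ Suc n) = N (z * y ^ n * y)" by (simp add: mult_ac)
    also have "\<dots> \<le> N (z * y ^ n) * N y" unfolding N_def by (rule spectral_norm_mult_le)
    finally show ?thesis using Ny by (simp add: T_def field_simps)
  qed
  then have dec: "decseq (T z)" for z by (rule decseq_SucI)
  have lim: "T z \<longlonglongrightarrow> S z" for z
  proof -
    obtain L where "T z \<longlonglongrightarrow> L"
      using T_nonneg decseq_convergent[OF dec, of 0] by blast
    then show ?thesis unfolding S_def by (simp add: limI)
  qed
  have S_add: "S (z + w) \<le> S z + S w" for z w
  proof (rule LIMSEQ_le[OF lim tendsto_add[OF lim lim]], intro exI allI impI)
    fix n
    have "N (z * y ^ n + w * y ^ n) \<le> max (N (z * y ^ n)) (N (w * y ^ n))"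
      unfolding N_def by (rule spectral_norm_add_le)
    also have "\<dots> \<le> N (z * y ^ n) + N (w * y ^ n)"
      using N_nonneg[of "z * y ^ n"] N_nonneg[of "w * y ^ n"] by simp
    finally show "T (z + w) n \<le> T z n + T w n"
      using Ny by (simp add: T_def divide_right_mono distrib_right flip: add_divide_distrib)
  qed
  have S_scale: "S (to_ac a * z) = av a * S z" for a z
  proof (rule LIMSEQ_unique[OF lim])
    have "T (to_ac a * z) = (\<lambda>n. av a * T z n)"
      by (simp add: T_def N_def mult.assoc spectral_norm_scale)
    then show "T (to_ac a * z) \<longlonglongrightarrow> av a * S z" using tendsto_mult_left[OF lim] by simp
  qed
  have S_mult: "S (z * w) \<le> S z * S w" for z w
  proof (rule LIMSEQ_le[OF _ tendsto_mult[OF lim lim]])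
    \<comment> \<open>An even power of y splits equally between the two factors, which gives the
      inequality along a subsequence; the limit is the same.\<close>
    have "strict_mono (\<lambda>n::nat. 2 * n)" by (rule strict_monoI) simp
    from LIMSEQ_subseq_LIMSEQ[OF lim this] show "(\<lambda>n. T (z * w) (2 * n)) \<longlonglongrightarrow> S (z * w)"
      by (simp add: o_def)
    have "T (z * w) (2 * n) \<le> T z n * T w n" for n
    proof -
      have "z * w * y ^ (2 * n) = (z * y ^ n) * (w * y ^ n)"
        unfolding mult_2 power_add by (simp only: mult_ac)
      then have "N (z * w * y ^ (2 * n)) \<le> N (z * y ^ n) * N (w * y ^ n)"
        unfolding N_def by (simp only: spectral_norm_mult_le)
      then have "N (z * w * y ^ (2 * n)) / N y ^ (2 * n) \<le> N (z * y ^ n) * N (w * y ^ n) / N y ^ (2 * n)"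
        using Ny by (intro divide_right_mono) auto
      then show ?thesis by (simp add: T_def mult_2 power_add)
    qed
    then show "\<exists>M. \<forall>n\<ge>M. T (z * w) (2 * n) \<le> T z n * T w n" by blast
  qed
  have S_one: "S 1 = 1"
  proof (rule LIMSEQ_unique[OF lim])
    \<comment> \<open>Power-multiplicativity is decisive here: from submultiplicativity alone
      \<open>T 1\<close> might decay.\<close>
    have "T 1 = (\<lambda>n. 1)" using Ny by (simp add: T_def N_def spectral_norm_power)
    then show "T 1 \<longlonglongrightarrow> 1" by simp
  qed
  have S_nonneg: "0 \<le> S z" for z
    by (rule LIMSEQ_le_const[OF lim]) (auto simp: T_nonneg)
  have S_pos: "0 < S z" if "z \<noteq> 0" for z
  proof -
    have "1 \<le> S z * S (inverse z)" using S_mult[of z "inverse z"] that S_one by simp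
    then have "S z \<noteq> 0" by auto
    then show ?thesis using S_nonneg[of z] by linarith
  qed
  have S_power: "S (x ^ k) \<le> S x ^ k" for k
  proof (induction k)
    case (Suc k)
    have "S (x * x ^ k) \<le> S x * S (x ^ k)" by (rule S_mult)
    also have "\<dots> \<le> S x * S x ^ k" using Suc S_nonneg by (intro mult_left_mono)
    finally show ?case by simp
  qed (simp add: S_one)
  obtain B where B: "finite B" "ac.independent B" "\<And>k. x ^ k \<in> ac.span B"
    by (rule alg_closure_powers_in_span[of x]) blast
  have "\<exists>c>0. \<forall>a. \<forall>b\<in>B. c * av (a b) \<le> S (\<Sum>b\<in>B. to_ac (a b) * b)"
    by (intro ac_norm_lower_bound B S_add S_scale S_pos)
  then obtain c where "0 < c \<and> (\<forall>a. \<forall>b\<in>B. c * av (a b) \<le> S (\<Sum>b\<in>B. to_ac (a b) * b))" ..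
  then have c: "0 < c" "\<And>a b. b \<in> B \<Longrightarrow> c * av (a b) \<le> S (\<Sum>b\<in>B. to_ac (a b) * b)"
    by simp_all
  \<comment> \<open>The norm comparison turns \<open>S_power\<close> into bounds for the
    coefficients of \<open>x ^ k\<close> in the basis B, so \<open>S x\<close> is an admissible
    growth rate of x.\<close>
  have "power_growth x (S x)"
  proof (rule power_growthI)
    show "0 < S x" using nz by (intro S_pos)
    show "x ^ k \<in> bounded_span B (1 / c * S x ^ k)" for k
    proof -
      define a where "a = ac.representation B (x ^ k)"
      have a: "(\<Sum>b\<in>B. to_ac (a b) * b) = x ^ k"
        unfolding a_def using B by (intro ac.sum_representation_eq) auto
      have "av (a b) \<le> 1 / c * S x ^ k" if "b \<in> B" for b
      proof -
        have "c * av (a b) \<le> S x ^ k" using c(2)[OF that, of a] S_power[of k] unfolding a by linarith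
        then show ?thesis using c(1) by (simp add: field_simps)
      qed
      then show ?thesis unfolding bounded_span_def using a[symmetric] by blast
    qed
  qed (use B c in auto)
  then have "N x \<le> S x" unfolding N_def by (rule spectral_norm_le)
  then have "N x * N y \<le> S x * N y" using Ny by (intro mult_right_mono) auto
  \<comment> \<open>An index shift: one factor y moves from the power into the argument.\<close>
  also have "S x * N y = S (x * y)"
  proof (rule LIMSEQ_unique[OF _ lim])
    have "(\<lambda>n. T x (Suc n) * N y) \<longlonglongrightarrow> S x * N y"
      by (intro tendsto_intros LIMSEQ_Suc lim)
    moreover have "T x (Suc n) * N y = T (x * y) n" for n
      using Ny by (simp add: T_def mult_ac)
    ultimately show "T (x * y) \<longlonglongrightarrow> S x * N y" by simp
  qed
  also have "S (x * y) \<le> N (x * y)"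
  proof (rule LIMSEQ_le_const2[OF lim], intro exI allI impI)
    fix n
    have "N (x * y * y ^ n) \<le> N (x * y) * N (y ^ n)" unfolding N_def by (rule spectral_norm_mult_le)
    then show "T (x * y) n \<le> N (x * y)"
      using Ny by (simp add: T_def N_def spectral_norm_power field_simps)
  qed
  finally show ?thesis using spectral_norm_mult_le[of x y] by (simp add: N_def)
qed

section \<open>Existence and uniqueness of the extended absolute value\<close>

lemma spectral_norm_to_ac: "spectral_norm (to_ac a) = av a"
  using spectral_norm_scale[of a 1] by simp

lemma absolute_value_spectral_norm:
  "absolute_value (spectral_norm :: 'k::complete_ultrametric_field alg_closure \<Rightarrow> real)"
  unfolding absolute_value_def
proof (intro conjI allI)
  fix x y :: "'k alg_closure"
  show "spectral_norm x = 0 \<longleftrightarrow> x = 0" using spectral_norm_pos[of x] by fastforce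
  show "spectral_norm (x + y) \<le> spectral_norm x + spectral_norm y"
    using spectral_norm_add_le[of x y] spectral_norm_nonneg[of x] spectral_norm_nonneg[of y]
    by linarith
qed (simp_all add: spectral_norm_mult)

text \<open>For v only the ordinary triangle inequality is available. Applied to the expansions of
  \<open>x ^ k\<close> over a fixed finite E it bounds all powers of \<open>v x / r\<close> by one
  constant, and this forces \<open>v x / r\<close> to be at most 1.\<close>

lemma absolute_value_le_spectral_norm:
  fixes v :: "'k::complete_ultrametric_field alg_closure \<Rightarrow> real"
  assumes v: "absolute_value v" and ext: "\<And>a. v (to_ac a) = av a"
  shows "v x \<le> spectral_norm x"
proof (rule spectral_norm_greatest)
  fix r assume "power_growth x r"
  then obtain E C where E: "finite E" "0 \<le> C" "\<And>k. x ^ k \<in> bounded_span E (C * r ^ k)" and r: "0 < r"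
    by (metis power_growthE power_growth_pos)
  have vm: "v (a * b) = v a * v b" and va: "v (a + b) \<le> v a + v b" and v_nonneg: "0 \<le> v a" for a b
    using v unfolding absolute_value_def by auto
  have v0: "v 0 = 0" and v1: "v 1 = 1" using ext[of 0] ext[of 1] by simp_all
  have v_sum: "v (\<Sum>e\<in>F. g e) \<le> (\<Sum>e\<in>F. v (g e))" for F and g :: "'k alg_closure \<Rightarrow> 'k alg_closure"
  proof (induction F rule: infinite_finite_induct)
    case (insert e F)
    have "v (g e + sum g F) \<le> v (g e) + v (sum g F)" by (rule va)
    with insert show ?case by simp
  qed (simp_all add: v0)
  have v_pow: "v (x ^ k) = v x ^ k" for k by (induction k) (simp_all add: v1 vm)
  define D where "D = C * (\<Sum>e\<in>E. v e)"
  have bound: "(v x / r) ^ k \<le> D" for k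
  proof -
    obtain a where a: "\<forall>e\<in>E. av (a e) \<le> C * r ^ k" "x ^ k = (\<Sum>e\<in>E. to_ac (a e) * e)"
      using E(3)[of k] unfolding bounded_span_def by auto
    have "v x ^ k = v (\<Sum>e\<in>E. to_ac (a e) * e)" unfolding a(2)[symmetric] v_pow ..
    also have "\<dots> \<le> (\<Sum>e\<in>E. v (to_ac (a e) * e))" by (rule v_sum)
    also have "\<dots> \<le> (\<Sum>e\<in>E. C * r ^ k * v e)"
      unfolding vm ext using a(1) v_nonneg by (intro sum_mono mult_right_mono) auto
    also have "\<dots> = D * r ^ k" by (simp add: D_def sum_distrib_left sum_distrib_right mult_ac)
    finally show ?thesis using r by (simp add: power_divide field_simps)
  qed
  show "v x \<le> r"
  proof (rule ccontr)
    assume "\<not> v x \<le> r"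
    then have "1 < v x / r" using r by (simp add: field_simps)
    then obtain k where "D < (v x / r) ^ k" using real_arch_pow by blast
    with bound[of k] show False by simp
  qed
qed

text \<open>Every extension lies below the spectral norm. Since the values at x and at its inverse
  multiply to 1 for both functions, the inequality for the inverse is the reverse inequality for
  x.\<close>

lemma ac_av_eq_spectral_norm:
  "(ac_av :: 'k::complete_ultrametric_field alg_closure \<Rightarrow> real) = spectral_norm"
  unfolding ac_av_def
proof (rule the_equality)
  show "absolute_value spectral_norm \<and> (\<forall>a::'k. spectral_norm (to_ac a) = av a)"
    by (simp add: absolute_value_spectral_norm spectral_norm_to_ac)
next
  fix v :: "'k alg_closure \<Rightarrow> real"
  assume v: "absolute_value v \<and> (\<forall>a. v (to_ac a) = av a)"
  show "v = spectral_norm"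
  proof
    fix x
    have le: "v z \<le> spectral_norm z" for z using v by (intro absolute_value_le_spectral_norm) auto
    have "v 0 = 0" using v unfolding absolute_value_def by blast
    show "v x = spectral_norm x"
    proof (cases "x = 0")
      case False
      have vi: "v x * v (inverse x) = v 1" using v False unfolding absolute_value_def
        by (metis right_inverse)
      have v1: "v 1 = 1" using v to_ac_1 av_one by metis
      have si: "spectral_norm x * spectral_norm (inverse x) = 1"
        using spectral_norm_mult[of x "inverse x"] False by simp
      have p: "0 < spectral_norm x" using False by (rule spectral_norm_pos)
      have "v x * v (inverse x) \<le> v x * spectral_norm (inverse x)"
        using v unfolding absolute_value_def by (intro mult_left_mono le) auto
      then have "1 \<le> v x * spectral_norm (inverse x)" using vi v1 by simp
      also have "spectral_norm (inverse x) = 1 / spectral_norm x" using si p by (simp add: field_simps)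
      finally have "spectral_norm x \<le> v x" using p by (simp add: field_simps)
      with le[of x] show ?thesis by simp
    qed (simp add: \<open>v 0 = 0\<close>)
  qed
qed

lemma ac_av_mult: "ac_av (x * y) = ac_av x * ac_av y"
  by (simp add: ac_av_eq_spectral_norm spectral_norm_mult)

lemma ac_av_add_le: "ac_av (x + y) \<le> max (ac_av x) (ac_av y)"
  by (simp add: ac_av_eq_spectral_norm spectral_norm_add_le)

lemma ac_av_to_ac [simp]: "ac_av (to_ac a) = av a"
  by (simp add: ac_av_eq_spectral_norm spectral_norm_to_ac)

lemma ac_av_nonneg [simp]: "0 \<le> ac_av x"
  by (simp add: ac_av_eq_spectral_norm)

lemma ac_av_zero [simp]: "ac_av 0 = 0"
  by (simp add: ac_av_eq_spectral_norm)

lemma ac_av_pos_iff [simp]: "0 < ac_av x \<longleftrightarrow> x \<noteq> 0"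
  using spectral_norm_pos[of x] by (auto simp: ac_av_eq_spectral_norm)

lemma ac_av_minus [simp]: "ac_av (- x) = ac_av x"
  using ac_av_mult[of "to_ac (-1)" x] unfolding ac_av_to_ac by simp

text \<open>x is recovered as (x + y) - y, so the sum cannot be smaller than x. This is the source
  of all exact growth factors along orbits.\<close>

lemma ac_av_add_eq:
  assumes "ac_av y < ac_av x" shows "ac_av (x + y) = ac_av x"
  using ac_av_add_le[of x y] ac_av_add_le[of "x + y" "- y"] assms by auto

lemma ac_av_sum_le:
  assumes "0 \<le> B" "\<And>i. i \<in> F \<Longrightarrow> ac_av (f i) \<le> B"
  shows "ac_av (\<Sum>i\<in>F. f i) \<le> B"
  using assms(2)
proof (induction F rule: infinite_finite_induct)
  case (insert i F)
  then have "ac_av (f i) \<le> B" "ac_av (sum f F) \<le> B" by auto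
  then show ?case using insert.hyps ac_av_add_le[of "f i" "sum f F"] by auto
qed (simp_all add: assms(1))

section \<open>Matrices over a field\<close>

text \<open>Matrices are functions on all pairs of indices, of which only the block with m rows and
  n columns is read. The cutoff makes the result an element of \<open>coord_space m\<close>.\<close>

definition mvec :: "nat \<Rightarrow> nat \<Rightarrow> (nat \<Rightarrow> nat \<Rightarrow> 'a::comm_ring_1) \<Rightarrow> (nat \<Rightarrow> 'a) \<Rightarrow> nat \<Rightarrow> 'a" where
  "mvec n m A x = (\<lambda>j. if j < m then \<Sum>i<n. A j i * x i else 0)"

text \<open>Kept general in its type because it also denotes the multi-indices of degree
  one.\<close>

definition unit_vec :: "nat \<Rightarrow> nat \<Rightarrow> 'a::zero_neq_one" where
  "unit_vec i = (\<lambda>j. if j = i then 1 else 0)"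

lemma mvec_in_coord_space [simp]: "mvec n m A x \<in> coord_space m"
  by (simp add: mvec_def coord_space_def)

lemma mvec_zero [simp]: "mvec n m A (\<lambda>_. 0) = (\<lambda>_. 0)"
  by (simp add: mvec_def fun_eq_iff)

lemma mvec_add: "mvec n m A (\<lambda>i. x i + y i) = (\<lambda>j. mvec n m A x j + mvec n m A y j)"
  by (auto simp: mvec_def fun_eq_iff distrib_left sum.distrib)

lemma mvec_diff: "mvec n m A (\<lambda>i. x i - y i) = (\<lambda>j. mvec n m A x j - mvec n m A y j)"
  by (auto simp: mvec_def fun_eq_iff right_diff_distrib sum_subtractf)

lemma mvec_scale: "mvec n m A (\<lambda>i. c * x i) = (\<lambda>j. c * mvec n m A x j)"
  by (auto simp: mvec_def fun_eq_iff sum_distrib_left mult_ac)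

lemma mvec_sum: "mvec n m A (\<lambda>i. \<Sum>k\<in>I. f k i) = (\<lambda>j. \<Sum>k\<in>I. mvec n m A (f k) j)"
proof
  fix j
  show "mvec n m A (\<lambda>i. \<Sum>k\<in>I. f k i) j = (\<Sum>k\<in>I. mvec n m A (f k) j)"
    unfolding mvec_def by (cases "j < m") (auto simp: sum_distrib_left intro: sum.swap)
qed

lemma mvec_cong: "(\<And>i. i < n \<Longrightarrow> x i = y i) \<Longrightarrow> mvec n m A x = mvec n m A y"
  unfolding mvec_def by (intro ext if_cong sum.cong) auto

lemma coord_space_eqI:
  "x \<in> coord_space n \<Longrightarrow> y \<in> coord_space n \<Longrightarrow> (\<And>i. i < n \<Longrightarrow> x i = y i) \<Longrightarrow> x = y"
  by (rule ext) (metis (mono_tags, lifting) coord_space_def mem_Collect_eq not_le)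

lemma unit_vec_in_coord_space [simp]: "i < n \<Longrightarrow> unit_vec i \<in> coord_space n"
  by (simp add: coord_space_def unit_vec_def)

lemma zero_in_coord_space [simp]: "(\<lambda>_. 0) \<in> coord_space n"
  by (simp add: coord_space_def)

lemma coord_space_add:
  "x \<in> coord_space n \<Longrightarrow> y \<in> coord_space n \<Longrightarrow> (\<lambda>i. x i + y i :: 'a::monoid_add) \<in> coord_space n"
  by (simp add: coord_space_def)

lemma coord_space_diff:
  "x \<in> coord_space n \<Longrightarrow> y \<in> coord_space n \<Longrightarrow> (\<lambda>i. x i - y i :: 'a::group_add) \<in> coord_space n"
  by (simp add: coord_space_def)

lemma coord_space_scale:
  "x \<in> coord_space n \<Longrightarrow> (\<lambda>i. c * x i :: 'a::mult_zero) \<in> coord_space n"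
  by (simp add: coord_space_def)

lemma sum_unit_vec: "(\<Sum>i<n. x i * unit_vec i j) = (if j < n then x j else (0::'a::comm_ring_1))"
proof -
  have "(\<Sum>i<n. x i * unit_vec i j) = (\<Sum>i<n. if j = i then x i else 0)"
    by (intro sum.cong) (auto simp: unit_vec_def)
  then show ?thesis by simp
qed

text \<open>Gaussian elimination in the last coordinate. An indexed family is used so that
  coinciding vectors count as dependent.\<close>

lemma coord_space_dependent:
  fixes w :: "'i \<Rightarrow> nat \<Rightarrow> 'a::field"
  assumes "finite I" "n < card I" "\<And>i. i \<in> I \<Longrightarrow> w i \<in> coord_space n"
  shows "\<exists>u. (\<exists>i\<in>I. u i \<noteq> 0) \<and> (\<forall>j. (\<Sum>i\<in>I. u i * w i j) = 0)"
  using assms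
proof (induction n arbitrary: I w)
  case 0
  then obtain p where "p \<in> I" by fastforce
  moreover have "w i j = 0" if "i \<in> I" for i j using 0(3)[OF that] by (simp add: coord_space_def)
  ultimately show ?case by (intro exI[of _ "\<lambda>_. 1"]) auto
next
  case (Suc n)
  show ?case
  proof (cases "\<forall>i\<in>I. w i n = 0")
    case True
    have "w i \<in> coord_space n" if i: "i \<in> I" for i
      unfolding coord_space_def
    proof (intro CollectI allI impI)
      fix j assume "n \<le> j"
      then show "w i j = 0"
        using Suc.prems(3)[OF i] True i by (cases "j = n") (auto simp: coord_space_def)
    qed
    with Suc.prems show ?thesis by (intro Suc.IH) auto
  next
    case False
    then obtain p where p: "p \<in> I" "w p n \<noteq> 0" by blast
    define J where "J = I - {p}"
    \<comment> \<open>The pivot p clears the last coordinate of all other vectors.\<close>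
    define w' where "w' = (\<lambda>i j. w i j - w i n / w p n * w p j)"
    have J: "finite J" "n < card J" "I = insert p J" "p \<notin> J"
      using Suc.prems p by (auto simp: J_def)
    have "w' i \<in> coord_space n" if i: "i \<in> J" for i
      unfolding coord_space_def
    proof (intro CollectI allI impI)
      fix j assume "n \<le> j"
      then show "w' i j = 0"
        using Suc.prems(3)[of i] Suc.prems(3)[of p] p i J
        by (cases "j = n") (auto simp: coord_space_def w'_def)
    qed
    from Suc.IH[OF J(1,2), of w', OF this] obtain u where
      u: "\<exists>i\<in>J. u i \<noteq> 0" "\<And>j. (\<Sum>i\<in>J. u i * w' i j) = 0" by auto
    \<comment> \<open>With coefficient -s the pivot accounts for all the multiples of it that were
      subtracted.\<close>
    define s where "s = (\<Sum>i\<in>J. u i * (w i n / w p n))"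
    define u' where "u' = (\<lambda>i. if i = p then - s else u i)"
    have "(\<Sum>i\<in>I. u' i * w i j) = 0" for j
    proof -
      have "(\<Sum>i\<in>I. u' i * w i j) = - s * w p j + (\<Sum>i\<in>J. u' i * w i j)"
        using J by (simp add: u'_def)
      also have "(\<Sum>i\<in>J. u' i * w i j) = (\<Sum>i\<in>J. u i * w i j)"
        using J by (intro sum.cong) (auto simp: u'_def)
      also have "- s * w p j + (\<Sum>i\<in>J. u i * w i j) = (\<Sum>i\<in>J. u i * w' i j)"
        by (simp add: s_def w'_def right_diff_distrib sum_subtractf sum_distrib_right mult.assoc)
      finally show ?thesis using u(2) by simp
    qed
    moreover have "\<exists>i\<in>I. u' i \<noteq> 0" using u(1) J by (auto simp: u'_def)
    ultimately show ?thesis by (intro exI[of _ u']) blast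
  qed
qed

text \<open>A dimension count replaces determinants. If the transpose were injective, a nonzero
  multiple of each \<open>unit_vec k\<close> would be one of its values, and pairing that value with
  y, which M annihilates, would give \<open>y k = 0\<close>.\<close>

lemma transpose_kernel:
  fixes M :: "nat \<Rightarrow> nat \<Rightarrow> 'a::field"
  assumes y: "y \<in> coord_space n" "y \<noteq> (\<lambda>_. 0)" "mvec n n M y = (\<lambda>_. 0)"
  shows "\<exists>v\<in>coord_space n. v \<noteq> (\<lambda>_. 0) \<and> mvec n n (\<lambda>i j. M j i) v = (\<lambda>_. 0)"
proof (rule ccontr)
  assume neg: "\<not> ?thesis"
  let ?M' = "\<lambda>i j. M j i"
  have inj: "v = (\<lambda>_. 0)" if "v \<in> coord_space n" "mvec n n ?M' v = (\<lambda>_. 0)" for v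
    using neg that by blast
  have pair: "(\<Sum>i<n. mvec n n ?M' d i * y i) = 0" for d
  proof -
    have "(\<Sum>i<n. mvec n n ?M' d i * y i) = (\<Sum>i<n. \<Sum>j<n. d j * (M j i * y i))"
      by (simp add: mvec_def sum_distrib_left sum_distrib_right mult_ac)
    also have "\<dots> = (\<Sum>j<n. d j * mvec n n M y j)"
      by (subst sum.swap) (simp add: mvec_def sum_distrib_left)
    finally show ?thesis using y(3) by simp
  qed
  have "y k = 0" if k: "k < n" for k
  proof -
    \<comment> \<open>These are n + 1 vectors in dimension n: the columns, and
      \<open>unit_vec k\<close> at index n. Injectivity forces the coefficient at index n to be
      nonzero.\<close>
    define w where "w = (\<lambda>i. if i < n then mvec n n ?M' (unit_vec i) else unit_vec k)"
    have "w i \<in> coord_space n" for i using k by (simp add: w_def)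
    from coord_space_dependent[of "{..n}" n w, OF _ _ this] obtain u where
      u: "\<exists>i\<le>n. u i \<noteq> 0" "\<And>j. (\<Sum>i\<le>n. u i * w i j) = 0" by auto
    define d where "d = (\<lambda>i. \<Sum>k<n. u k * unit_vec k i)"
    have d: "d = (\<lambda>j. if j < n then u j else 0)" unfolding d_def sum_unit_vec ..
    have Md: "mvec n n ?M' d = (\<lambda>j. \<Sum>i<n. u i * w i j)"
      unfolding d_def by (auto simp: mvec_sum mvec_scale w_def intro!: ext sum.cong)
    have eq: "mvec n n ?M' d j + u n * unit_vec k j = 0" for j
      using u(2)[of j] unfolding Md lessThan_Suc_atMost[symmetric] sum.lessThan_Suc
      by (simp add: w_def)
    have "u n \<noteq> 0"
    proof
      assume n0: "u n = 0"
      have "mvec n n ?M' d = (\<lambda>_. 0)" using eq n0 by auto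
      moreover have "d \<in> coord_space n" by (simp add: d coord_space_def)
      ultimately have "d = (\<lambda>_. 0)" by (rule inj[rotated])
      then have "u i = 0" if "i < n" for i using that d by (metis (full_types))
      then show False using u(1) n0 by (metis le_neq_implies_less)
    qed
    have "0 = (\<Sum>i<n. mvec n n ?M' d i * y i)" by (simp add: pair)
    also have "\<dots> = (\<Sum>i<n. - (u n * unit_vec k i) * y i)"
      using eq by (intro sum.cong arg_cong2[where f = "(*)"]) (auto simp: eq_neg_iff_add_eq_0)
    also have "\<dots> = - u n * (\<Sum>i<n. unit_vec k i * y i)"
      by (simp add: sum_distrib_left sum_negf mult.assoc)
    also have "(\<Sum>i<n. unit_vec k i * y i) = (\<Sum>i<n. if k = i then y i else 0)"
      by (intro sum.cong) (auto simp: unit_vec_def)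
    also have "\<dots> = y k" using k by simp
    finally show ?thesis using \<open>u n \<noteq> 0\<close> by simp
  qed
  then have "y = (\<lambda>_. 0)" using y(1) by (intro coord_space_eqI) auto
  with y(2) show False ..
qed

section \<open>Eigenvalues of matrices and of their transposes\<close>

definition eigenvalue_of :: "nat \<Rightarrow> (nat \<Rightarrow> nat \<Rightarrow> 'a::field) \<Rightarrow> 'a \<Rightarrow> bool" where
  "eigenvalue_of n M \<mu> \<longleftrightarrow>
     (\<exists>y\<in>coord_space n. y \<noteq> (\<lambda>_. 0) \<and> mvec n n M y = (\<lambda>i. \<mu> * y i))"

lemma mvec_minus_diag:
  fixes M :: "nat \<Rightarrow> nat \<Rightarrow> 'a::field"
  assumes "y \<in> coord_space n"
  shows "mvec n n (\<lambda>i j. M i j - (if i = j then \<mu> else 0)) y = (\<lambda>i. mvec n n M y i - \<mu> * y i)"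
proof
  fix i
  show "mvec n n (\<lambda>i j. M i j - (if i = j then \<mu> else 0)) y i = mvec n n M y i - \<mu> * y i"
  proof (cases "i < n")
    case True
    have "(\<Sum>j<n. (M i j - (if i = j then \<mu> else 0)) * y j)
        = (\<Sum>j<n. M i j * y j - (if i = j then \<mu> * y j else 0))"
      by (intro sum.cong) (auto simp: left_diff_distrib)
    then show ?thesis using True by (simp add: mvec_def sum_subtractf)
  next
    case False
    then show ?thesis using assms by (simp add: mvec_def coord_space_def)
  qed
qed

text \<open>The kernel statement is applied to \<open>M\<close> minus \<mu> on the diagonal.
  Eigenvectors of the transpose are the linear forms that M multiplies by \<mu>.\<close>

lemma eigenvalue_of_transpose:
  fixes M :: "nat \<Rightarrow> nat \<Rightarrow> 'a::field"
  assumes "eigenvalue_of n M \<mu>" shows "eigenvalue_of n (\<lambda>i j. M j i) \<mu>"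
proof -
  obtain y where y: "y \<in> coord_space n" "y \<noteq> (\<lambda>_. 0)" "mvec n n M y = (\<lambda>i. \<mu> * y i)"
    using assms unfolding eigenvalue_of_def by blast
  let ?D = "\<lambda>i j. M i j - (if i = j then \<mu> else 0)"
  have "mvec n n ?D y = (\<lambda>_. 0)" unfolding mvec_minus_diag[OF y(1)] y(3) by simp
  from transpose_kernel[OF y(1,2) this] obtain v where
    v: "v \<in> coord_space n" "v \<noteq> (\<lambda>_. 0)" "mvec n n (\<lambda>i j. ?D j i) v = (\<lambda>_. 0)" by blast
  have "(\<lambda>i j. ?D j i) = (\<lambda>i j. (\<lambda>i j. M j i) i j - (if i = j then \<mu> else 0))"
    by (intro ext) auto
  then have "mvec n n (\<lambda>i j. M j i - (if i = j then \<mu> else 0)) v = (\<lambda>_. 0)" using v(3) by simp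
  then have "(\<lambda>i. mvec n n (\<lambda>i j. M j i) v i - \<mu> * v i) = (\<lambda>_. 0)"
    unfolding mvec_minus_diag[OF v(1), where M = "\<lambda>i j. M j i"] .
  then have "mvec n n (\<lambda>i j. M j i) v = (\<lambda>i. \<mu> * v i)" by (simp add: fun_eq_iff)
  with v show ?thesis unfolding eigenvalue_of_def by blast
qed

text \<open>Applying \<open>M\<close> and subtracting \<kappa> times the relation removes the term
  of \<kappa> and multiplies the others by the nonzero numbers
  \<open>\<mu> - \<kappa>\<close>.\<close>

lemma eigenvectors_independent:
  fixes M :: "nat \<Rightarrow> nat \<Rightarrow> 'a::field"
  assumes "finite \<Lambda>"
    and "\<And>\<mu>. \<mu> \<in> \<Lambda> \<Longrightarrow> v \<mu> \<noteq> (\<lambda>_. 0) \<and> mvec n n M (v \<mu>) = (\<lambda>i. \<mu> * v \<mu> i)"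
    and "\<And>j. (\<Sum>\<mu>\<in>\<Lambda>. u \<mu> * v \<mu> j) = 0" and "\<mu> \<in> \<Lambda>"
  shows "u \<mu> = 0"
  using assms
proof (induction \<Lambda> arbitrary: u \<mu> rule: finite_induct)
  case (insert \<kappa> \<Lambda>)
  have zero: "(\<lambda>i. \<Sum>\<mu>\<in>insert \<kappa> \<Lambda>. u \<mu> * v \<mu> i) = (\<lambda>_. 0)" using insert.prems(2) by auto
  have "mvec n n M (\<lambda>i. \<Sum>\<mu>\<in>insert \<kappa> \<Lambda>. u \<mu> * v \<mu> i) = (\<lambda>_. 0)" unfolding zero by simp
  then have s1: "(\<Sum>\<mu>\<in>insert \<kappa> \<Lambda>. u \<mu> * mvec n n M (v \<mu>) j) = 0" for j
    unfolding mvec_sum mvec_scale by (rule fun_cong)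
  have "(\<Sum>\<mu>\<in>insert \<kappa> \<Lambda>. u \<mu> * mvec n n M (v \<mu>) j)
      = (\<Sum>\<mu>\<in>insert \<kappa> \<Lambda>. \<mu> * (u \<mu> * v \<mu> j))" for j
    using insert.prems(1) by (intro sum.cong) auto
  with s1 have "(\<Sum>\<mu>\<in>insert \<kappa> \<Lambda>. \<mu> * (u \<mu> * v \<mu> j)) - \<kappa> * (\<Sum>\<mu>\<in>insert \<kappa> \<Lambda>. u \<mu> * v \<mu> j) = 0" for j
    using insert.prems(2)[of j] by simp
  then have "(\<Sum>\<mu>\<in>\<Lambda>. ((\<mu> - \<kappa>) * u \<mu>) * v \<mu> j) = 0" for j
    using insert.hyps by (simp add: distrib_left sum_distrib_left sum_subtractf left_diff_distrib mult.assoc)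
  then have "(\<mu> - \<kappa>) * u \<mu> = 0" if "\<mu> \<in> \<Lambda>" for \<mu>
    using insert.prems(1) that by (intro insert.IH[of "\<lambda>\<mu>. (\<mu> - \<kappa>) * u \<mu>"]) auto
  then have z: "u \<mu> = 0" if "\<mu> \<in> \<Lambda>" for \<mu> using that insert.hyps by fastforce
  then have "u \<kappa> * v \<kappa> j = 0" for j using insert.prems(2)[of j] insert.hyps by simp
  moreover obtain j where "v \<kappa> j \<noteq> 0" using insert.prems(1)[of \<kappa>] by fastforce
  ultimately have "u \<kappa> = 0" by (metis mult_eq_0_iff)
  with z insert.prems(3) show ?case by auto
qed simp

text \<open>More than n eigenvalues would give more than n independent vectors in dimension n.
  Finiteness is what makes extremal absolute values attained.\<close>

lemma finite_eigenvalues: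
  fixes M :: "nat \<Rightarrow> nat \<Rightarrow> 'a::field"
  shows "finite {\<mu>. eigenvalue_of n M \<mu>}"
proof (rule ccontr)
  assume "infinite {\<mu>. eigenvalue_of n M \<mu>}"
  then obtain \<Lambda> where \<Lambda>: "\<Lambda> \<subseteq> {\<mu>. eigenvalue_of n M \<mu>}" "finite \<Lambda>" "card \<Lambda> = Suc n"
    by (metis infinite_arbitrarily_large)
  have "\<forall>\<mu>\<in>\<Lambda>. \<exists>y. y \<in> coord_space n \<and> y \<noteq> (\<lambda>_. 0) \<and> mvec n n M y = (\<lambda>i. \<mu> * y i)"
    using \<Lambda>(1) unfolding eigenvalue_of_def by blast
  then obtain v where v: "\<forall>\<mu>\<in>\<Lambda>. v \<mu> \<in> coord_space n \<and> v \<mu> \<noteq> (\<lambda>_. 0)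
      \<and> mvec n n M (v \<mu>) = (\<lambda>i. \<mu> * v \<mu> i)"
    by (rule bchoice[THEN exE])
  have "\<exists>u. (\<exists>i\<in>\<Lambda>. u i \<noteq> 0) \<and> (\<forall>j. (\<Sum>i\<in>\<Lambda>. u i * v i j) = 0)"
    using \<Lambda> v by (intro coord_space_dependent[of _ n]) auto
  then obtain u where u: "\<exists>i\<in>\<Lambda>. u i \<noteq> 0" "\<And>j. (\<Sum>i\<in>\<Lambda>. u i * v i j) = 0" by auto
  have "u \<mu> = 0" if "\<mu> \<in> \<Lambda>" for \<mu>
    by (rule eigenvectors_independent[OF \<Lambda>(2), of v n M u]) (use v u(2) that in auto)
  with u(1) show False by blast
qed

section \<open>Polynomials in a matrix, applied to a vector\<close>

definition poly_apply :: "nat \<Rightarrow> (nat \<Rightarrow> nat \<Rightarrow> 'a::field) \<Rightarrow> 'a poly \<Rightarrow> (nat \<Rightarrow> 'a) \<Rightarrow> nat \<Rightarrow> 'a" where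
  "poly_apply n M p v = (\<lambda>i. \<Sum>k\<le>Polynomial.degree p. Polynomial.coeff p k * (mvec n n M ^^ k) v i)"

lemma poly_apply_altdef:
  assumes "Polynomial.degree p \<le> N"
  shows "poly_apply n M p v = (\<lambda>i. \<Sum>k\<le>N. Polynomial.coeff p k * (mvec n n M ^^ k) v i)"
  unfolding poly_apply_def
  by (intro ext sum.mono_neutral_left) (use assms in \<open>auto simp: coeff_eq_0\<close>)

text \<open>Multiplication by X - x shifts the coefficients and subtracts x times the old ones; the
  shift amounts to one more application of M.\<close>

lemma poly_apply_linear_factor:
  fixes q :: "'a::field poly"
  shows "poly_apply n M ([:- x, 1:] * q) v
    = (\<lambda>i. mvec n n M (poly_apply n M q v) i - x * poly_apply n M q v i)"
proof
  fix i
  let ?N = "Polynomial.degree q" and ?B = "\<lambda>k. (mvec n n M ^^ k) v i"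
  have c: "Polynomial.coeff ([:- x, 1:] * q) k = Polynomial.coeff (pCons 0 q) k - x * Polynomial.coeff q k" for k
    by simp
  have "Polynomial.degree ([:- x, 1:] * q) \<le> Suc ?N"
    using degree_mult_le[of "[:- x, 1:]" q] by simp
  then have "poly_apply n M ([:- x, 1:] * q) v i
      = (\<Sum>k\<le>Suc ?N. (Polynomial.coeff (pCons 0 q) k - x * Polynomial.coeff q k) * ?B k)"
    by (simp only: poly_apply_altdef c)
  also have "\<dots> = (\<Sum>k\<le>Suc ?N. Polynomial.coeff (pCons 0 q) k * ?B k)
      - x * (\<Sum>k\<le>Suc ?N. Polynomial.coeff q k * ?B k)"
    by (simp only: left_diff_distrib sum_subtractf sum_distrib_left mult.assoc)
  also have "(\<Sum>k\<le>Suc ?N. Polynomial.coeff (pCons 0 q) k * ?B k)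
      = (\<Sum>k\<le>?N. Polynomial.coeff q k * ?B (Suc k))"
    by (subst sum.atMost_Suc_shift) simp
  also have "\<dots> = mvec n n M (poly_apply n M q v) i"
    unfolding poly_apply_def mvec_sum mvec_scale by simp
  also have "(\<Sum>k\<le>Suc ?N. Polynomial.coeff q k * ?B k) = poly_apply n M q v i"
    by (subst poly_apply_altdef[of q "Suc ?N"]) auto
  finally show "poly_apply n M ([:- x, 1:] * q) v i
      = mvec n n M (poly_apply n M q v) i - x * poly_apply n M q v i" .
qed

lemma funpow_mvec_in_coord_space: "v \<in> coord_space n \<Longrightarrow> (mvec n n M ^^ k) v \<in> coord_space n"
  by (cases k) auto

lemma poly_apply_in_coord_space:
  assumes "v \<in> coord_space n" shows "poly_apply n M p v \<in> coord_space n"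
proof -
  have "(mvec n n M ^^ k) v i = 0" if "n \<le> i" for k i
    using funpow_mvec_in_coord_space[OF assms] that by (simp add: coord_space_def)
  then show ?thesis by (simp add: poly_apply_def coord_space_def)
qed

lemma ex_annihilating_poly:
  fixes M :: "nat \<Rightarrow> nat \<Rightarrow> 'a::field"
  assumes "v \<in> coord_space n"
  shows "\<exists>p. p \<noteq> 0 \<and> poly_apply n M p v = (\<lambda>_. 0)"
proof -
  let ?w = "\<lambda>k. (mvec n n M ^^ k) v"
  have "\<exists>u. (\<exists>k\<in>{..n}. u k \<noteq> 0) \<and> (\<forall>j. (\<Sum>k\<in>{..n}. u k * ?w k j) = 0)"
    by (rule coord_space_dependent[of _ n]) (simp_all add: funpow_mvec_in_coord_space assms)
  then obtain u where u: "\<exists>k\<in>{..n}. u k \<noteq> 0" "\<And>j. (\<Sum>k\<in>{..n}. u k * ?w k j) = 0" by auto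
  define p where "p = (\<Sum>k\<le>n. Polynomial.monom (u k) k)"
  have c: "Polynomial.coeff p k = (if k \<le> n then u k else 0)" for k
    by (simp add: p_def Polynomial.coeff_sum)
  have "Polynomial.degree p \<le> n" by (rule degree_le) (simp add: c)
  then have "poly_apply n M p v = (\<lambda>i. \<Sum>k\<le>n. Polynomial.coeff p k * ?w k i)"
    by (rule poly_apply_altdef)
  also have "\<dots> = (\<lambda>_. 0)" using u(2) by (simp add: c)
  finally have "poly_apply n M p v = (\<lambda>_. 0)" .
  moreover have "p \<noteq> 0"
  proof
    assume "p = 0"
    then have "u k = 0" if "k \<le> n" for k using c[of k] that by simp
    with u(1) show False by auto
  qed
  ultimately show ?thesis by blast
qed

text \<open>For an annihilator of v of least degree, removing the factor of a root x leaves a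
  polynomial whose value at v is nonzero, and that value is an eigenvector for x. This takes the
  place of the characteristic polynomial.\<close>

lemma ex_annihilating_poly_eigenvalues:
  fixes M :: "nat \<Rightarrow> nat \<Rightarrow> 'a::field"
  assumes v: "v \<in> coord_space n"
  shows "\<exists>p. p \<noteq> 0 \<and> poly_apply n M p v = (\<lambda>_. 0) \<and> (\<forall>x. poly p x = 0 \<longrightarrow> eigenvalue_of n M x)"
proof -
  define P where "P = (\<lambda>p. p \<noteq> 0 \<and> poly_apply n M p v = (\<lambda>_. 0))"
  obtain p where p: "P p" "\<And>q. P q \<Longrightarrow> Polynomial.degree p \<le> Polynomial.degree q"
    using ex_annihilating_poly[OF v, of M] arg_min_nat_lemma[of P _ Polynomial.degree]
    unfolding P_def by blast
  have "eigenvalue_of n M x" if x: "poly p x = 0" for x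
  proof -
    obtain q where q: "p = [:- x, 1:] * q" using x by (metis poly_eq_0_iff_dvd dvdE)
    have q0: "q \<noteq> 0" using p(1) q unfolding P_def by auto
    have "Polynomial.degree p = Suc (Polynomial.degree q)" unfolding q using q0
      by (subst degree_mult_eq) auto
    then have "\<not> P q" using p(2)[of q] by auto
    then have "poly_apply n M q v \<noteq> (\<lambda>_. 0)" using q0 unfolding P_def by blast
    moreover have "mvec n n M (poly_apply n M q v) = (\<lambda>i. x * poly_apply n M q v i)"
      using p(1) unfolding P_def q poly_apply_linear_factor by (auto simp: fun_eq_iff)
    ultimately show ?thesis
      unfolding eigenvalue_of_def using poly_apply_in_coord_space[OF v] by blast
  qed
  with p(1) show ?thesis unfolding P_def by blast
qed

section \<open>Norms adapted to a matrix\<close>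

text \<open>The inserted 0 gives the value in dimension 0.\<close>

definition vnorm :: "nat \<Rightarrow> (nat \<Rightarrow> 'k::complete_ultrametric_field) \<Rightarrow> real" where
  "vnorm n x = Max (insert 0 ((\<lambda>i. av (x i)) ` {..<n}))"

lemma vnorm_nonneg [simp]: "0 \<le> vnorm n x"
  by (simp add: vnorm_def)

lemma av_le_vnorm: "i < n \<Longrightarrow> av (x i) \<le> vnorm n x"
  by (simp add: vnorm_def)

lemma vnorm_le_iff: "0 \<le> B \<Longrightarrow> vnorm n x \<le> B \<longleftrightarrow> (\<forall>i<n. av (x i) \<le> B)"
  by (auto simp: vnorm_def)

lemma vnorm_less_iff: "0 < B \<Longrightarrow> vnorm n x < B \<longleftrightarrow> (\<forall>i<n. av (x i) < B)"
  by (auto simp: vnorm_def)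

lemma vnorm_zero [simp]: "vnorm n (\<lambda>_. 0) = 0"
  by (intro order_antisym) (simp_all add: vnorm_le_iff)

lemma vnorm_eq_0_D: "vnorm n x = 0 \<Longrightarrow> i < n \<Longrightarrow> x i = 0"
  using av_le_vnorm[of i n x] by (metis av_eq_0_iff av_nonneg order_antisym)

lemma vnorm_add: "vnorm n (\<lambda>i. x i + y i) \<le> max (vnorm n x) (vnorm n y)"
proof -
  have "av (x i + y i) \<le> max (vnorm n x) (vnorm n y)" if "i < n" for i
    using av_ultrametric[of "x i" "y i"] av_le_vnorm[OF that, of x] av_le_vnorm[OF that, of y]
    by linarith
  then show ?thesis by (subst vnorm_le_iff) (auto simp: le_max_iff_disj)
qed

lemma vnorm_scale_le: "vnorm n (\<lambda>i. c * x i) \<le> av c * vnorm n x"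
  by (subst vnorm_le_iff) (auto simp: av_mult intro!: mult_left_mono av_le_vnorm)

lemma mvec_bounded:
  "\<exists>K\<ge>0. \<forall>x. vnorm m (mvec n m A x) \<le> K * vnorm n (x :: nat \<Rightarrow> 'k::complete_ultrametric_field)"
proof -
  define K where "K = (\<Sum>j<m. \<Sum>i<n. av (A j i))"
  have K: "av (A j i) \<le> K" if "j < m" "i < n" for i j
  proof -
    have "av (A j i) \<le> (\<Sum>i<n. av (A j i))" using that by (intro member_le_sum) auto
    also have "\<dots> \<le> K" unfolding K_def
      using that by (intro member_le_sum[of j "{..<m}" "\<lambda>j. \<Sum>i<n. av (A j i)"]) (auto intro: sum_nonneg)
    finally show ?thesis .
  qed
  have K0: "0 \<le> K" unfolding K_def by (intro sum_nonneg) auto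
  have "vnorm m (mvec n m A x) \<le> K * vnorm n x" for x
  proof (subst vnorm_le_iff)
    show "\<forall>j<m. av (mvec n m A x j) \<le> K * vnorm n x"
      using K K0 by (auto simp: mvec_def av_mult intro!: av_sum_le mult_mono av_le_vnorm)
  qed (use K0 in simp)
  with K0 show ?thesis by blast
qed

section \<open>Linear forms over the algebraic closure and the adapted norm\<close>

definition pairing :: "nat \<Rightarrow> (nat \<Rightarrow> 'k::complete_ultrametric_field alg_closure) \<Rightarrow> (nat \<Rightarrow> 'k) \<Rightarrow> 'k alg_closure" where
  "pairing n v x = (\<Sum>i<n. v i * to_ac (x i))"

lemma pairing_add: "pairing n v (\<lambda>i. x i + y i) = pairing n v x + pairing n v y"
  by (simp add: pairing_def distrib_left sum.distrib)

lemma pairing_scale: "pairing n v (\<lambda>i. c * x i) = to_ac c * pairing n v x"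
  by (simp add: pairing_def sum_distrib_left mult_ac)

lemma pairing_mvec:
  "pairing n v (mvec n n A x) = pairing n (mvec n n (\<lambda>i j. to_ac (A j i)) v) x"
proof -
  have "pairing n v (mvec n n A x) = (\<Sum>i<n. \<Sum>j<n. v i * (to_ac (A i j) * to_ac (x j)))"
    by (simp add: pairing_def mvec_def to_ac_sum sum_distrib_left)
  also have "\<dots> = (\<Sum>j<n. \<Sum>i<n. v i * (to_ac (A i j) * to_ac (x j)))" by (rule sum.swap)
  also have "\<dots> = pairing n (mvec n n (\<lambda>i j. to_ac (A j i)) v) x"
    by (simp add: pairing_def mvec_def sum_distrib_left sum_distrib_right mult_ac)
  finally show ?thesis .
qed

lemma pairing_le_vnorm: "\<exists>C\<ge>0. \<forall>x. ac_av (pairing n v x) \<le> C * vnorm n x"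
proof -
  define C where "C = (\<Sum>i<n. ac_av (v i))"
  have C0: "0 \<le> C" unfolding C_def by (intro sum_nonneg) auto
  have C: "ac_av (v i) \<le> C" if "i < n" for i
    unfolding C_def using that by (intro member_le_sum) auto
  have "ac_av (pairing n v x) \<le> C * vnorm n x" for x
    unfolding pairing_def using C C0
    by (intro ac_av_sum_le) (auto simp: ac_av_mult intro!: mult_mono av_le_vnorm)
  with C0 show ?thesis by blast
qed

lemma pairing_unit_vec: "j < n \<Longrightarrow> pairing n (unit_vec j) x = to_ac (x j)"
proof -
  assume "j < n"
  moreover have "pairing n (unit_vec j) x = (\<Sum>i<n. if i = j then to_ac (x i) else 0)"
    unfolding pairing_def by (intro sum.cong) (auto simp: unit_vec_def)
  ultimately show ?thesis by simp
qed

text \<open>A seminorm, because the construction starts from the zero function and gains one linear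
  form at a time. The bound by \<open>vnorm\<close> expresses continuity.\<close>

definition adapted_seminorm ::
    "nat \<Rightarrow> (nat \<Rightarrow> nat \<Rightarrow> 'k::complete_ultrametric_field) \<Rightarrow> real \<Rightarrow> real \<Rightarrow> ((nat \<Rightarrow> 'k) \<Rightarrow> real) \<Rightarrow> bool" where
  "adapted_seminorm n A s r q \<longleftrightarrow>
     (\<forall>x. 0 \<le> q x) \<and> (\<forall>x y. q (\<lambda>i. x i + y i) \<le> max (q x) (q y)) \<and>
     (\<forall>c x. q (\<lambda>i. c * x i) = av c * q x) \<and> (\<exists>C\<ge>0. \<forall>x. q x \<le> C * vnorm n x) \<and>
     (\<forall>x. s * q x \<le> q (mvec n n A x) \<and> q (mvec n n A x) \<le> r * q x)"

text \<open>Boundedness of the linear form v with respect to q. Once all coordinate forms are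
  bounded, q is a norm on \<open>coord_space n\<close>.\<close>

definition dominates ::
    "nat \<Rightarrow> ((nat \<Rightarrow> 'k::complete_ultrametric_field) \<Rightarrow> real) \<Rightarrow> (nat \<Rightarrow> 'k alg_closure) \<Rightarrow> bool" where
  "dominates n q v \<longleftrightarrow> (\<exists>C\<ge>0. \<forall>x. ac_av (pairing n v x) \<le> C * q x)"

lemma dominates_mono:
  assumes "dominates n q v" "\<And>x. q x \<le> q' x" shows "dominates n q' v"
proof -
  obtain C where C: "0 \<le> C" "\<And>x. ac_av (pairing n v x) \<le> C * q x"
    using assms(1) unfolding dominates_def by blast
  have "ac_av (pairing n v x) \<le> C * q' x" for x
    using C(2)[of x] mult_left_mono[OF assms(2)[of x] C(1)] by linarith
  with C(1) show ?thesis unfolding dominates_def by blast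
qed

text \<open>The new functional enters with a weight so small that its off-diagonal part
  \<open>v A - \<kappa> v\<close> stays below \<open>s q\<close>.\<close>

lemma adapted_seminorm_step:
  assumes q: "adapted_seminorm n A s r q" and s: "0 < s" and l: "s \<le> ac_av \<kappa>" "ac_av \<kappa> \<le> r"
    and dom: "dominates n q (\<lambda>i. mvec n n (\<lambda>i j. to_ac (A j i)) v i - \<kappa> * v i)"
  shows "\<exists>q'. adapted_seminorm n A s r q' \<and> (\<forall>x. q x \<le> q' x) \<and> dominates n q' v"
proof -
  have q_nonneg: "0 \<le> q x" and q_add: "q (\<lambda>i. x i + y i) \<le> max (q x) (q y)"
    and q_scale: "q (\<lambda>i. c * x i) = av c * q x"
    and q_low: "s * q x \<le> q (mvec n n A x)" and q_up: "q (mvec n n A x) \<le> r * q x" for x y c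
    using q unfolding adapted_seminorm_def by auto
  obtain D where D: "0 \<le> D" "\<And>x. q x \<le> D * vnorm n x"
    using q unfolding adapted_seminorm_def by blast
  obtain C where C: "0 \<le> C"
    "\<And>x. ac_av (pairing n (\<lambda>i. mvec n n (\<lambda>i j. to_ac (A j i)) v i - \<kappa> * v i) x) \<le> C * q x"
    using dom unfolding dominates_def by blast
  obtain E where E: "0 \<le> E" "\<And>x. ac_av (pairing n v x) \<le> E * vnorm n x"
    using pairing_le_vnorm[of n v] by blast
  \<comment> \<open>Chosen so that \<open>\<tau> * C\<close> is at most s; C + 1 keeps the quotient
    defined when C = 0.\<close>
  define \<tau> where "\<tau> = s / (C + 1)"
  have \<tau>: "0 < \<tau>" "\<tau> * C \<le> s" using C(1) s by (auto simp: \<tau>_def field_simps)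
  define L where "L = (\<lambda>x. \<tau> * ac_av (pairing n v x))"
  define q' where "q' = (\<lambda>x. max (q x) (L x))"
  have L_nonneg: "0 \<le> L x" for x using \<tau> by (simp add: L_def)
  have r: "s \<le> r" "0 \<le> r" using l s by linarith+
  define u where "u = (\<lambda>i. mvec n n (\<lambda>i j. to_ac (A j i)) v i - \<kappa> * v i)"
  have pA: "pairing n v (mvec n n A x) = \<kappa> * pairing n v x + pairing n u x" for x
    unfolding pairing_mvec
    by (simp add: pairing_def u_def left_diff_distrib sum_subtractf sum_distrib_left mult.assoc)
  have u: "\<tau> * ac_av (pairing n u x) \<le> s * q x" for x
  proof -
    have "\<tau> * ac_av (pairing n u x) \<le> \<tau> * (C * q x)"
      using C(2)[of x] \<tau> unfolding u_def by (intro mult_left_mono) auto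
    also have "\<dots> = (\<tau> * C) * q x" by simp
    also have "\<dots> \<le> s * q x" using \<tau> q_nonneg by (intro mult_right_mono)
    finally show ?thesis .
  qed
  have L1: "\<tau> * ac_av (\<kappa> * pairing n v x) = ac_av \<kappa> * L x" for x
    by (simp add: L_def ac_av_mult)
  have up: "q' (mvec n n A x) \<le> r * q' x" for x
  proof -
    have "q (mvec n n A x) \<le> r * q' x"
      using q_up[of x] mult_left_mono[of "q x" "q' x" r] r by (simp add: q'_def)
    moreover have "L (mvec n n A x) \<le> r * q' x"
    proof -
      have "L (mvec n n A x) \<le> \<tau> * max (ac_av (\<kappa> * pairing n v x)) (ac_av (pairing n u x))"
        unfolding L_def pA using \<tau> by (intro mult_left_mono ac_av_add_le) auto
      also have "\<dots> = max (ac_av \<kappa> * L x) (\<tau> * ac_av (pairing n u x))"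
        using \<tau> by (subst max_mult_distrib_left) (auto simp: L1)
      also have "\<dots> \<le> r * q' x"
      proof (rule max.boundedI)
        show "ac_av \<kappa> * L x \<le> r * q' x"
          using l L_nonneg[of x] r by (intro mult_mono) (auto simp: q'_def)
        have "s * q x \<le> r * q' x" using r q_nonneg[of x] by (intro mult_mono) (auto simp: q'_def)
        then show "\<tau> * ac_av (pairing n u x) \<le> r * q' x" using u[of x] by linarith
      qed
      finally show ?thesis .
    qed
    ultimately show ?thesis by (simp add: q'_def)
  qed
  \<comment> \<open>Where the new form exceeds q, its diagonal part strictly outweighs the
    off-diagonal one, so \<open>L\<close> is multiplied by exactly \<open>ac_av \<kappa>\<close>.
    Elsewhere the bound for q suffices.\<close>
  have low: "s * q' x \<le> q' (mvec n n A x)" for x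
  proof (cases "L x \<le> q x")
    case True
    then show ?thesis using q_low[of x] by (simp add: q'_def)
  next
    case False
    have "\<tau> * ac_av (pairing n u x) < \<tau> * ac_av (\<kappa> * pairing n v x)"
    proof -
      have "s * q x < s * L x" using False s by simp
      also have "\<dots> \<le> ac_av \<kappa> * L x" using l L_nonneg by (intro mult_right_mono) auto
      finally show ?thesis using u[of x] unfolding L1 by linarith
    qed
    then have "ac_av (pairing n v (mvec n n A x)) = ac_av (\<kappa> * pairing n v x)"
      unfolding pA using \<tau> by (intro ac_av_add_eq) simp
    then have "L (mvec n n A x) = ac_av \<kappa> * L x" unfolding L_def by (simp add: ac_av_mult)
    moreover have "s * L x \<le> ac_av \<kappa> * L x" using l L_nonneg by (intro mult_right_mono) auto
    ultimately show ?thesis using False by (simp add: q'_def)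
  qed
  have "adapted_seminorm n A s r q'"
    unfolding adapted_seminorm_def
  proof (intro conjI allI)
    fix x y :: "nat \<Rightarrow> 'a" and c
    show "0 \<le> q' x" using q_nonneg[of x] by (simp add: q'_def)
    have "L (\<lambda>i. x i + y i) \<le> max (L x) (L y)"
    proof -
      have "L (\<lambda>i. x i + y i) \<le> \<tau> * max (ac_av (pairing n v x)) (ac_av (pairing n v y))"
        unfolding L_def pairing_add using \<tau> by (intro mult_left_mono ac_av_add_le) auto
      also have "\<dots> = max (L x) (L y)" using \<tau> by (subst max_mult_distrib_left) (auto simp: L_def)
      finally show ?thesis .
    qed
    with q_add[of x y] show "q' (\<lambda>i. x i + y i) \<le> max (q' x) (q' y)"
      unfolding q'_def by linarith
    show "q' (\<lambda>i. c * x i) = av c * q' x"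
      unfolding q'_def q_scale L_def pairing_scale ac_av_mult
      by (subst max_mult_distrib_left) (auto simp: mult_ac)
    show "\<exists>C\<ge>0. \<forall>x. q' x \<le> C * vnorm n x"
    proof (intro exI[of _ "max D (\<tau> * E)"] conjI allI)
      show "0 \<le> max D (\<tau> * E)" using D by auto
      fix x
      have "q x \<le> max D (\<tau> * E) * vnorm n x"
        by (rule order_trans[OF D(2)]) (intro mult_right_mono, auto)
      moreover have "L x \<le> \<tau> * (E * vnorm n x)"
        unfolding L_def using \<tau> E by (intro mult_left_mono) auto
      moreover have "\<tau> * E * vnorm n x \<le> max D (\<tau> * E) * vnorm n x"
        by (intro mult_right_mono) auto
      ultimately show "q' x \<le> max D (\<tau> * E) * vnorm n x" unfolding q'_def by simp
    qed
    show "s * q' x \<le> q' (mvec n n A x)" by (rule low)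
    show "q' (mvec n n A x) \<le> r * q' x" by (rule up)
  qed
  moreover have "dominates n q' v"
    unfolding dominates_def
  proof (intro exI[of _ "1 / \<tau>"] conjI allI)
    show "0 \<le> 1 / \<tau>" using \<tau> by simp
    fix x
    have "ac_av (pairing n v x) = 1 / \<tau> * L x" using \<tau> by (simp add: L_def)
    also have "\<dots> \<le> 1 / \<tau> * q' x" using \<tau> by (intro mult_left_mono) (auto simp: q'_def)
    finally show "ac_av (pairing n v x) \<le> 1 / \<tau> * q' x" .
  qed
  moreover have "q x \<le> q' x" for x by (simp add: q'_def)
  ultimately show ?thesis by blast
qed

text \<open>One factor X - x is split off at a time. If w is the remaining polynomial applied to v,
  the hypothesis says that the image of w minus x times w is dominated, which is the input of
  \<open>adapted_seminorm_step\<close>; afterwards w is dominated and the degree has dropped. The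
  forms passed on the way are those that triangularise A.\<close>

lemma adapted_seminorm_poly:
  fixes A :: "nat \<Rightarrow> nat \<Rightarrow> 'k::complete_ultrametric_field"
  assumes "p \<noteq> 0" and "\<And>x. poly p x = 0 \<Longrightarrow> s \<le> ac_av x \<and> ac_av x \<le> r" and "0 < s"
    and "adapted_seminorm n A s r q" and "dominates n q (poly_apply n (\<lambda>i j. to_ac (A j i)) p v)"
  shows "\<exists>q'. adapted_seminorm n A s r q' \<and> (\<forall>x. q x \<le> q' x) \<and> dominates n q' v"
  using assms
proof (induction "Polynomial.degree p" arbitrary: p q)
  case 0
  let ?B = "\<lambda>i j. to_ac (A j i)"
  define c where "c = Polynomial.coeff p 0"
  have c: "c \<noteq> 0" using 0(1,2) unfolding c_def by (metis leading_coeff_0_iff)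
  have pv: "poly_apply n ?B p v = (\<lambda>i. c * v i)" by (simp add: poly_apply_def c_def flip: 0(1))
  obtain C where C: "0 \<le> C" "\<And>x. ac_av (pairing n (\<lambda>i. c * v i) x) \<le> C * q x"
    using 0(6) unfolding dominates_def pv by blast
  have "ac_av (pairing n v x) \<le> (C / ac_av c) * q x" for x
  proof -
    have "pairing n (\<lambda>i. c * v i) x = c * pairing n v x"
      by (simp add: pairing_def sum_distrib_left mult.assoc)
    then have "ac_av c * ac_av (pairing n v x) \<le> C * q x" using C(2)[of x] by (simp add: ac_av_mult)
    then show ?thesis using c by (simp add: field_simps)
  qed
  moreover have "0 \<le> C / ac_av c" using C by simp
  ultimately have "dominates n q v" unfolding dominates_def by blast
  with 0(5) show ?case by blast
next
  case (Suc d)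
  let ?B = "\<lambda>i j. to_ac (A j i)"
  obtain x where x: "poly p x = 0" using alg_closed_imp_poly_has_root[of p] Suc(2) by auto
  then obtain p' where p': "p = [:- x, 1:] * p'" by (metis poly_eq_0_iff_dvd dvdE)
  have p'0: "p' \<noteq> 0" using Suc.prems(1) p' by auto
  have "Polynomial.degree p = Suc (Polynomial.degree p')" unfolding p' using p'0
    by (subst degree_mult_eq) auto
  then have d: "d = Polynomial.degree p'" using Suc(2) by simp
  have "dominates n q (\<lambda>i. mvec n n ?B (poly_apply n ?B p' v) i - x * poly_apply n ?B p' v i)"
    using Suc.prems(5) unfolding p' poly_apply_linear_factor .
  then obtain q1 where q1: "adapted_seminorm n A s r q1" "\<And>x. q x \<le> q1 x"
      "dominates n q1 (poly_apply n ?B p' v)"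
    using adapted_seminorm_step[OF Suc.prems(4,3), of x] Suc.prems(2)[OF x] by blast
  have roots: "s \<le> ac_av z \<and> ac_av z \<le> r" if "poly p' z = 0" for z
    using Suc.prems(2)[of z] that unfolding p' by simp
  from Suc(1)[OF d p'0 roots Suc.prems(3) q1(1,3)] obtain q2 where
    "adapted_seminorm n A s r q2" "\<And>x. q1 x \<le> q2 x" "dominates n q2 v" by blast
  with q1(2) show ?case by (meson order_trans)
qed

text \<open>Each coordinate form is adjoined together with the chain of forms given by its
  annihilating polynomial, whose roots are eigenvalues and hence satisfy the bounds s and r.\<close>

lemma ex_adapted_norm:
  fixes A :: "nat \<Rightarrow> nat \<Rightarrow> 'k::complete_ultrametric_field"
  assumes s: "0 < s"
    and ev: "\<And>\<mu>. eigenvalue_of n (\<lambda>i j. to_ac (A i j)) \<mu> \<Longrightarrow> s \<le> ac_av \<mu> \<and> ac_av \<mu> \<le> r"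
  shows "\<exists>q. adapted_seminorm n A s r q \<and> (\<exists>C\<ge>0. \<forall>x. vnorm n x \<le> C * q x)"
proof -
  let ?B = "\<lambda>i j. to_ac (A j i)"
  have evB: "s \<le> ac_av \<mu> \<and> ac_av \<mu> \<le> r" if "eigenvalue_of n ?B \<mu>" for \<mu>
    using eigenvalue_of_transpose[OF that] by (rule ev)
  have "\<exists>q. adapted_seminorm n A s r q \<and> (\<forall>j<m. dominates n q (unit_vec j))" if "m \<le> n" for m
    using that
  proof (induction m)
    case 0
    have "adapted_seminorm n A s r (\<lambda>_. 0)"
      unfolding adapted_seminorm_def by (auto intro!: exI[of _ 0])
    then show ?case by auto
  next
    case (Suc m)
    then obtain q where q: "adapted_seminorm n A s r q" "\<And>j. j < m \<Longrightarrow> dominates n q (unit_vec j)"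
      by auto
    have "unit_vec m \<in> coord_space n" using Suc.prems by simp
    then obtain p where p: "p \<noteq> 0" "poly_apply n ?B p (unit_vec m) = (\<lambda>_. 0)"
      "\<And>x. poly p x = 0 \<Longrightarrow> eigenvalue_of n ?B x"
      using ex_annihilating_poly_eigenvalues[of "unit_vec m" n ?B] by blast
    have q_nonneg: "0 \<le> q x" for x using q(1) unfolding adapted_seminorm_def by blast
    \<comment> \<open>The chain starts at the zero form, which every seminorm dominates.\<close>
    have "dominates n q (poly_apply n ?B p (unit_vec m))"
      unfolding dominates_def p(2) by (auto simp: pairing_def intro!: exI[of _ 0])
    from adapted_seminorm_poly[OF p(1) evB[OF p(3)] s q(1) this] obtain q' where q':
      "adapted_seminorm n A s r q'" "\<And>x. q x \<le> q' x" "dominates n q' (unit_vec m)" by blast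
    have "dominates n q' (unit_vec j)" if "j < Suc m" for j
      using that q'(3) dominates_mono[OF q(2) q'(2)] by (cases "j = m") auto
    with q'(1) show ?case by blast
  qed
  from this[of n] obtain q where q: "adapted_seminorm n A s r q"
    "\<forall>j<n. \<exists>C. 0 \<le> C \<and> (\<forall>x. ac_av (pairing n (unit_vec j) x) \<le> C * q x)"
    unfolding dominates_def by auto
  then obtain C where C: "\<And>j. j < n \<Longrightarrow> 0 \<le> C j"
    "\<And>j x. j < n \<Longrightarrow> ac_av (pairing n (unit_vec j) x) \<le> C j * q x" by metis
  have q_nonneg: "0 \<le> q x" for x using q(1) unfolding adapted_seminorm_def by blast
  have "vnorm n x \<le> (\<Sum>j<n. C j) * q x" for x
  proof (subst vnorm_le_iff)
    show "0 \<le> (\<Sum>j<n. C j) * q x" using C(1) q_nonneg by (intro mult_nonneg_nonneg sum_nonneg) auto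
    show "\<forall>i<n. av (x i) \<le> (\<Sum>j<n. C j) * q x"
    proof (intro allI impI)
      fix i assume i: "i < n"
      have "av (x i) \<le> C i * q x" using C(2)[OF i, of x] i by (simp add: pairing_unit_vec)
      also have "\<dots> \<le> (\<Sum>j<n. C j) * q x"
        using i C(1) q_nonneg by (intro mult_right_mono member_le_sum) auto
      finally show "av (x i) \<le> (\<Sum>j<n. C j) * q x" .
    qed
  qed
  moreover have "0 \<le> (\<Sum>j<n. C j)" using C(1) by (intro sum_nonneg) auto
  ultimately show ?thesis using q(1) by blast
qed

section \<open>Strict differentiability of analytic maps\<close>

definition vdist :: "nat \<Rightarrow> (nat \<Rightarrow> 'k::complete_ultrametric_field) \<Rightarrow> (nat \<Rightarrow> 'k) \<Rightarrow> real" where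
  "vdist n x y = vnorm n (\<lambda>i. x i - y i)"

lemma vdist_nonneg [simp]: "0 \<le> vdist n x y"
  by (simp add: vdist_def)

lemma vdist_self [simp]: "vdist n x x = 0"
  by (simp add: vdist_def)

lemma vdist_less_iff: "0 < r \<Longrightarrow> vdist n x y < r \<longleftrightarrow> (\<forall>i<n. av (x i - y i) < r)"
  unfolding vdist_def by (rule vnorm_less_iff)

lemma av_le_vdist: "i < n \<Longrightarrow> av (x i - y i) \<le> vdist n x y"
  unfolding vdist_def by (rule av_le_vnorm)

text \<open>Strict differentiability in the quantitative form that power series provide: near a the
  error is Lipschitz with a constant proportional to the radius. The two-point form is what
  comparisons of orbits and the Newton-type iteration require.\<close>

definition strictly_diff ::
    "nat \<Rightarrow> nat \<Rightarrow> ((nat \<Rightarrow> 'k::complete_ultrametric_field) \<Rightarrow> (nat \<Rightarrow> 'k)) \<Rightarrow> (nat \<Rightarrow> 'k)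
      \<Rightarrow> (nat \<Rightarrow> nat \<Rightarrow> 'k) \<Rightarrow> bool" where
  "strictly_diff n m g a A \<longleftrightarrow> (\<exists>r>0. \<exists>C\<ge>0.
     (\<forall>x\<in>coord_space n. vdist n x a < r \<longrightarrow> g x \<in> coord_space m) \<and>
     (\<forall>x\<in>coord_space n. \<forall>y\<in>coord_space n. vdist n x a < r \<longrightarrow> vdist n y a < r \<longrightarrow>
        vnorm m (\<lambda>j. g x j - g y j - mvec n m A (\<lambda>i. x i - y i) j)
          \<le> C * max (vdist n x a) (vdist n y a) * vdist n x y))"

lemma strictly_diffE:
  assumes "strictly_diff n m g a A"
  obtains r C where "0 < r" "0 \<le> C"
    "\<And>x. x \<in> coord_space n \<Longrightarrow> vdist n x a < r \<Longrightarrow> g x \<in> coord_space m"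
    "\<And>x y. x \<in> coord_space n \<Longrightarrow> y \<in> coord_space n \<Longrightarrow> vdist n x a < r \<Longrightarrow> vdist n y a < r \<Longrightarrow>
        vnorm m (\<lambda>j. g x j - g y j - mvec n m A (\<lambda>i. x i - y i) j)
          \<le> C * max (vdist n x a) (vdist n y a) * vdist n x y"
  using assms unfolding strictly_diff_def by blast

text \<open>A product rule for increments. The factor \<rho> on the left stands for a division by
  \<rho> on the right, so monomials are covered without exponents lowered by one, including exponent
  0.\<close>

lemma av_mult_diff_le:
  fixes a b a' b' :: "'k::complete_ultrametric_field"
  assumes "0 \<le> \<rho>" "av a \<le> P" "av b' \<le> Q" "\<rho> * av (a - a') \<le> \<delta> * P" "\<rho> * av (b - b') \<le> \<delta> * Q"
  shows "\<rho> * av (a * b - a' * b') \<le> \<delta> * (P * Q)"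
proof -
  have nn: "0 \<le> P" "0 \<le> Q" using assms(2,3) av_nonneg order_trans by blast+
  have "a * b - a' * b' = a * (b - b') + (a - a') * b'" by (simp add: algebra_simps)
  then have "av (a * b - a' * b') \<le> max (av a * av (b - b')) (av (a - a') * av b')"
    using av_ultrametric[of "a * (b - b')" "(a - a') * b'"] by (simp add: av_mult)
  then have "\<rho> * av (a * b - a' * b') \<le> \<rho> * max (av a * av (b - b')) (av (a - a') * av b')"
    using assms(1) by (rule mult_left_mono)
  also have "\<dots> = max (av a * (\<rho> * av (b - b'))) ((\<rho> * av (a - a')) * av b')"
    using assms(1) by (subst max_mult_distrib_left) (auto simp: mult_ac)
  also have "\<dots> \<le> \<delta> * (P * Q)"
  proof (rule max.boundedI)
    have "av a * (\<rho> * av (b - b')) \<le> P * (\<delta> * Q)"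
      using assms(1) by (intro mult_mono[OF assms(2,5) nn(1)]) simp
    then show "av a * (\<rho> * av (b - b')) \<le> \<delta> * (P * Q)" by (simp add: mult_ac)
    have "(\<rho> * av (a - a')) * av b' \<le> (\<delta> * P) * Q"
    proof (rule mult_mono[OF assms(4,3)])
      have "0 \<le> \<rho> * av (a - a')" using assms(1) by simp
      then show "0 \<le> \<delta> * P" using assms(4) by linarith
    qed simp
    then show "(\<rho> * av (a - a')) * av b' \<le> \<delta> * (P * Q)" by (simp add: mult_ac)
  qed
  finally show ?thesis .
qed

lemma av_power_diff_le:
  fixes x y :: "'k::complete_ultrametric_field"
  assumes "av x \<le> \<rho>" "av y \<le> \<rho>" "av (x - y) \<le> \<delta>" "0 \<le> \<rho>" "0 \<le> \<delta>"
  shows "\<rho> * av (x ^ k - y ^ k) \<le> \<delta> * \<rho> ^ k"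
proof (induction k)
  case (Suc k)
  have "av (y ^ k) \<le> \<rho> ^ k" using assms by (simp add: av_power power_mono)
  moreover have "\<rho> * av (x - y) \<le> \<delta> * \<rho>"
    using mult_right_mono[OF assms(3,4)] by (simp only: mult.commute)
  ultimately have "\<rho> * av (x * x ^ k - y * y ^ k) \<le> \<delta> * (\<rho> * \<rho> ^ k)"
    using assms Suc by (intro av_mult_diff_le) auto
  then show ?case by simp
qed (simp add: assms)

lemma av_monomial_le:
  fixes x :: "nat \<Rightarrow> 'k::complete_ultrametric_field"
  assumes "\<And>i. i < n \<Longrightarrow> av (x i) \<le> \<rho>"
  shows "av (\<Prod>i<n. x i ^ \<nu> i) \<le> \<rho> ^ (\<Sum>i<n. \<nu> i)"
  unfolding av_prod av_power power_sum using assms by (intro prod_mono) (auto intro: power_mono)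

lemma av_monomial_diff_le:
  fixes x y :: "nat \<Rightarrow> 'k::complete_ultrametric_field"
  assumes "\<And>i. i < n \<Longrightarrow> av (x i) \<le> \<rho>" "\<And>i. i < n \<Longrightarrow> av (y i) \<le> \<rho>"
    "\<And>i. i < n \<Longrightarrow> av (x i - y i) \<le> \<delta>" "0 \<le> \<rho>" "0 \<le> \<delta>"
  shows "\<rho> * av ((\<Prod>i<n. x i ^ \<nu> i) - (\<Prod>i<n. y i ^ \<nu> i)) \<le> \<delta> * \<rho> ^ (\<Sum>i<n. \<nu> i)"
  using assms(1-3)
proof (induction n)
  case (Suc n)
  have "\<rho> * av ((\<Prod>i<n. x i ^ \<nu> i) * x n ^ \<nu> n - (\<Prod>i<n. y i ^ \<nu> i) * y n ^ \<nu> n)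
      \<le> \<delta> * (\<rho> ^ (\<Sum>i<n. \<nu> i) * \<rho> ^ \<nu> n)"
  proof (rule av_mult_diff_le)
    show "av (\<Prod>i<n. x i ^ \<nu> i) \<le> \<rho> ^ (\<Sum>i<n. \<nu> i)" using Suc.prems by (intro av_monomial_le) auto
    show "av (y n ^ \<nu> n) \<le> \<rho> ^ \<nu> n" using Suc.prems(2)[of n] by (simp add: av_power power_mono)
    show "\<rho> * av ((\<Prod>i<n. x i ^ \<nu> i) - (\<Prod>i<n. y i ^ \<nu> i)) \<le> \<delta> * \<rho> ^ (\<Sum>i<n. \<nu> i)"
      using Suc by auto
    show "\<rho> * av (x n ^ \<nu> n - y n ^ \<nu> n) \<le> \<delta> * \<rho> ^ \<nu> n"
      using Suc.prems assms(4,5) by (intro av_power_diff_le) auto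
  qed (rule assms)
  then show ?case by (simp add: power_add mult.commute)
qed (simp add: assms)

section \<open>Unordered sums and the linearisation of power series\<close>

lemma has_sum_av_limit:
  fixes f :: "'i \<Rightarrow> 'k::complete_ultrametric_field"
  assumes "(f has_sum s) I" "0 < \<epsilon>"
  obtains F where "finite F" "F \<subseteq> I" "\<And>G. finite G \<Longrightarrow> F \<subseteq> G \<Longrightarrow> G \<subseteq> I \<Longrightarrow> av (sum f G - s) < \<epsilon>"
proof -
  have "eventually (\<lambda>G. dist (sum f G) s < \<epsilon>) (finite_subsets_at_top I)"
    using assms unfolding has_sum_def tendsto_iff by blast
  then obtain F where "finite F" "F \<subseteq> I" "\<forall>G. finite G \<and> F \<subseteq> G \<and> G \<subseteq> I \<longrightarrow> dist (sum f G) s < \<epsilon>"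
    unfolding eventually_finite_subsets_at_top by blast
  with that[of F] show ?thesis by (simp add: dist_av)
qed

text \<open>Outside a suitable finite set every term is a difference of two partial sums close to s;
  inside it there are finitely many terms.\<close>

lemma has_sum_terms_bounded:
  fixes f :: "'i \<Rightarrow> 'k::complete_ultrametric_field"
  assumes "(f has_sum s) I"
  obtains B where "0 \<le> B" "\<And>\<nu>. \<nu> \<in> I \<Longrightarrow> av (f \<nu>) \<le> B"
proof -
  obtain F where F: "finite F" "F \<subseteq> I"
    "\<And>G. finite G \<Longrightarrow> F \<subseteq> G \<Longrightarrow> G \<subseteq> I \<Longrightarrow> av (sum f G - s) < 1"
    using has_sum_av_limit[OF assms, of 1] by (metis zero_less_one)
  define B where "B = max 1 (\<Sum>\<nu>\<in>F. av (f \<nu>))"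
  have "av (f \<nu>) \<le> B" if \<nu>: "\<nu> \<in> I" for \<nu>
  proof (cases "\<nu> \<in> F")
    case True
    then have "av (f \<nu>) \<le> (\<Sum>\<nu>\<in>F. av (f \<nu>))" using F(1) by (intro member_le_sum) auto
    then show ?thesis by (simp add: B_def)
  next
    case False
    then have "f \<nu> = (sum f (insert \<nu> F) - s) - (sum f F - s)" using F(1) by simp
    then have "av (f \<nu>) \<le> max (av (sum f (insert \<nu> F) - s)) (av (sum f F - s))"
      using av_diff by metis
    also have "\<dots> \<le> 1"
      using F(3)[of "insert \<nu> F"] F(3)[of F] F(1,2) \<nu> by (intro max.boundedI less_imp_le) blast+
    finally show ?thesis by (simp add: B_def)
  qed
  with that[of B] show ?thesis by (simp add: B_def)
qed

lemma multi_index_degree_le_1: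
  assumes "\<nu> \<in> multi_indices n" "(\<Sum>i<n. \<nu> i) \<le> Suc 0"
  shows "(\<Sum>i<n. \<nu> i) = 0 \<or> (\<exists>i<n. \<nu> = unit_vec i)"
proof (cases "(\<Sum>i<n. \<nu> i) = 0")
  case False
  then have s: "(\<Sum>i<n. \<nu> i) = 1" using assms(2) by linarith
  then obtain i where i: "i < n" "\<nu> i = 1" "\<forall>j<n. j \<noteq> i \<longrightarrow> \<nu> j = 0"
    using sum_eq_1_iff[of "{..<n}" \<nu>] by auto
  have "\<nu> = unit_vec i"
  proof
    fix j show "\<nu> j = unit_vec i j"
      using i assms(1) by (cases "j < n") (auto simp: unit_vec_def multi_indices_def)
  qed
  with i(1) show ?thesis by blast
qed simp

lemma monomial_unit_vec: "i < n \<Longrightarrow> (\<Prod>j<n. x j ^ unit_vec i j) = (x i :: 'a::comm_ring_1)"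
proof -
  assume i: "i < n"
  have "(\<Prod>j<n. x j ^ unit_vec i j) = (\<Prod>j<n. if j = i then x j else 1)"
    by (intro prod.cong) (auto simp: unit_vec_def)
  then show ?thesis using i by simp
qed

text \<open>Terms of degree 0 cancel, terms of degree 1 form the linear part, and each term of
  higher degree has an increment of order \<open>\<rho> * \<delta>\<close>. By ultrametricity the
  worst single term bounds the whole remainder.\<close>

lemma power_series_strict_estimate:
  fixes c :: "(nat \<Rightarrow> nat) \<Rightarrow> 'k::complete_ultrametric_field"
  assumes X: "((\<lambda>\<nu>. c \<nu> * (\<Prod>i<n. x i ^ \<nu> i)) has_sum s) (multi_indices n)"
    and Y: "((\<lambda>\<nu>. c \<nu> * (\<Prod>i<n. y i ^ \<nu> i)) has_sum s') (multi_indices n)"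
    and B: "0 \<le> B" "\<And>\<nu>. \<nu> \<in> multi_indices n \<Longrightarrow> av (c \<nu>) * t ^ (\<Sum>i<n. \<nu> i) \<le> B"
    and \<rho>: "0 < \<rho>" "\<rho> \<le> t" "\<And>i. i < n \<Longrightarrow> av (x i) \<le> \<rho>" "\<And>i. i < n \<Longrightarrow> av (y i) \<le> \<rho>"
    and \<delta>: "0 \<le> \<delta>" "\<And>i. i < n \<Longrightarrow> av (x i - y i) \<le> \<delta>"
  shows "av (s - s' - (\<Sum>i<n. c (unit_vec i) * (x i - y i))) \<le> B / t\<^sup>2 * \<rho> * \<delta>"
proof -
  let ?I = "multi_indices n"
  define K where "K = B / t\<^sup>2 * \<rho> * \<delta>"
  have t: "0 < t" using \<rho> by linarith
  have K0: "0 \<le> K" using B \<rho> \<delta> t by (simp add: K_def)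
  define X' where "X' = (\<lambda>\<nu>. c \<nu> * (\<Prod>i<n. x i ^ \<nu> i))"
  define Y' where "Y' = (\<lambda>\<nu>. c \<nu> * (\<Prod>i<n. y i ^ \<nu> i))"
  have summand: "av (X' \<nu> - Y' \<nu>) \<le> K" if \<nu>: "\<nu> \<in> ?I" "\<nu> \<notin> unit_vec ` {..<n}" for \<nu>
  proof (cases "(\<Sum>i<n. \<nu> i) \<le> Suc 0")
    case True
    with multi_index_degree_le_1[OF \<nu>(1) True] \<nu>(2) have "(\<Sum>i<n. \<nu> i) = 0" by auto
    then have "X' \<nu> = Y' \<nu>" by (simp add: X'_def Y'_def)
    then show ?thesis using K0 by simp
  next
    case False
    \<comment> \<open>One factor \<delta> and one factor \<rho> are kept; the other d factors are
      estimated by t, where the coefficients are under control.\<close>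
    define d where "d = (\<Sum>i<n. \<nu> i) - 2"
    have d: "(\<Sum>i<n. \<nu> i) = d + 2" using False by (simp add: d_def)
    let ?D = "av ((\<Prod>i<n. x i ^ \<nu> i) - (\<Prod>i<n. y i ^ \<nu> i))"
    have "\<rho> * ?D \<le> \<delta> * \<rho> ^ (\<Sum>i<n. \<nu> i)"
      using \<rho> \<delta> by (intro av_monomial_diff_le) auto
    then have "\<rho> * ?D \<le> \<rho> * (\<delta> * \<rho> * \<rho> ^ d)" unfolding d by (simp add: power2_eq_square power_add mult_ac)
    then have "?D \<le> \<delta> * \<rho> * \<rho> ^ d" using \<rho>(1) by simp
    also have "\<dots> \<le> \<delta> * \<rho> * t ^ d" using \<rho> \<delta> by (intro mult_left_mono power_mono) auto
    finally have "av (c \<nu>) * ?D \<le> av (c \<nu>) * (\<delta> * \<rho> * t ^ d)" by (intro mult_left_mono) auto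
    also have "\<dots> = (av (c \<nu>) * t ^ (d + 2)) / t\<^sup>2 * \<rho> * \<delta>"
      using t by (simp add: power_add power2_eq_square)
    also have "\<dots> \<le> K"
      unfolding K_def using B(2)[OF \<nu>(1)] \<rho> \<delta> t unfolding d
      by (intro mult_right_mono divide_right_mono) auto
    finally show ?thesis by (simp add: X'_def Y'_def av_mult flip: right_diff_distrib)
  qed
  have units: "(\<Sum>\<nu>\<in>unit_vec ` {..<n}. X' \<nu> - Y' \<nu>) = (\<Sum>i<n. c (unit_vec i) * (x i - y i))"
  proof (subst sum.reindex)
    show "inj_on (unit_vec :: nat \<Rightarrow> nat \<Rightarrow> nat) {..<n}"
      by (rule inj_onI) (metis (full_types) unit_vec_def zero_neq_one)
  qed (auto simp: X'_def Y'_def monomial_unit_vec right_diff_distrib intro!: sum.cong)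
  have "av (s - s' - (\<Sum>i<n. c (unit_vec i) * (x i - y i))) \<le> K + \<epsilon>" if \<epsilon>: "0 < \<epsilon>" for \<epsilon>
  proof -
    obtain F where F: "finite F" "F \<subseteq> ?I"
      "\<And>G. finite G \<Longrightarrow> F \<subseteq> G \<Longrightarrow> G \<subseteq> ?I \<Longrightarrow> av (sum X' G - s) < \<epsilon>"
      unfolding X'_def by (rule has_sum_av_limit[OF X \<epsilon>]) blast
    obtain F' where F': "finite F'" "F' \<subseteq> ?I"
      "\<And>G. finite G \<Longrightarrow> F' \<subseteq> G \<Longrightarrow> G \<subseteq> ?I \<Longrightarrow> av (sum Y' G - s') < \<epsilon>"
      unfolding Y'_def by (rule has_sum_av_limit[OF Y \<epsilon>]) blast
    define U where "U = (unit_vec :: nat \<Rightarrow> nat \<Rightarrow> nat) ` {..<n}"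
    \<comment> \<open>A single finite index set close to both sums and containing all indices of
      degree one, so that the series are compared through finite sums only.\<close>
    define G where "G = F \<union> F' \<union> U"
    have U: "finite U" "U \<subseteq> ?I" by (auto simp: U_def multi_indices_def unit_vec_def)
    have G: "finite G" "F \<subseteq> G" "F' \<subseteq> G" "G \<subseteq> ?I" "U \<subseteq> G" using F F' U by (auto simp: G_def)
    define r where "r = (\<Sum>\<nu>\<in>G - U. X' \<nu> - Y' \<nu>)"
    have r: "av r \<le> K" unfolding r_def using G K0 unfolding U_def by (intro av_sum_le summand) auto
    have "sum X' G - sum Y' G = (\<Sum>\<nu>\<in>G. X' \<nu> - Y' \<nu>)" by (simp add: sum_subtractf)
    also have "\<dots> = r + (\<Sum>\<nu>\<in>U. X' \<nu> - Y' \<nu>)" unfolding r_def using G by (intro sum.subset_diff)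
    finally have "s - s' - (\<Sum>i<n. c (unit_vec i) * (x i - y i)) = r + ((sum Y' G - s') - (sum X' G - s))"
      using units unfolding U_def by (simp add: algebra_simps)
    then have "av (s - s' - (\<Sum>i<n. c (unit_vec i) * (x i - y i)))
        \<le> max (av r) (av ((sum Y' G - s') - (sum X' G - s)))"
      using av_ultrametric by metis
    moreover have "av ((sum Y' G - s') - (sum X' G - s)) \<le> max (av (sum Y' G - s')) (av (sum X' G - s))"
      by (rule av_diff)
    ultimately show ?thesis
      using F(3)[OF G(1,2,4)] F'(3)[OF G(1,3,4)] r K0 \<epsilon> by linarith
  qed
  then show ?thesis unfolding K_def[symmetric] by (rule field_le_epsilon)
qed

lemma analytic_between_strictly_diff:
  fixes g :: "(nat \<Rightarrow> 'k::complete_ultrametric_field) \<Rightarrow> nat \<Rightarrow> 'k"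
  assumes an: "analytic_between n m U g" and a: "a \<in> U"
  shows "\<exists>A. strictly_diff n m g a A"
proof -
  have aC: "a \<in> coord_space n" and gU: "g ` U \<subseteq> coord_space m" using assms unfolding analytic_between_def by auto
  let ?P = "\<lambda>r c. \<forall>x\<in>coord_space n. (\<forall>i<n. av (x i - a i) < r) \<longrightarrow> x \<in> U \<and>
          (\<forall>j<m. ((\<lambda>\<nu>. c j \<nu> * (\<Prod>i<n. (x i - a i) ^ \<nu> i)) has_sum g x j) (multi_indices n))"
  have "\<forall>a\<in>U. \<exists>r>0. \<exists>c :: nat \<Rightarrow> (nat \<Rightarrow> nat) \<Rightarrow> 'k. \<forall>x\<in>coord_space n.
      (\<forall>i<n. av (x i - a i) < r) \<longrightarrow> x \<in> U \<and>
      (\<forall>j<m. ((\<lambda>\<nu>. c j \<nu> * (\<Prod>i<n. (x i - a i) ^ \<nu> i)) has_sum g x j) (multi_indices n))"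
    using an unfolding analytic_between_def by (elim conjE)
  from bspec[OF this a] obtain r where "r > 0 \<and> (\<exists>c. ?P r c)" by (rule exE)
  then have r: "r > 0" and ex: "\<exists>c. ?P r c" by (rule conjunct1, rule conjunct2)
  from ex obtain c where P: "?P r c" by (rule exE)
  have c: "x \<in> U \<and>
          (\<forall>j<m. ((\<lambda>\<nu>. c j \<nu> * (\<Prod>i<n. (x i - a i) ^ \<nu> i)) has_sum g x j) (multi_indices n))"
    if "x \<in> coord_space n" "\<forall>i<n. av (x i - a i) < r" for x
    using mp[OF bspec[OF P that(1)] that(2)] .
  obtain t :: 'k where t: "t \<noteq> 0" "av t < r" using ex_av_small[OF r] by blast
  \<comment> \<open>Every coordinate is displaced by the same t, so each monomial is a power of t,
    and boundedness of the terms at this one point bounds all coefficients.\<close>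
  define x0 where "x0 = (\<lambda>i. if i < n then a i + t else 0)"
  have x0: "x0 \<in> coord_space n" "\<forall>i<n. av (x0 i - a i) < r" using t by (auto simp: x0_def coord_space_def)
  have "\<exists>B\<ge>0. \<forall>\<nu>\<in>multi_indices n. av (c j \<nu>) * av t ^ (\<Sum>i<n. \<nu> i) \<le> B" if j: "j < m" for j
  proof -
    have "((\<lambda>\<nu>. c j \<nu> * (\<Prod>i<n. (x0 i - a i) ^ \<nu> i)) has_sum g x0 j) (multi_indices n)"
      using c[OF x0] j by blast
    then obtain B where B: "0 \<le> B"
      "\<And>\<nu>. \<nu> \<in> multi_indices n \<Longrightarrow> av (c j \<nu> * (\<Prod>i<n. (x0 i - a i) ^ \<nu> i)) \<le> B"
      by (rule has_sum_terms_bounded) blast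
    have "(\<Prod>i<n. (x0 i - a i) ^ \<nu> i) = t ^ (\<Sum>i<n. \<nu> i)" for \<nu>
      unfolding power_sum by (intro prod.cong) (auto simp: x0_def)
    with B show ?thesis by (auto simp: av_mult av_power)
  qed
  then obtain B where B: "\<And>j. j < m \<Longrightarrow> 0 \<le> B j"
    "\<And>j \<nu>. j < m \<Longrightarrow> \<nu> \<in> multi_indices n \<Longrightarrow> av (c j \<nu>) * av t ^ (\<Sum>i<n. \<nu> i) \<le> B j"
    by metis
  define B' where "B' = (\<Sum>j<m. B j)"
  have B'0: "0 \<le> B'" unfolding B'_def using B by (intro sum_nonneg) auto
  have B': "av (c j \<nu>) * av t ^ (\<Sum>i<n. \<nu> i) \<le> B'" if "j < m" "\<nu> \<in> multi_indices n" for j \<nu>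
  proof -
    have "B j \<le> B'" unfolding B'_def using that B(1) by (intro member_le_sum) auto
    with B(2)[OF that] show ?thesis by linarith
  qed
  \<comment> \<open>The Jacobian matrix, read off from the multi-indices of degree one.\<close>
  define A where "A = (\<lambda>j i. c j (unit_vec i))"
  have "strictly_diff n m g a A"
    unfolding strictly_diff_def
  proof (intro exI conjI ballI impI)
    show "0 < av t" using t by simp
    show "0 \<le> B' / (av t)\<^sup>2" using B'0 by simp
    fix x assume x: "x \<in> coord_space n" "vdist n x a < av t"
    have xr: "\<forall>i<n. av (x i - a i) < r"
      using x(2) av_le_vdist[of _ n x a] t(2) by (meson le_less_trans less_trans)
    show "g x \<in> coord_space m" using c[OF x(1) xr] gU by blast
  next
    fix x y assume x: "x \<in> coord_space n" "vdist n x a < av t" and y: "y \<in> coord_space n" "vdist n y a < av t"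
    have xr: "\<forall>i<n. av (x i - a i) < r"
      using x(2) av_le_vdist[of _ n x a] t(2) by (meson le_less_trans less_trans)
    have yr: "\<forall>i<n. av (y i - a i) < r"
      using y(2) av_le_vdist[of _ n y a] t(2) by (meson le_less_trans less_trans)
    define \<rho> where "\<rho> = max (vdist n x a) (vdist n y a)"
    show "vnorm m (\<lambda>j. g x j - g y j - mvec n m A (\<lambda>i. x i - y i) j)
          \<le> B' / (av t)\<^sup>2 * max (vdist n x a) (vdist n y a) * vdist n x y"
      unfolding \<rho>_def[symmetric]
    \<comment> \<open>The series estimate requires a positive radius; radius 0 leaves only x = y =
      a.\<close>
    proof (cases "\<rho> = 0")
      case True
      then have "vdist n x a = 0" "vdist n y a = 0"
        using vdist_nonneg[of n x a] vdist_nonneg[of n y a] unfolding \<rho>_def by linarith+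
      then have "x i = a i" "y i = a i" if "i < n" for i
        using that vnorm_eq_0_D[of n "\<lambda>i. x i - a i" i] vnorm_eq_0_D[of n "\<lambda>i. y i - a i" i]
        unfolding vdist_def by auto
      then have "x = y" using x y by (intro coord_space_eqI) auto
      then show "vnorm m (\<lambda>j. g x j - g y j - mvec n m A (\<lambda>i. x i - y i) j)
          \<le> B' / (av t)\<^sup>2 * \<rho> * vdist n x y" by simp
    next
      case False
      then have \<rho>: "0 < \<rho>" "\<rho> \<le> av t"
        using x(2) y(2) vdist_nonneg[of n x a] vdist_nonneg[of n y a] unfolding \<rho>_def by linarith+
      show "vnorm m (\<lambda>j. g x j - g y j - mvec n m A (\<lambda>i. x i - y i) j)
          \<le> B' / (av t)\<^sup>2 * \<rho> * vdist n x y"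
      proof (subst vnorm_le_iff)
        show "0 \<le> B' / (av t)\<^sup>2 * \<rho> * vdist n x y" using B'0 \<rho> by simp
        show "\<forall>j<m. av (g x j - g y j - mvec n m A (\<lambda>i. x i - y i) j) \<le> B' / (av t)\<^sup>2 * \<rho> * vdist n x y"
        proof (intro allI impI)
          fix j assume j: "j < m"
          have "av (g x j - g y j - (\<Sum>i<n. c j (unit_vec i) * ((x i - a i) - (y i - a i))))
              \<le> B' / (av t)\<^sup>2 * \<rho> * vdist n x y"
          proof (rule power_series_strict_estimate)
            show "((\<lambda>\<nu>. c j \<nu> * (\<Prod>i<n. (x i - a i) ^ \<nu> i)) has_sum g x j) (multi_indices n)"
              using c[OF x(1) xr] j by blast
            show "((\<lambda>\<nu>. c j \<nu> * (\<Prod>i<n. (y i - a i) ^ \<nu> i)) has_sum g y j) (multi_indices n)"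
              using c[OF y(1) yr] j by blast
            show "av (c j \<nu>) * av t ^ (\<Sum>i<n. \<nu> i) \<le> B'" if "\<nu> \<in> multi_indices n" for \<nu>
              using B' j that by blast
            show "av (x i - a i) \<le> \<rho>" if "i < n" for i
              using av_le_vdist[OF that, of x a] by (simp add: \<rho>_def)
            show "av (y i - a i) \<le> \<rho>" if "i < n" for i
              using av_le_vdist[OF that, of y a] by (simp add: \<rho>_def)
            show "av ((x i - a i) - (y i - a i)) \<le> vdist n x y" if "i < n" for i
              using av_le_vdist[OF that, of x y] by simp
          qed (use \<rho> B'0 in auto)
          then show "av (g x j - g y j - mvec n m A (\<lambda>i. x i - y i) j) \<le> B' / (av t)\<^sup>2 * \<rho> * vdist n x y"
            using j by (simp add: mvec_def A_def)
        qed
      qed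
    qed
  qed
  then show ?thesis by blast
qed

section \<open>Locality, Lipschitz bounds and the chain rule\<close>

lemma strictly_diff_cong:
  assumes "strictly_diff n m g a A" "0 < \<rho>"
    and eq: "\<And>x. x \<in> coord_space n \<Longrightarrow> vdist n x a < \<rho> \<Longrightarrow> g' x = g x"
  shows "strictly_diff n m g' a A"
  using assms(1)
proof (elim strictly_diffE)
  fix r C assume h: "0 < r" "0 \<le> C"
    "\<And>x. x \<in> coord_space n \<Longrightarrow> vdist n x a < r \<Longrightarrow> g x \<in> coord_space m"
    "\<And>x y. x \<in> coord_space n \<Longrightarrow> y \<in> coord_space n \<Longrightarrow> vdist n x a < r \<Longrightarrow> vdist n y a < r \<Longrightarrow>
        vnorm m (\<lambda>j. g x j - g y j - mvec n m A (\<lambda>i. x i - y i) j)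
          \<le> C * max (vdist n x a) (vdist n y a) * vdist n x y"
  show ?thesis unfolding strictly_diff_def
    by (intro exI[of _ "min r \<rho>"] exI[of _ C] conjI ballI impI) (use h assms(2) in \<open>auto simp: eq\<close>)
qed

lemma strictly_diff_id:
  "strictly_diff n n (\<lambda>x. x) a (\<lambda>i j. if i = j then 1 else (0::'k::complete_ultrametric_field))"
  unfolding strictly_diff_def
proof (intro exI[of _ 1] conjI ballI impI)
  fix x y :: "nat \<Rightarrow> 'k"
  assume "x \<in> coord_space n" "y \<in> coord_space n" "vdist n x a < 1" "vdist n y a < 1"
  have "(\<Sum>i<n. (if j = i then 1 else 0) * (x i - y i)) = (\<Sum>i<n. if j = i then x i - y i else 0)" for j
    by (intro sum.cong) auto
  then have "vnorm n (\<lambda>j. x j - y j - mvec n n (\<lambda>i j. if i = j then 1 else 0) (\<lambda>i. x i - y i) j)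
      \<le> (0::real)"
    by (subst vnorm_le_iff) (auto simp: mvec_def)
  also have "0 \<le> 1 * max (vdist n x a) (vdist n y a) * vdist n x y" by (simp add: le_max_iff_disj)
  finally show "vnorm n (\<lambda>j. x j - y j - mvec n n (\<lambda>i j. if i = j then 1 else 0) (\<lambda>i. x i - y i) j)
      \<le> 1 * max (vdist n x a) (vdist n y a) * vdist n x y" .
qed auto

lemma strictly_diff_lipschitz:
  fixes g :: "(nat \<Rightarrow> 'k::complete_ultrametric_field) \<Rightarrow> nat \<Rightarrow> 'k"
  assumes "strictly_diff n m g a A"
  obtains r K where "0 < r" "0 \<le> K"
    "\<And>x y. x \<in> coord_space n \<Longrightarrow> y \<in> coord_space n \<Longrightarrow> vdist n x a < r \<Longrightarrow> vdist n y a < r \<Longrightarrow>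
        vdist m (g x) (g y) \<le> K * vdist n x y"
proof -
  obtain r C where h: "0 < r" "0 \<le> C"
    "\<And>x y. x \<in> coord_space n \<Longrightarrow> y \<in> coord_space n \<Longrightarrow> vdist n x a < r \<Longrightarrow> vdist n y a < r \<Longrightarrow>
        vnorm m (\<lambda>j. g x j - g y j - mvec n m A (\<lambda>i. x i - y i) j)
          \<le> C * max (vdist n x a) (vdist n y a) * vdist n x y"
    using assms by (rule strictly_diffE) blast
  obtain L where L: "0 \<le> L" "\<And>x. vnorm m (mvec n m A x) \<le> L * vnorm n x"
    using mvec_bounded[of m n A] by blast
  show ?thesis
  proof (rule that[OF h(1), of "max (C * r) L"])
    show "0 \<le> max (C * r) L" using L by auto
    fix x y assume xy: "x \<in> coord_space n" "y \<in> coord_space n" "vdist n x a < r" "vdist n y a < r"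
    let ?e = "\<lambda>j. g x j - g y j - mvec n m A (\<lambda>i. x i - y i) j"
    have "vnorm m ?e \<le> C * max (vdist n x a) (vdist n y a) * vdist n x y" using h(3)[OF xy] .
    also have "\<dots> \<le> C * r * vdist n x y" using xy h by (intro mult_right_mono mult_left_mono) auto
    also have "\<dots> \<le> max (C * r) L * vdist n x y" by (intro mult_right_mono) auto
    finally have 1: "vnorm m ?e \<le> max (C * r) L * vdist n x y" .
    have "vnorm m (mvec n m A (\<lambda>i. x i - y i)) \<le> L * vdist n x y" unfolding vdist_def by (rule L)
    also have "\<dots> \<le> max (C * r) L * vdist n x y" by (intro mult_right_mono) auto
    finally have 2: "vnorm m (mvec n m A (\<lambda>i. x i - y i)) \<le> max (C * r) L * vdist n x y" .
    have "vdist m (g x) (g y) \<le> max (vnorm m ?e) (vnorm m (mvec n m A (\<lambda>i. x i - y i)))"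
      using vnorm_add[of m ?e "mvec n m A (\<lambda>i. x i - y i)"] by (simp add: vdist_def)
    with 1 2 show "vdist m (g x) (g y) \<le> max (C * r) L * vdist n x y" by linarith
  qed
qed

definition mmult :: "nat \<Rightarrow> (nat \<Rightarrow> nat \<Rightarrow> 'a::comm_ring_1) \<Rightarrow> (nat \<Rightarrow> nat \<Rightarrow> 'a) \<Rightarrow> nat \<Rightarrow> nat \<Rightarrow> 'a" where
  "mmult m B A = (\<lambda>i j. \<Sum>k<m. B i k * A k j)"

lemma mvec_mmult: "mvec n l (mmult m B A) x = mvec m l B (mvec n m A x)"
proof
  fix j
  have "(\<Sum>i<n. (\<Sum>k<m. B j k * A k i) * x i) = (\<Sum>i<n. \<Sum>k<m. B j k * (A k i * x i))"
    by (simp add: sum_distrib_right mult.assoc)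
  also have "\<dots> = (\<Sum>k<m. \<Sum>i<n. B j k * (A k i * x i))" by (rule sum.swap)
  finally show "mvec n l (mmult m B A) x j = mvec m l B (mvec n m A x) j"
    by (simp add: mvec_def mmult_def sum_distrib_left)
qed

lemma strictly_diff_compose:
  fixes g h :: "(nat \<Rightarrow> 'k::complete_ultrametric_field) \<Rightarrow> nat \<Rightarrow> 'k"
  assumes g: "strictly_diff n m g a A" and h: "strictly_diff m l h (g a) B" and a: "a \<in> coord_space n"
  shows "strictly_diff n l (\<lambda>x. h (g x)) a (mmult m B A)"
proof -
  obtain r C where r: "0 < r" "0 \<le> C"
    "\<And>x. x \<in> coord_space n \<Longrightarrow> vdist n x a < r \<Longrightarrow> g x \<in> coord_space m"
    "\<And>x y. x \<in> coord_space n \<Longrightarrow> y \<in> coord_space n \<Longrightarrow> vdist n x a < r \<Longrightarrow> vdist n y a < r \<Longrightarrow>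
        vnorm m (\<lambda>j. g x j - g y j - mvec n m A (\<lambda>i. x i - y i) j)
          \<le> C * max (vdist n x a) (vdist n y a) * vdist n x y"
    using g by (rule strictly_diffE) blast
  obtain s D where s: "0 < s" "0 \<le> D"
    "\<And>x. x \<in> coord_space m \<Longrightarrow> vdist m x (g a) < s \<Longrightarrow> h x \<in> coord_space l"
    "\<And>x y. x \<in> coord_space m \<Longrightarrow> y \<in> coord_space m \<Longrightarrow> vdist m x (g a) < s \<Longrightarrow> vdist m y (g a) < s \<Longrightarrow>
        vnorm l (\<lambda>j. h x j - h y j - mvec m l B (\<lambda>i. x i - y i) j)
          \<le> D * max (vdist m x (g a)) (vdist m y (g a)) * vdist m x y"
    using h by (rule strictly_diffE) blast
  obtain r' K where K: "0 < r'" "0 \<le> K"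
    "\<And>x y. x \<in> coord_space n \<Longrightarrow> y \<in> coord_space n \<Longrightarrow> vdist n x a < r' \<Longrightarrow> vdist n y a < r' \<Longrightarrow>
        vdist m (g x) (g y) \<le> K * vdist n x y"
    using g by (rule strictly_diff_lipschitz) blast
  obtain L where L: "0 \<le> L" "\<And>x. vnorm l (mvec m l B x) \<le> L * vnorm m x"
    using mvec_bounded[of l m B] by blast
  \<comment> \<open>The bound \<open>s / (K + 1)\<close> keeps images under the K-Lipschitz map g
    inside the ball where h is estimated.\<close>
  define R where "R = min (min r r') (s / (K + 1))"
  have R: "0 < R" "R \<le> r" "R \<le> r'" using r s K by (auto simp: R_def)
  have close: "vdist m (g x) (g a) \<le> K * vdist n x a" "vdist m (g x) (g a) < s" "g x \<in> coord_space m"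
    if x: "x \<in> coord_space n" "vdist n x a < R" for x
  proof -
    show 1: "vdist m (g x) (g a) \<le> K * vdist n x a" using K(1,3) a x R by auto
    also have "\<dots> \<le> (K + 1) * vdist n x a" by (intro mult_right_mono) auto
    also have "\<dots> < s"
    proof -
      have "vdist n x a < s / (K + 1)" using x(2) by (simp add: R_def)
      then show ?thesis using K(2) by (simp add: field_simps)
    qed
    finally show "vdist m (g x) (g a) < s" .
    show "g x \<in> coord_space m" using r(3) x R by auto
  qed
  show ?thesis unfolding strictly_diff_def
  proof (intro exI conjI ballI impI)
    show "0 < R" by fact
    show "0 \<le> max (D * K * K) (L * C)"
      using mult_nonneg_nonneg[OF L(1) r(2)] by (simp add: le_max_iff_disj)
    show "h (g x) \<in> coord_space l" if "x \<in> coord_space n" "vdist n x a < R" for x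
      using close[OF that] s(3) by blast
  next
    fix x y assume xy: "x \<in> coord_space n" "y \<in> coord_space n" "vdist n x a < R" "vdist n y a < R"
    let ?\<rho> = "max (vdist n x a) (vdist n y a)" and ?E = "max (D * K * K) (L * C)"
    let ?e1 = "\<lambda>j. h (g x) j - h (g y) j - mvec m l B (\<lambda>i. g x i - g y i) j"
    let ?d = "\<lambda>j. g x j - g y j - mvec n m A (\<lambda>i. x i - y i) j"
    have lip: "vdist m (g x) (g y) \<le> K * vdist n x y" using K(3) xy R by auto
    have "vnorm l ?e1 \<le> D * max (vdist m (g x) (g a)) (vdist m (g y) (g a)) * vdist m (g x) (g y)"
      using close[OF xy(1,3)] close[OF xy(2,4)] by (intro s(4)) auto
    also have "\<dots> \<le> D * (K * ?\<rho>) * (K * vdist n x y)"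
    proof (intro mult_mono lip)
      have "K * vdist n x a \<le> K * ?\<rho>" "K * vdist n y a \<le> K * ?\<rho>"
        using K(2) by (intro mult_left_mono; simp)+
      then show "max (vdist m (g x) (g a)) (vdist m (g y) (g a)) \<le> K * ?\<rho>"
        using close(1)[OF xy(1,3)] close(1)[OF xy(2,4)] by linarith
    qed (use s K in \<open>auto simp: le_max_iff_disj\<close>)
    also have "\<dots> = D * K * K * (?\<rho> * vdist n x y)" by (simp add: mult_ac)
    also have "\<dots> \<le> ?E * (?\<rho> * vdist n x y)" by (intro mult_right_mono) (auto simp: le_max_iff_disj)
    finally have 1: "vnorm l ?e1 \<le> ?E * (?\<rho> * vdist n x y)" .
    have "vnorm m ?d \<le> C * ?\<rho> * vdist n x y" using xy R by (intro r(4)) auto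
    then have "L * vnorm m ?d \<le> L * (C * ?\<rho> * vdist n x y)" using L(1) by (rule mult_left_mono)
    also have "\<dots> = (L * C) * (?\<rho> * vdist n x y)" by simp
    also have "\<dots> \<le> ?E * (?\<rho> * vdist n x y)" by (intro mult_right_mono) (auto simp: le_max_iff_disj)
    finally have 2: "vnorm l (mvec m l B ?d) \<le> ?E * (?\<rho> * vdist n x y)" using L(2)[of ?d] by linarith
    \<comment> \<open>The error of the composite is the error of h at the image points plus B
      applied to the error of g.\<close>
    have eq: "(\<lambda>j. h (g x) j - h (g y) j - mvec n l (mmult m B A) (\<lambda>i. x i - y i) j)
        = (\<lambda>j. ?e1 j + mvec m l B ?d j)"
      unfolding mvec_mmult mvec_diff by (intro ext) simp
    show "vnorm l (\<lambda>j. h (g x) j - h (g y) j - mvec n l (mmult m B A) (\<lambda>i. x i - y i) j)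
        \<le> ?E * ?\<rho> * vdist n x y"
      unfolding eq using vnorm_add[of l ?e1 "mvec m l B ?d"] 1 2 by (simp add: mult.assoc)
  qed
qed

text \<open>At \<open>a + t h\<close> the error is quadratic in t, hence the difference quotient
  converges to the linear part.\<close>

lemma differential_eq_mvec:
  fixes g :: "(nat \<Rightarrow> 'k::complete_ultrametric_field) \<Rightarrow> nat \<Rightarrow> 'k"
  assumes g: "strictly_diff n m g a A" and a: "a \<in> coord_space n" and h: "h \<in> coord_space n"
  shows "differential g a h = mvec n m A h"
proof
  fix j
  obtain r C where r: "0 < r" "0 \<le> C"
    "\<And>x. x \<in> coord_space n \<Longrightarrow> vdist n x a < r \<Longrightarrow> g x \<in> coord_space m"
    "\<And>x y. x \<in> coord_space n \<Longrightarrow> y \<in> coord_space n \<Longrightarrow> vdist n x a < r \<Longrightarrow> vdist n y a < r \<Longrightarrow>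
        vnorm m (\<lambda>j. g x j - g y j - mvec n m A (\<lambda>i. x i - y i) j)
          \<le> C * max (vdist n x a) (vdist n y a) * vdist n x y"
    using g by (rule strictly_diffE) blast
  define H where "H = vnorm n h"
  define x where "x = (\<lambda>t i. a i + t * h i)"
  have H0: "0 \<le> H" by (simp add: H_def)
  have xC: "x t \<in> coord_space n" for t using a h by (simp add: x_def coord_space_def)
  have xd: "vdist n (x t) a \<le> av t * H" for t
    using vnorm_scale_le[of n t h] by (simp add: vdist_def x_def H_def)
  have est: "av ((g (x t) j - g a j) / t - mvec n m A h j) \<le> C * H * H * av t"
    if t: "t \<noteq> 0" "av t * (H + 1) < r" for t
  proof -
    have lt: "vdist n (x t) a < r"
    proof -
      have "av t * H \<le> av t * (H + 1)" by (intro mult_left_mono) auto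
      with xd[of t] t(2) show ?thesis by linarith
    qed
    have main: "av (g (x t) j - g a j - t * mvec n m A h j) \<le> C * H * H * av t * av t"
    proof (cases "j < m")
      case True
      let ?e = "\<lambda>j. g (x t) j - g a j - mvec n m A (\<lambda>i. x t i - a i) j"
      have "?e j = g (x t) j - g a j - t * mvec n m A h j" by (simp add: x_def mvec_scale)
      then have "av (g (x t) j - g a j - t * mvec n m A h j) \<le> vnorm m ?e"
        using av_le_vnorm[OF True, of ?e] by simp
      also have "\<dots> \<le> C * max (vdist n (x t) a) (vdist n a a) * vdist n (x t) a"
        using xC a lt r(1) by (intro r(4)) auto
      also have "\<dots> \<le> C * (av t * H) * (av t * H)"
        using xd[of t] r(2) H0 by (intro mult_mono mult_left_mono) auto
      finally show ?thesis by (simp add: mult_ac)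
    next
      \<comment> \<open>Beyond m everything vanishes, since \<open>strictly_diff\<close> includes
        that the values near a lie in \<open>coord_space m\<close>.\<close>
      case False
      then have "g (x t) j = 0" "g a j = 0" "mvec n m A h j = 0"
        using r(3)[OF xC lt] r(3)[OF a] r(1) by (auto simp: coord_space_def mvec_def)
      then show ?thesis using r(2) H0 by simp
    qed
    have "(g (x t) j - g a j) / t - mvec n m A h j = (g (x t) j - g a j - t * mvec n m A h j) / t"
      using t(1) by (simp add: field_simps)
    then have "av ((g (x t) j - g a j) / t - mvec n m A h j) = av (g (x t) j - g a j - t * mvec n m A h j) / av t"
      by (simp add: av_divide)
    also have "\<dots> \<le> C * H * H * av t * av t / av t" using main by (intro divide_right_mono) auto
    finally show ?thesis using t(1) by simp
  qed
  have "((\<lambda>t. (g (x t) j - g a j) / t) \<longlongrightarrow> mvec n m A h j) (at 0)"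
    unfolding tendsto_iff
  proof (intro allI impI)
    fix e :: real assume e: "0 < e"
    \<comment> \<open>The first bound keeps the point inside the ball of radius r, the second makes
      the error smaller than e.\<close>
    define d where "d = min (r / (H + 1)) (e / (C * H * H + 1))"
    have CH: "0 \<le> C * H * H" using r(2) H0 by simp
    have d: "0 < d" unfolding d_def using r(1) e H0 CH by (simp add: add_nonneg_pos)
    show "eventually (\<lambda>t. dist ((g (x t) j - g a j) / t) (mvec n m A h j) < e) (at 0)"
      unfolding eventually_at
    proof (intro exI[of _ d] conjI ballI impI)
      show "0 < d" by fact
      fix t :: 'k assume t: "t \<noteq> 0 \<and> dist t 0 < d"
      then have td: "av t < d" by (simp add: dist_av)
      have "av t < r / (H + 1)" using td by (simp add: d_def)
      then have "av t * (H + 1) < r" using H0 by (simp add: field_simps)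
      then have "av ((g (x t) j - g a j) / t - mvec n m A h j) \<le> C * H * H * av t" using t est by blast
      also have "\<dots> \<le> (C * H * H + 1) * av t" by (intro mult_right_mono) auto
      also have "\<dots> < e"
      proof -
        have "av t < e / (C * H * H + 1)" using td by (simp add: d_def)
        then show ?thesis using CH by (simp add: field_simps)
      qed
      finally show "dist ((g (x t) j - g a j) / t) (mvec n m A h j) < e" by (simp add: dist_av)
    qed
  qed
  then show "differential g a h j = mvec n m A h j"
    unfolding differential_def x_def by (intro tendsto_Lim) auto
qed

section \<open>Dynamics near a fixed point in coordinates\<close>

text \<open>Strict differentiability at a fixed point, rewritten in the adapted norm, where A scales
  lengths by factors between s and r without further constants. C leads back to coordinates.\<close>

locale adapted_fixed_point =
  fixes n :: nat and A :: "nat \<Rightarrow> nat \<Rightarrow> 'k::complete_ultrametric_field" and s r :: real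
    and q :: "(nat \<Rightarrow> 'k) \<Rightarrow> real" and C :: real
    and g :: "(nat \<Rightarrow> 'k) \<Rightarrow> nat \<Rightarrow> 'k" and a :: "nat \<Rightarrow> 'k" and \<rho> K :: real
  assumes adapted: "adapted_seminorm n A s r q"
    and vnorm_le: "\<And>x. vnorm n x \<le> C * q x" and C_nonneg: "0 \<le> C"
    and s_pos: "0 < s" and r_pos: "0 < r"
    and a_mem: "a \<in> coord_space n" and fixed: "g a = a"
    and \<rho>_pos: "0 < \<rho>" and K_nonneg: "0 \<le> K"
    and g_mem: "\<And>x. x \<in> coord_space n \<Longrightarrow> q (\<lambda>i. x i - a i) < \<rho> \<Longrightarrow> g x \<in> coord_space n"
    and g_est: "\<And>x y. x \<in> coord_space n \<Longrightarrow> y \<in> coord_space n \<Longrightarrow>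
        q (\<lambda>i. x i - a i) < \<rho> \<Longrightarrow> q (\<lambda>i. y i - a i) < \<rho> \<Longrightarrow>
        q (\<lambda>j. g x j - g y j - mvec n n A (\<lambda>i. x i - y i) j)
          \<le> K * max (q (\<lambda>i. x i - a i)) (q (\<lambda>i. y i - a i)) * q (\<lambda>i. x i - y i)"
begin

definition dq :: "(nat \<Rightarrow> 'k) \<Rightarrow> (nat \<Rightarrow> 'k) \<Rightarrow> real" where
  "dq x y = q (\<lambda>i. x i - y i)"

lemma q_nonneg [simp]: "0 \<le> q x"
  and q_add: "q (\<lambda>i. x i + y i) \<le> max (q x) (q y)"
  and q_scale: "q (\<lambda>i. c * x i) = av c * q x"
  and q_mvec_ge: "s * q x \<le> q (mvec n n A x)"
  and q_mvec_le: "q (mvec n n A x) \<le> r * q x"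
  using adapted unfolding adapted_seminorm_def by auto

lemma q_bound: obtains D where "0 \<le> D" "\<And>x. q x \<le> D * vnorm n x"
  using adapted unfolding adapted_seminorm_def by blast

lemma q_minus: "q (\<lambda>i. - x i) = q x"
  using q_scale[of "- 1" x] by simp

lemma q_diff: "q (\<lambda>i. x i - y i) \<le> max (q x) (q y)"
  using q_add[of x "\<lambda>i. - y i"] by (simp add: q_minus)

lemma q_add_eq: "q y < q x \<Longrightarrow> q (\<lambda>i. x i + y i) = q x"
  using q_add[of x y] q_diff[of "\<lambda>i. x i + y i" y] by auto

lemma q_zero [simp]: "q (\<lambda>_. 0) = 0"
  using q_scale[of 0 "\<lambda>_. 0"] by simp

lemma dq_nonneg [simp]: "0 \<le> dq x y"
  by (simp add: dq_def)

lemma dq_self [simp]: "dq x x = 0"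
  by (simp add: dq_def)

lemma dq_commute: "dq x y = dq y x"
  using q_minus[of "\<lambda>i. x i - y i"] by (simp add: dq_def)

lemma dq_triangle: "dq x z \<le> max (dq x y) (dq y z)"
  using q_add[of "\<lambda>i. x i - y i" "\<lambda>i. y i - z i"] by (simp add: dq_def)

lemma dq_eq_0_D: "dq x y = 0 \<Longrightarrow> x \<in> coord_space n \<Longrightarrow> y \<in> coord_space n \<Longrightarrow> x = y"
proof (intro coord_space_eqI)
  fix i assume "dq x y = 0" "i < n"
  then have "av (x i - y i) \<le> 0"
    using vnorm_le[of "\<lambda>i. x i - y i"] av_le_vnorm[of i n "\<lambda>i. x i - y i"] by (simp add: dq_def)
  then show "x i = y i" by (metis av_eq_0_iff av_nonneg eq_iff_diff_eq_0 order_antisym)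
qed

lemma vdist_le_dq: "vdist n x y \<le> C * dq x y"
  unfolding vdist_def dq_def by (rule vnorm_le)

lemma g_est_dq:
  assumes "x \<in> coord_space n" "y \<in> coord_space n" "dq x a < \<rho>" "dq y a < \<rho>"
  shows "q (\<lambda>j. g x j - g y j - mvec n n A (\<lambda>i. x i - y i) j) \<le> K * max (dq x a) (dq y a) * dq x y"
  using g_est[of x y] assms by (simp add: dq_def)

lemma dq_g_le:
  assumes "x \<in> coord_space n" "y \<in> coord_space n" "dq x a < \<rho>" "dq y a < \<rho>"
    and "K * max (dq x a) (dq y a) \<le> r"
  shows "dq (g x) (g y) \<le> r * dq x y"
proof -
  let ?e = "\<lambda>j. g x j - g y j - mvec n n A (\<lambda>i. x i - y i) j"
  have "q ?e \<le> r * dq x y"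
    using g_est_dq[OF assms(1-4)] mult_right_mono[OF assms(5), of "dq x y"] by simp
  moreover have "q (mvec n n A (\<lambda>i. x i - y i)) \<le> r * dq x y" using q_mvec_le by (simp add: dq_def)
  ultimately show ?thesis
    using q_add[of ?e "mvec n n A (\<lambda>i. x i - y i)"] by (simp add: dq_def)
qed

text \<open>The strict hypothesis puts the error below the linear part, so the increment of g has
  exactly the length of its linear part.\<close>

lemma dq_g_ge:
  assumes "x \<in> coord_space n" "y \<in> coord_space n" "dq x a < \<rho>" "dq y a < \<rho>"
    and "K * max (dq x a) (dq y a) < s"
  shows "s * dq x y \<le> dq (g x) (g y)"
proof (cases "dq x y = 0")
  case False
  then have pos: "0 < dq x y" using dq_nonneg[of x y] by linarith
  let ?e = "\<lambda>j. g x j - g y j - mvec n n A (\<lambda>i. x i - y i) j"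
  let ?A = "mvec n n A (\<lambda>i. x i - y i)"
  have A: "s * dq x y \<le> q ?A" using q_mvec_ge by (simp add: dq_def)
  have "q ?e < s * dq x y"
    using g_est_dq[OF assms(1-4)] mult_strict_right_mono[OF assms(5) pos] by simp
  with A have "q ?e < q ?A" by linarith
  from q_add_eq[OF this] A show ?thesis by (simp add: dq_def)
qed simp

lemma dq_g_fixed_le:
  assumes "x \<in> coord_space n" "dq x a < \<rho>" "K * dq x a \<le> r"
  shows "dq (g x) a \<le> r * dq x a"
  using dq_g_le[OF assms(1) a_mem assms(2)] assms(3) \<rho>_pos by (simp add: fixed)

lemma dq_g_fixed_ge:
  assumes "x \<in> coord_space n" "dq x a < \<rho>" "K * dq x a < s"
  shows "s * dq x a \<le> dq (g x) a"
  using dq_g_ge[OF assms(1) a_mem assms(2)] assms(3) \<rho>_pos by (simp add: fixed)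

text \<open>For \<open>s = r = 1\<close> the map is an isometry of small balls; the Newton-type iteration
  \<open>x \<mapsto> x + A\<^sup>-\<^sup>1 (w - g x)\<close> shows that it is onto.\<close>

lemma g_surj_ball:
  assumes sr: "s = 1" "r = 1"
    and inv: "\<And>x. x \<in> coord_space n \<Longrightarrow> mvec n n A (mvec n n A' x) = x"
    and \<epsilon>: "\<epsilon> \<le> \<rho>" "K * \<epsilon> \<le> 1 / 2"
    and w: "w \<in> coord_space n" "dq w a < \<epsilon>"
  shows "\<exists>x\<in>coord_space n. dq x a < \<epsilon> \<and> g x = w"
proof -
  \<comment> \<open>All iterates stay in the closed ball of radius \<eta> < \<epsilon>, so the limit
    lies in the open \<epsilon>-ball.\<close>
  define \<eta> where "\<eta> = dq w a"
  have \<eta>: "0 \<le> \<eta>" "\<eta> < \<epsilon>" using w by (auto simp: \<eta>_def)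
  have K\<eta>: "K * \<eta> \<le> 1 / 2"
    using mult_left_mono[of \<eta> \<epsilon> K] \<eta> \<epsilon> K_nonneg by linarith
  define corr where "corr = (\<lambda>x. mvec n n A' (\<lambda>i. w i - g x i))"
  define Z where "Z = rec_nat a (\<lambda>_ x i. x i + corr x i)"
  have Z0: "Z 0 = a" and ZS: "Z (Suc k) = (\<lambda>i. Z k i + corr (Z k) i)" for k by (simp_all add: Z_def)
  have inv1: "Z k \<in> coord_space n \<and> dq (Z k) a \<le> \<eta> \<and> dq w (g (Z k)) \<le> (1/2) ^ k * \<eta>
      \<and> q (corr (Z k)) \<le> (1/2) ^ k * \<eta>" for k
  proof -
    have corr_le: "q (corr x) \<le> dq w (g x)" and A_corr: "mvec n n A (corr x) = (\<lambda>i. w i - g x i)"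
      if "x \<in> coord_space n" "dq x a \<le> \<eta>" for x
    proof -
      have "g x \<in> coord_space n" using that \<eta> \<epsilon> by (intro g_mem) (auto simp: dq_def)
      then show A_corr: "mvec n n A (corr x) = (\<lambda>i. w i - g x i)"
        unfolding corr_def using w by (intro inv coord_space_diff)
      show "q (corr x) \<le> dq w (g x)" using q_mvec_ge[of "corr x"] sr unfolding A_corr dq_def by simp
    qed
    have "Z k \<in> coord_space n \<and> dq (Z k) a \<le> \<eta> \<and> dq w (g (Z k)) \<le> (1/2) ^ k * \<eta>"
    proof (induction k)
      case 0
      then show ?case using a_mem \<eta> by (simp add: Z0 fixed \<eta>_def)
    next
      case (Suc k)
      then have x: "Z k \<in> coord_space n" "dq (Z k) a \<le> \<eta>" "dq w (g (Z k)) \<le> (1/2) ^ k * \<eta>" by auto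
      have qi: "q (corr (Z k)) \<le> (1/2) ^ k * \<eta>" using corr_le[OF x(1,2)] x(3) by linarith
      have "(1/2) ^ k * \<eta> \<le> \<eta>" using \<eta>(1) by (intro mult_left_le_one_le) (auto simp: power_le_one)
      with qi have qi': "q (corr (Z k)) \<le> \<eta>" by linarith
      have y: "Z (Suc k) \<in> coord_space n"
        unfolding ZS using x(1) by (intro coord_space_add) (simp_all add: corr_def)
      have d: "dq (Z (Suc k)) (Z k) = q (corr (Z k))" by (simp add: dq_def ZS)
      have ya: "dq (Z (Suc k)) a \<le> \<eta>"
        using dq_triangle[of "Z (Suc k)" a "Z k"] d qi' x(2) by linarith
      \<comment> \<open>A maps the correction to the old residual, so up to sign the new residual is
        the linearisation error of this step; it is at least halved.\<close>
      let ?e = "\<lambda>j. g (Z (Suc k)) j - g (Z k) j - mvec n n A (\<lambda>i. Z (Suc k) i - Z k i) j"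
      have "(\<lambda>i. Z (Suc k) i - Z k i) = corr (Z k)" by (simp add: ZS)
      then have e: "?e = (\<lambda>j. - (w j - g (Z (Suc k)) j))" using A_corr[OF x(1,2)] by auto
      have "dq w (g (Z (Suc k))) = q ?e" unfolding e q_minus dq_def ..
      also have "\<dots> \<le> K * max (dq (Z (Suc k)) a) (dq (Z k) a) * dq (Z (Suc k)) (Z k)"
        using y x ya \<eta> \<epsilon> by (intro g_est_dq) auto
      also have "\<dots> \<le> K * \<eta> * dq (Z (Suc k)) (Z k)"
        using ya x(2) K_nonneg by (intro mult_right_mono mult_left_mono) auto
      also have "\<dots> \<le> 1 / 2 * ((1/2) ^ k * \<eta>)"
        using K\<eta> qi unfolding d by (intro mult_mono) auto
      finally have "dq w (g (Z (Suc k))) \<le> (1/2) ^ Suc k * \<eta>" by simp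
      with y ya show ?case by blast
    qed
    with corr_le[of "Z k"] show ?thesis by (meson order_trans)
  qed
  then have Xm: "Z k \<in> coord_space n" and Xa: "dq (Z k) a \<le> \<eta>"
    and Xw: "dq w (g (Z k)) \<le> (1/2) ^ k * \<eta>" and Xi: "q (corr (Z k)) \<le> (1/2) ^ k * \<eta>" for k by auto
  have step: "dq (Z (k + d)) (Z k) \<le> (1/2) ^ k * \<eta>" for k d
  proof (induction d)
    case 0
    then show ?case using \<eta> by simp
  next
    case (Suc d)
    have "dq (Z (k + Suc d)) (Z (k + d)) = q (corr (Z (k + d)))" by (simp add: dq_def ZS)
    also have "\<dots> \<le> (1/2) ^ (k + d) * \<eta>" by (rule Xi)
    also have "\<dots> \<le> (1/2) ^ k * \<eta>" using \<eta> by (intro mult_right_mono power_decreasing) auto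
    finally show ?case using dq_triangle[of "Z (k + Suc d)" "Z k" "Z (k + d)"] Suc by linarith
  qed
  have lim0: "(\<lambda>k. B * ((1/2) ^ k * \<eta>)) \<longlonglongrightarrow> 0" for B :: real
    using tendsto_mult_right_zero[OF tendsto_mult_left_zero[OF LIMSEQ_power_zero[of "1/2::real"]]] by simp
  have small: "\<exists>k. B * ((1/2) ^ k * \<eta>) < e" if e: "0 < e" for B e :: real
    using order_tendstoD(2)[OF lim0 e] by (auto simp: eventually_sequentially)
  \<comment> \<open>Convergence is obtained in each coordinate, where completeness of K applies, and
    then carried back to q.\<close>
  have coord: "av (Z (k + d) i - Z k i) \<le> C * ((1/2) ^ k * \<eta>)" if "i < n" for i k d
  proof -
    have "av (Z (k + d) i - Z k i) \<le> vdist n (Z (k + d)) (Z k)" using that by (rule av_le_vdist)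
    also have "\<dots> \<le> C * dq (Z (k + d)) (Z k)" by (rule vdist_le_dq)
    also have "\<dots> \<le> C * ((1/2) ^ k * \<eta>)" using step C_nonneg by (intro mult_left_mono)
    finally show ?thesis .
  qed
  have "\<exists>l. (\<lambda>k. Z k i) \<longlonglongrightarrow> l" for i
  proof (cases "i < n")
    case True
    have "Cauchy (\<lambda>k. Z k i)"
    proof (rule metric_CauchyI)
      fix e :: real assume "0 < e"
      then obtain k where k: "C * ((1/2) ^ k * \<eta>) < e" using small by blast
      have one: "av (Z m i - Z k i) < e" if "k \<le> m" for m
        using coord[OF True, of k "m - k"] k that by simp
      have "dist (Z l i) (Z m i) < e" if "k \<le> l" "k \<le> m" for l m
        using av_diff[of "Z l i - Z k i" "Z m i - Z k i"] one[OF that(1)] one[OF that(2)]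
        by (simp add: dist_av)
      then show "\<exists>M. \<forall>l\<ge>M. \<forall>m\<ge>M. dist (Z l i) (Z m i) < e" by blast
    qed
    then show ?thesis by (simp add: Cauchy_convergent_iff convergent_def)
  next
    case False
    then have "Z k i = 0" for k using Xm[of k] by (simp add: coord_space_def)
    then show ?thesis by auto
  qed
  then obtain x where lim: "\<And>i. (\<lambda>k. Z k i) \<longlonglongrightarrow> x i" by metis
  have x: "x \<in> coord_space n"
    unfolding coord_space_def
  proof (intro CollectI allI impI)
    fix i assume "n \<le> i"
    then have "Z k i = 0" for k using Xm[of k] by (simp add: coord_space_def)
    then have "(\<lambda>k. Z k i) \<longlonglongrightarrow> 0" by simp
    with lim[of i] show "x i = 0" by (rule LIMSEQ_unique)
  qed
  obtain D where D: "0 \<le> D" "\<And>x. q x \<le> D * vnorm n x" by (rule q_bound) blast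
  have conv: "dq x (Z k) \<le> D * C * ((1/2) ^ k * \<eta>)" for k
  proof -
    have "av (x i - Z k i) \<le> C * ((1/2) ^ k * \<eta>)" if i: "i < n" for i
    proof -
      have "(\<lambda>m. dist (Z (m + k) i) (Z k i)) \<longlonglongrightarrow> dist (x i) (Z k i)"
        by (intro tendsto_dist tendsto_const LIMSEQ_ignore_initial_segment lim)
      moreover have "dist (Z (m + k) i) (Z k i) \<le> C * ((1/2) ^ k * \<eta>)" for m
        using coord[OF i, of k m] by (simp add: dist_av add.commute)
      ultimately have "dist (x i) (Z k i) \<le> C * ((1/2) ^ k * \<eta>)"
        by (intro LIMSEQ_le_const2[of "\<lambda>m. dist (Z (m + k) i) (Z k i)"]) auto
      then show ?thesis by (simp add: dist_av)
    qed
    then have "vnorm n (\<lambda>i. x i - Z k i) \<le> C * ((1/2) ^ k * \<eta>)"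
      using C_nonneg \<eta> by (subst vnorm_le_iff) auto
    from mult_left_mono[OF this D(1)] D(2)[of "\<lambda>i. x i - Z k i"] show ?thesis
      by (simp add: dq_def mult.assoc)
  qed
  have xa: "dq x a < \<epsilon>"
  proof -
    have "0 < \<epsilon>" using \<eta> by linarith
    then obtain k where "D * C * ((1/2) ^ k * \<eta>) < \<epsilon>" using small by blast
    then show ?thesis using conv[of k] Xa[of k] \<eta> dq_triangle[of x a "Z k"] by linarith
  qed
  have gx: "g x \<in> coord_space n" using x xa \<epsilon> by (intro g_mem) (auto simp: dq_def)
  have "dq w (g x) \<le> e" if e: "0 < e" for e
  proof -
    obtain k where k: "(1 + D * C) * ((1/2) ^ k * \<eta>) < e" using small[OF e] by blast
    have DC: "0 \<le> D * C" using D C_nonneg by simp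
    have p: "0 \<le> (1/2) ^ k * \<eta>" using \<eta> by simp
    have "dq (g (Z k)) (g x) \<le> r * dq (Z k) x"
    proof (rule dq_g_le)
      have "max (dq (Z k) a) (dq x a) \<le> \<epsilon>" using Xa[of k] xa \<eta> by simp
      from mult_left_mono[OF this K_nonneg] show "K * max (dq (Z k) a) (dq x a) \<le> r"
        using \<epsilon> sr by linarith
      show "dq (Z k) a < \<rho>" using Xa[of k] \<eta> \<epsilon> by linarith
    qed (use Xm x xa \<epsilon> in auto)
    also have "\<dots> = dq x (Z k)" using sr by (simp add: dq_commute)
    finally have "dq (g (Z k)) (g x) \<le> (1 + D * C) * ((1/2) ^ k * \<eta>)"
      using conv[of k] p by (simp add: distrib_right)
    moreover have "dq w (g (Z k)) \<le> (1 + D * C) * ((1/2) ^ k * \<eta>)"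
      using Xw[of k] mult_nonneg_nonneg[OF DC p] by (simp add: distrib_right)
    ultimately show ?thesis using dq_triangle[of w "g x" "g (Z k)"] k by linarith
  qed
  then have "dq w (g x) \<le> 0" by (rule dense_ge)
  then have "dq w (g x) = 0" using dq_nonneg[of w "g x"] by linarith
  then have "w = g x" using w(1) gx by (rule dq_eq_0_D)
  with x xa show ?thesis by blast
qed

section \<open>Growth of a linear form along orbits\<close>

definition ev_size :: "(nat \<Rightarrow> 'k alg_closure) \<Rightarrow> (nat \<Rightarrow> 'k) \<Rightarrow> real" where
  "ev_size v z = ac_av (pairing n v (\<lambda>i. z i - a i))"

lemma ev_size_bound: obtains E where "0 \<le> E" "\<And>x. ac_av (pairing n v x) \<le> E * q x"
proof -
  obtain F where F: "0 \<le> F" "\<And>x. ac_av (pairing n v x) \<le> F * vnorm n x"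
    using pairing_le_vnorm[of n v] by blast
  have "ac_av (pairing n v x) \<le> F * C * q x" for x
    using F(2)[of x] mult_left_mono[OF vnorm_le[of x] F(1)] by simp
  then show ?thesis using that[of "F * C"] F(1) C_nonneg by simp
qed

text \<open>If \<open>v i\<close> is nonzero, all points a + t e_i lie in one cone, because both |v|
  and q scale with \<open>av t\<close>. These are points over K, as they must be.\<close>

lemma cone_points:
  assumes v: "v \<in> coord_space n" "v \<noteq> (\<lambda>_. 0)"
  obtains \<kappa> where "0 < \<kappa>"
    "\<And>\<eta>. 0 < \<eta> \<Longrightarrow> \<exists>z\<in>coord_space n. dq z a < \<eta> \<and> 0 < ev_size v z \<and> \<kappa> * dq z a \<le> ev_size v z"
proof -
  obtain i where i: "v i \<noteq> 0" using v(2) by (auto simp: fun_eq_iff)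
  have n: "i < n"
  proof (rule ccontr)
    assume "\<not> i < n"
    with v(1) i show False by (simp add: coord_space_def)
  qed
  define Q where "Q = q (unit_vec i) + 1"
  have Q: "0 < Q" "q (unit_vec i) \<le> Q" by (auto simp: Q_def add_nonneg_pos)
  have pu: "pairing n v (unit_vec i) = v i"
  proof -
    have "pairing n v (unit_vec i) = (\<Sum>j<n. if j = i then v j else 0)"
      unfolding pairing_def by (intro sum.cong) (auto simp: unit_vec_def)
    then show ?thesis using n by simp
  qed
  show ?thesis
  proof (rule that[of "ac_av (v i) / Q"])
    show "0 < ac_av (v i) / Q" using i Q by simp
    fix \<eta> :: real assume "0 < \<eta>"
    then have "0 < \<eta> / Q" using Q by simp
    then obtain t :: 'k where t: "t \<noteq> 0" "av t < \<eta> / Q" by (rule ex_av_small)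
    define z where "z = (\<lambda>j. a j + t * unit_vec i j)"
    have z: "z \<in> coord_space n"
      unfolding z_def using a_mem n by (intro coord_space_add coord_space_scale) auto
    have dz: "dq z a = av t * q (unit_vec i)" by (simp add: dq_def z_def q_scale)
    have ez: "ev_size v z = av t * ac_av (v i)"
      by (simp add: ev_size_def z_def pairing_scale pu ac_av_mult)
    have le: "dq z a \<le> av t * Q" unfolding dz using Q by (intro mult_left_mono) auto
    have "dq z a < \<eta>" using le t(2) Q(1) by (simp add: field_simps)
    moreover have "0 < ev_size v z" unfolding ez using t i by simp
    moreover have "ac_av (v i) / Q * dq z a \<le> ac_av (v i) / Q * (av t * Q)"
      using le Q by (intro mult_left_mono) auto
    then have "ac_av (v i) / Q * dq z a \<le> ev_size v z" unfolding ez using Q(1) by (simp add: mult.commute)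
    ultimately show "\<exists>z\<in>coord_space n. dq z a < \<eta> \<and> 0 < ev_size v z
        \<and> ac_av (v i) / Q * dq z a \<le> ev_size v z" using z by blast
  qed
qed

lemma small_radius:
  assumes "0 \<le> M" "0 < b"
  shows "\<exists>\<delta>>0. \<forall>d. 0 \<le> d \<longrightarrow> d < \<delta> \<longrightarrow> M * d < (b::real)"
proof (intro exI[of _ "b / (M + 1)"] conjI allI impI)
  show "0 < b / (M + 1)" using assms by simp
  fix d assume d: "0 \<le> d" "d < b / (M + 1)"
  then have "d * (M + 1) < b" using assms by (simp add: pos_less_divide_eq)
  with d show "M * d < b" by (simp add: algebra_simps)
qed

lemma pairing_g:
  assumes "mvec n n (\<lambda>i j. to_ac (A j i)) v = (\<lambda>i. \<mu> * v i)"
  shows "pairing n v (\<lambda>i. g x i - a i)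
    = \<mu> * pairing n v (\<lambda>i. x i - a i) + pairing n v (\<lambda>j. g x j - g a j - mvec n n A (\<lambda>i. x i - a i) j)"
proof -
  have "pairing n v (\<lambda>i. g x i - a i) = pairing n v (mvec n n A (\<lambda>i. x i - a i))
      + pairing n v (\<lambda>j. g x j - g a j - mvec n n A (\<lambda>i. x i - a i) j)"
    unfolding pairing_add[symmetric] by (simp add: fixed)
  moreover have "pairing n v (mvec n n A (\<lambda>i. x i - a i)) = \<mu> * pairing n v (\<lambda>i. x i - a i)"
    unfolding pairing_mvec assms by (simp add: pairing_def sum_distrib_left mult.assoc)
  ultimately show ?thesis by simp
qed

text \<open>The cone \<open>|v (z - a)| \<ge> \<kappa> q (z - a)\<close> is invariant under \<open>g\<close> near \<open>a\<close> if \<open>|\<mu>| = r\<close>, because \<open>A\<close>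
  expands no direction by more than \<open>r\<close>; for \<open>|\<mu>| = s\<close> the same holds for backward orbits.\<close>

lemma forward_cone:
  assumes v: "v \<in> coord_space n" "v \<noteq> (\<lambda>_. 0)" "mvec n n (\<lambda>i j. to_ac (A j i)) v = (\<lambda>i. \<mu> * v i)"
    and \<mu>: "ac_av \<mu> = r"
  shows "\<exists>\<delta>>0. \<forall>\<eta>>0. \<exists>z0\<in>coord_space n. dq z0 a < \<eta> \<and> 0 < ev_size v z0 \<and>
    (\<forall>z. z 0 = z0 \<longrightarrow> (\<forall>k. z k \<in> coord_space n \<and> dq (z k) a < \<delta> \<and> z (Suc k) = g (z k)) \<longrightarrow>
      (\<forall>k. ev_size v (z k) = r ^ k * ev_size v z0))"
proof -
  obtain E where E: "0 \<le> E" "\<And>x. ac_av (pairing n v x) \<le> E * q x" by (rule ev_size_bound) blast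
  obtain \<kappa> where \<kappa>: "0 < \<kappa>"
    "\<And>\<eta>. 0 < \<eta> \<Longrightarrow> \<exists>z\<in>coord_space n. dq z a < \<eta> \<and> 0 < ev_size v z \<and> \<kappa> * dq z a \<le> ev_size v z"
    using cone_points[OF v(1,2)] by blast
  \<comment> \<open>On the cone, \<delta>1 makes the error seen by v smaller than the main term;
    \<delta>2 below lets \<open>dq_g_fixed_le\<close> apply, which keeps the image in the
    cone.\<close>
  obtain \<delta>1 where \<delta>1: "0 < \<delta>1" "\<And>d. 0 \<le> d \<Longrightarrow> d < \<delta>1 \<Longrightarrow> E * K * d < r * \<kappa>"
    using small_radius[of "E * K" "r * \<kappa>"] E K_nonneg r_pos \<kappa> by auto
  obtain \<delta>2 where \<delta>2: "0 < \<delta>2" "\<And>d. 0 \<le> d \<Longrightarrow> d < \<delta>2 \<Longrightarrow> K * d < r"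
    using small_radius[OF K_nonneg r_pos] by auto
  define \<delta> where "\<delta> = min \<rho> (min \<delta>1 \<delta>2)"
  have \<delta>: "0 < \<delta>" using \<rho>_pos \<delta>1 \<delta>2 by (simp add: \<delta>_def)
  have step: "ev_size v (g x) = r * ev_size v x \<and> \<kappa> * dq (g x) a \<le> ev_size v (g x)"
    if x: "x \<in> coord_space n" "dq x a < \<delta>" "0 < ev_size v x" "\<kappa> * dq x a \<le> ev_size v x" for x
  proof -
    have d: "dq x a < \<rho>" "dq x a < \<delta>1" "dq x a < \<delta>2" using x(2) by (auto simp: \<delta>_def)
    have dpos: "0 < dq x a"
    proof -
      have "0 < E * dq x a"
        using x(3) E(2)[of "\<lambda>i. x i - a i"] unfolding ev_size_def dq_def by linarith
      then show ?thesis using dq_nonneg[of x a] by (metis less_eq_real_def mult_zero_right)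
    qed
    let ?e = "\<lambda>j. g x j - g a j - mvec n n A (\<lambda>i. x i - a i) j"
    have "ac_av (pairing n v ?e) \<le> E * q ?e" by (rule E)
    also have "\<dots> \<le> E * (K * dq x a * dq x a)"
      using g_est_dq[OF x(1) a_mem d(1)] \<rho>_pos E by (intro mult_left_mono) auto
    also have "\<dots> = (E * K * dq x a) * dq x a" by simp
    also have "\<dots> < (r * \<kappa>) * dq x a" using \<delta>1(2)[OF dq_nonneg d(2)] dpos by (rule mult_strict_right_mono)
    also have "\<dots> \<le> r * ev_size v x" using x(4) r_pos by simp
    also have "\<dots> = ac_av (\<mu> * pairing n v (\<lambda>i. x i - a i))" by (simp add: ac_av_mult \<mu> ev_size_def)
    finally have "ev_size v (g x) = ac_av (\<mu> * pairing n v (\<lambda>i. x i - a i))"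
      unfolding ev_size_def pairing_g[OF v(3)] by (rule ac_av_add_eq)
    then have eq: "ev_size v (g x) = r * ev_size v x" by (simp add: ac_av_mult \<mu> ev_size_def)
    have "dq (g x) a \<le> r * dq x a"
      using \<delta>2(2)[OF dq_nonneg d(3)] by (intro dq_g_fixed_le x d) simp
    then have "\<kappa> * dq (g x) a \<le> \<kappa> * (r * dq x a)" using \<kappa> by (intro mult_left_mono) auto
    also have "\<dots> = r * (\<kappa> * dq x a)" by simp
    also have "\<dots> \<le> r * ev_size v x" using x(4) r_pos by (intro mult_left_mono) auto
    finally show ?thesis using eq by simp
  qed
  show ?thesis
  proof (intro exI[of _ \<delta>] conjI allI impI)
    show "0 < \<delta>" by fact
    fix \<eta> :: real assume "0 < \<eta>"
    then obtain z0 where z0: "z0 \<in> coord_space n" "dq z0 a < \<eta>" "0 < ev_size v z0"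
      "\<kappa> * dq z0 a \<le> ev_size v z0" using \<kappa>(2) by blast
    have "ev_size v (z k) = r ^ k * ev_size v z0"
      if z: "z 0 = z0" "\<forall>k. z k \<in> coord_space n \<and> dq (z k) a < \<delta> \<and> z (Suc k) = g (z k)" for z k
    proof -
      have "ev_size v (z k) = r ^ k * ev_size v z0 \<and> \<kappa> * dq (z k) a \<le> ev_size v (z k)"
      proof (induction k)
        case (Suc k)
        then have "0 < ev_size v (z k)" using z0(3) r_pos by simp
        from step[OF _ _ this] z(2) Suc show ?case by auto
      qed (use z z0 in simp)
      then show ?thesis ..
    qed
    with z0 show "\<exists>z0\<in>coord_space n. dq z0 a < \<eta> \<and> 0 < ev_size v z0 \<and>
      (\<forall>z. z 0 = z0 \<longrightarrow> (\<forall>k. z k \<in> coord_space n \<and> dq (z k) a < \<delta> \<and> z (Suc k) = g (z k)) \<longrightarrow>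
        (\<forall>k. ev_size v (z k) = r ^ k * ev_size v z0))" by blast
  qed
qed

text \<open>The cone condition is now given at the image and pulled back. Since A shrinks no
  direction by more than s, passing to a preimage multiplies q by at most 1/s, while |v| is
  multiplied by exactly 1/s.\<close>

lemma backward_cone:
  assumes v: "v \<in> coord_space n" "v \<noteq> (\<lambda>_. 0)" "mvec n n (\<lambda>i j. to_ac (A j i)) v = (\<lambda>i. \<mu> * v i)"
    and \<mu>: "ac_av \<mu> = s"
  shows "\<exists>\<delta>>0. \<forall>\<eta>>0. \<exists>z0\<in>coord_space n. dq z0 a < \<eta> \<and> 0 < ev_size v z0 \<and>
    (\<forall>z. z 0 = z0 \<longrightarrow> (\<forall>k. z k \<in> coord_space n \<and> dq (z k) a < \<delta> \<and> g (z (Suc k)) = z k) \<longrightarrow>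
      (\<forall>k. s ^ k * ev_size v (z k) = ev_size v z0))"
proof -
  obtain E where E: "0 \<le> E" "\<And>x. ac_av (pairing n v x) \<le> E * q x" by (rule ev_size_bound) blast
  obtain \<kappa> where \<kappa>: "0 < \<kappa>"
    "\<And>\<eta>. 0 < \<eta> \<Longrightarrow> \<exists>z\<in>coord_space n. dq z a < \<eta> \<and> 0 < ev_size v z \<and> \<kappa> * dq z a \<le> ev_size v z"
    using cone_points[OF v(1,2)] by blast
  obtain \<delta>1 where \<delta>1: "0 < \<delta>1" "\<And>d. 0 \<le> d \<Longrightarrow> d < \<delta>1 \<Longrightarrow> E * K * d < s * \<kappa>"
    using small_radius[of "E * K" "s * \<kappa>"] E K_nonneg s_pos \<kappa> by auto
  obtain \<delta>2 where \<delta>2: "0 < \<delta>2" "\<And>d. 0 \<le> d \<Longrightarrow> d < \<delta>2 \<Longrightarrow> K * d < s"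
    using small_radius[OF K_nonneg s_pos] by auto
  define \<delta> where "\<delta> = min \<rho> (min \<delta>1 \<delta>2)"
  have \<delta>: "0 < \<delta>" using \<rho>_pos \<delta>1 \<delta>2 by (simp add: \<delta>_def)
  have step: "s * ev_size v x = ev_size v (g x) \<and> \<kappa> * dq x a \<le> ev_size v x"
    if x: "x \<in> coord_space n" "dq x a < \<delta>" "0 < ev_size v (g x)" "\<kappa> * dq (g x) a \<le> ev_size v (g x)" for x
  proof -
    have d: "dq x a < \<rho>" "dq x a < \<delta>1" "dq x a < \<delta>2" using x(2) by (auto simp: \<delta>_def)
    have low: "s * dq x a \<le> dq (g x) a"
      using \<delta>2(2)[OF dq_nonneg d(3)] by (intro dq_g_fixed_ge x d)
    let ?e = "\<lambda>j. g x j - g a j - mvec n n A (\<lambda>i. x i - a i) j"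
    have "ac_av (pairing n v ?e) \<le> E * q ?e" by (rule E)
    also have "\<dots> \<le> E * (K * dq x a * dq x a)"
      using g_est_dq[OF x(1) a_mem d(1)] \<rho>_pos E by (intro mult_left_mono) auto
    also have "\<dots> = (E * K * dq x a) * dq x a" by simp
    finally have e: "ac_av (pairing n v ?e) \<le> (E * K * dq x a) * dq x a" .
    have lt: "ac_av (pairing n v ?e) < ev_size v (g x)"
    proof (cases "dq x a = 0")
      case True
      then show ?thesis using e x(3) by simp
    next
      case False
      then have dpos: "0 < dq x a" using dq_nonneg[of x a] by linarith
      have "(E * K * dq x a) * dq x a < (s * \<kappa>) * dq x a"
        using \<delta>1(2)[OF dq_nonneg d(2)] dpos by (rule mult_strict_right_mono)
      also have "\<dots> = \<kappa> * (s * dq x a)" by simp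
      also have "\<dots> \<le> \<kappa> * dq (g x) a" using low \<kappa> by (intro mult_left_mono) auto
      finally show ?thesis using e x(4) by linarith
    qed
    \<comment> \<open>Here the size at the image is known, so the error is subtracted from the image
      to isolate the term with \<mu>.\<close>
    have "ac_av (pairing n v (\<lambda>i. g x i - a i) + - pairing n v ?e) = ac_av (pairing n v (\<lambda>i. g x i - a i))"
      using lt unfolding ev_size_def by (intro ac_av_add_eq) simp
    then have eq: "s * ev_size v x = ev_size v (g x)"
      unfolding pairing_g[OF v(3)] by (simp add: ev_size_def ac_av_mult \<mu> pairing_g[OF v(3)])
    have "s * (\<kappa> * dq x a) \<le> \<kappa> * dq (g x) a"
      using mult_left_mono[OF low, of \<kappa>] \<kappa> by (simp add: mult_ac)
    with x(4) eq have "s * (\<kappa> * dq x a) \<le> s * ev_size v x" by linarith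
    then have "\<kappa> * dq x a \<le> ev_size v x" using s_pos by (rule mult_left_le_imp_le)
    with eq show ?thesis by blast
  qed
  show ?thesis
  proof (intro exI[of _ \<delta>] conjI allI impI)
    show "0 < \<delta>" by fact
    fix \<eta> :: real assume "0 < \<eta>"
    then obtain z0 where z0: "z0 \<in> coord_space n" "dq z0 a < \<eta>" "0 < ev_size v z0"
      "\<kappa> * dq z0 a \<le> ev_size v z0" using \<kappa>(2) by blast
    have "s ^ k * ev_size v (z k) = ev_size v z0"
      if z: "z 0 = z0" "\<forall>k. z k \<in> coord_space n \<and> dq (z k) a < \<delta> \<and> g (z (Suc k)) = z k" for z k
    proof -
      have "s ^ k * ev_size v (z k) = ev_size v z0 \<and> \<kappa> * dq (z k) a \<le> ev_size v (z k)"
      proof (induction k)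
        case (Suc k)
        have "0 < s ^ k * ev_size v (z k)" using Suc z0(3) by simp
        then have p: "0 < ev_size v (z k)" using s_pos by (simp add: zero_less_mult_iff)
        have gz: "g (z (Suc k)) = z k" using z(2) by blast
        have st: "s * ev_size v (z (Suc k)) = ev_size v (z k) \<and> \<kappa> * dq (z (Suc k)) a \<le> ev_size v (z (Suc k))"
          using step[of "z (Suc k)"] z(2) p Suc unfolding gz by blast
        then have "s ^ k * (s * ev_size v (z (Suc k))) = ev_size v z0" using Suc by simp
        then have "s ^ Suc k * ev_size v (z (Suc k)) = ev_size v z0" by (simp add: mult_ac)
        with st show ?case by blast
      qed (use z z0 in simp)
      then show ?thesis ..
    qed
    with z0 show "\<exists>z0\<in>coord_space n. dq z0 a < \<eta> \<and> 0 < ev_size v z0 \<and>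
      (\<forall>z. z 0 = z0 \<longrightarrow> (\<forall>k. z k \<in> coord_space n \<and> dq (z k) a < \<delta> \<and> g (z (Suc k)) = z k) \<longrightarrow>
        (\<forall>k. s ^ k * ev_size v (z k) = ev_size v z0))" by blast
  qed
qed

end

lemma ex_adapted_fixed_point:
  fixes A :: "nat \<Rightarrow> nat \<Rightarrow> 'k::complete_ultrametric_field"
  assumes s: "0 < s" "0 < r"
    and ev: "\<And>\<mu>. eigenvalue_of n (\<lambda>i j. to_ac (A i j)) \<mu> \<Longrightarrow> s \<le> ac_av \<mu> \<and> ac_av \<mu> \<le> r"
    and g: "strictly_diff n n g a A" "a \<in> coord_space n" "g a = a"
  shows "\<exists>q C \<rho> K. adapted_fixed_point n A s r q C g a \<rho> K"
proof -
  obtain q C where q: "adapted_seminorm n A s r q" "0 \<le> C" "\<And>x. vnorm n x \<le> C * q x"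
    using ex_adapted_norm[OF s(1) ev] by blast
  obtain D where D: "0 \<le> D" "\<And>x. q x \<le> D * vnorm n x" and q_nonneg: "\<And>x. 0 \<le> q x"
    using q(1) unfolding adapted_seminorm_def by blast
  obtain R L where h: "0 < R" "0 \<le> L"
    "\<And>x. x \<in> coord_space n \<Longrightarrow> vdist n x a < R \<Longrightarrow> g x \<in> coord_space n"
    "\<And>x y. x \<in> coord_space n \<Longrightarrow> y \<in> coord_space n \<Longrightarrow> vdist n x a < R \<Longrightarrow> vdist n y a < R \<Longrightarrow>
        vnorm n (\<lambda>j. g x j - g y j - mvec n n A (\<lambda>i. x i - y i) j)
          \<le> L * max (vdist n x a) (vdist n y a) * vdist n x y"
    using g(1) by (rule strictly_diffE) blast
  define \<rho> where "\<rho> = R / (C + 1)"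
  have \<rho>: "0 < \<rho>" using h q by (simp add: \<rho>_def)
  have close: "vdist n x a < R" if x: "q (\<lambda>i. x i - a i) < \<rho>" for x
  proof -
    have "vdist n x a \<le> C * q (\<lambda>i. x i - a i)" unfolding vdist_def by (rule q)
    also have "\<dots> \<le> (C + 1) * q (\<lambda>i. x i - a i)" using q_nonneg by (intro mult_right_mono) auto
    also have "\<dots> < R" using x q(2) by (simp add: \<rho>_def field_simps)
    finally show ?thesis .
  qed
  \<comment> \<open>D returns from \<open>vnorm\<close> to q, L is the constant of the strict
    estimate, and each of the two distances in it contributes a factor C.\<close>
  have "adapted_fixed_point n A s r q C g a \<rho> (D * L * C * C)"
  proof
    fix x y assume xy: "x \<in> coord_space n" "y \<in> coord_space n" "q (\<lambda>i. x i - a i) < \<rho>" "q (\<lambda>i. y i - a i) < \<rho>"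
    let ?e = "\<lambda>j. g x j - g y j - mvec n n A (\<lambda>i. x i - y i) j"
    let ?m = "max (q (\<lambda>i. x i - a i)) (q (\<lambda>i. y i - a i))"
    have v: "vdist n x a \<le> C * ?m" "vdist n y a \<le> C * ?m"
      using q(3)[of "\<lambda>i. x i - a i"] q(3)[of "\<lambda>i. y i - a i"]
        mult_left_mono[of "q (\<lambda>i. x i - a i)" ?m C] mult_left_mono[of "q (\<lambda>i. y i - a i)" ?m C] q(2)
      unfolding vdist_def by auto
    have "vnorm n ?e \<le> L * max (vdist n x a) (vdist n y a) * vdist n x y"
      using xy close by (intro h(4)) auto
    also have "\<dots> \<le> L * (C * ?m) * (C * q (\<lambda>i. x i - y i))"
      using v h(2) q q_nonneg by (intro mult_mono[OF mult_left_mono]) (auto simp: vdist_def le_max_iff_disj)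
    finally have "D * vnorm n ?e \<le> D * (L * (C * ?m) * (C * q (\<lambda>i. x i - y i)))"
      using D(1) by (rule mult_left_mono)
    with D(2)[of ?e] show "q ?e \<le> D * L * C * C * ?m * q (\<lambda>i. x i - y i)" by (simp add: mult_ac)
  qed (use q D h g s \<rho> close in auto)
  then show ?thesis by blast
qed

section \<open>Eigenvalues of the scalar extension\<close>

lemma lookup_scale_map:
  "Poly_Mapping.lookup (Poly_Mapping.map (\<lambda>l. \<mu> * l) x) v = \<mu> * Poly_Mapping.lookup x v"
  for \<mu> :: "'a::mult_zero"
  by transfer (auto simp: when_def)

lemma keys_scale_map: "Poly_Mapping.keys (Poly_Mapping.map (\<lambda>l. \<mu> * l) x) \<subseteq> Poly_Mapping.keys x"
  for \<mu> :: "'a::mult_zero"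
  by (auto simp: Poly_Mapping.in_keys_iff lookup_scale_map)

lemma poly_mapping_sum_single:
  "x = (\<Sum>v\<in>Poly_Mapping.keys x. Poly_Mapping.single v (Poly_Mapping.lookup x v))"
proof (rule poly_mapping_eqI)
  fix k
  have "(\<Sum>v\<in>Poly_Mapping.keys x. Poly_Mapping.lookup (Poly_Mapping.single v (Poly_Mapping.lookup x v)) k)
      = (\<Sum>v\<in>Poly_Mapping.keys x. if v = k then Poly_Mapping.lookup x v else 0)"
    by (intro sum.cong) (auto simp: lookup_single when_def)
  also have "\<dots> = Poly_Mapping.lookup x k" by (simp add: Poly_Mapping.in_keys_iff)
  finally show "Poly_Mapping.lookup x k
      = Poly_Mapping.lookup (\<Sum>v\<in>Poly_Mapping.keys x. Poly_Mapping.single v (Poly_Mapping.lookup x v)) k"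
    by (simp add: lookup_sum)
qed

lemma single_sum: "Poly_Mapping.single k (\<Sum>i\<in>I. f i) = (\<Sum>i\<in>I. Poly_Mapping.single k (f i))"
  by (induction I rule: infinite_finite_induct) (simp_all add: single_add)

text \<open>A basis e with its coordinate functions, on a carrier set, since tangent spaces are
  subsets of a function type.\<close>

locale coordinate_space =
  fixes s :: "'k::complete_ultrametric_field \<Rightarrow> 'v::ab_group_add \<Rightarrow> 'v" and V :: "'v set"
    and n :: nat and co :: "'v \<Rightarrow> nat \<Rightarrow> 'k" and e :: "nat \<Rightarrow> 'v"
  assumes e_mem: "i < n \<Longrightarrow> e i \<in> V"
    and add_mem: "u \<in> V \<Longrightarrow> v \<in> V \<Longrightarrow> u + v \<in> V"
    and scale_mem: "v \<in> V \<Longrightarrow> s a v \<in> V"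
    and zero_mem: "0 \<in> V"
    and co_add: "u \<in> V \<Longrightarrow> v \<in> V \<Longrightarrow> co (u + v) i = co u i + co v i"
    and co_scale: "v \<in> V \<Longrightarrow> co (s a v) i = a * co v i"
    and co_mem: "v \<in> V \<Longrightarrow> co v \<in> coord_space n"
    and co_e: "i < n \<Longrightarrow> co (e i) = unit_vec i"
    and expand: "v \<in> V \<Longrightarrow> v = (\<Sum>i<n. s (co v i) (e i))"
begin

text \<open>The map from V \<otimes> L to L^n induced by the coordinates, on
  representatives.\<close>

definition tensor_coord :: "('v \<Rightarrow>\<^sub>0 'k alg_closure) \<Rightarrow> nat \<Rightarrow> 'k alg_closure" where
  "tensor_coord x i = (\<Sum>v\<in>Poly_Mapping.keys x. to_ac (co v i) * Poly_Mapping.lookup x v)"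

lemma tensor_coord_superset:
  assumes "finite F" "Poly_Mapping.keys x \<subseteq> F"
  shows "tensor_coord x i = (\<Sum>v\<in>F. to_ac (co v i) * Poly_Mapping.lookup x v)"
  unfolding tensor_coord_def using assms
  by (intro sum.mono_neutral_left) (auto simp: Poly_Mapping.in_keys_iff)

lemma tensor_coord_add: "tensor_coord (x + y) i = tensor_coord x i + tensor_coord y i"
proof -
  let ?F = "Poly_Mapping.keys x \<union> Poly_Mapping.keys y"
  have "tensor_coord (x + y) i = (\<Sum>v\<in>?F. to_ac (co v i) * Poly_Mapping.lookup (x + y) v)"
    by (intro tensor_coord_superset keys_add) auto
  also have "\<dots> = (\<Sum>v\<in>?F. to_ac (co v i) * Poly_Mapping.lookup x v)
      + (\<Sum>v\<in>?F. to_ac (co v i) * Poly_Mapping.lookup y v)"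
    by (simp add: lookup_add distrib_left sum.distrib)
  finally show ?thesis
    using tensor_coord_superset[of ?F x i] tensor_coord_superset[of ?F y i] by simp
qed

lemma tensor_coord_diff: "tensor_coord (x - y) i = tensor_coord x i - tensor_coord y i"
  using tensor_coord_add[of "x - y" y i] by simp

lemma tensor_coord_zero [simp]: "tensor_coord 0 i = 0"
  by (simp add: tensor_coord_def)

lemma tensor_coord_single: "tensor_coord (Poly_Mapping.single v l) i = to_ac (co v i) * l"
  using tensor_coord_superset[of "{v}" "Poly_Mapping.single v l" i] by (cases "l = 0") auto

lemma tensor_coord_sum: "tensor_coord (\<Sum>j\<in>I. f j) i = (\<Sum>j\<in>I. tensor_coord (f j) i)"
  by (induction I rule: infinite_finite_induct) (simp_all add: tensor_coord_add)

lemma tensor_coord_null: "x \<in> tensor_null s V \<Longrightarrow> tensor_coord x i = 0"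
proof (induction rule: tensor_null.induct)
  case (additive u v l)
  then show ?case by (simp add: tensor_coord_diff tensor_coord_single co_add distrib_right)
next
  case (balanced v a l)
  then show ?case by (simp add: tensor_coord_diff tensor_coord_single co_scale mult_ac)
qed (simp_all add: tensor_coord_diff)

lemma tensor_null_minus: "x \<in> tensor_null s V \<Longrightarrow> - x \<in> tensor_null s V"
  using tensor_null.diff[OF tensor_null.zero] by fastforce

lemma tensor_null_add:
  assumes "x \<in> tensor_null s V" "y \<in> tensor_null s V" shows "x + y \<in> tensor_null s V"
  using tensor_null.diff[OF assms(1) tensor_null_minus[OF assms(2)]] by simp

lemma tensor_null_sum: "(\<And>j. j \<in> I \<Longrightarrow> f j \<in> tensor_null s V) \<Longrightarrow> (\<Sum>j\<in>I. f j) \<in> tensor_null s V"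
  by (induction I rule: infinite_finite_induct) (auto intro: tensor_null_add tensor_null.zero)

lemma sum_mem: "(\<And>j. j \<in> I \<Longrightarrow> f j \<in> V) \<Longrightarrow> (\<Sum>j\<in>I. f j) \<in> V"
  by (induction I rule: infinite_finite_induct) (auto intro: add_mem zero_mem)

lemma tensor_null_single_sum:
  fixes u :: "nat \<Rightarrow> 'v"
  assumes "\<And>j. j < m \<Longrightarrow> u j \<in> V"
  shows "Poly_Mapping.single (\<Sum>j<m. u j) l - (\<Sum>j<m. Poly_Mapping.single (u j) l) \<in> tensor_null s V"
  using assms
proof (induction m)
  case 0
  \<comment> \<open>The relation for 0 + 0 reduces to minus the generator 0 \<otimes> l.\<close>
  have "Poly_Mapping.single (0 + 0) l - Poly_Mapping.single 0 l - Poly_Mapping.single 0 l \<in> tensor_null s V"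
    by (intro tensor_null.additive zero_mem)
  from tensor_null_minus[OF this] show ?case by simp
next
  case (Suc m)
  have "Poly_Mapping.single ((\<Sum>j<m. u j) + u m) l - Poly_Mapping.single (\<Sum>j<m. u j) l
      - Poly_Mapping.single (u m) l \<in> tensor_null s V"
    using Suc.prems by (intro tensor_null.additive sum_mem) auto
  from tensor_null_add[OF this Suc.IH] Suc.prems show ?case by (simp add: algebra_simps)
qed

lemma tensor_null_single_expand:
  assumes v: "v \<in> V"
  shows "Poly_Mapping.single v l - (\<Sum>i<n. Poly_Mapping.single (e i) (to_ac (co v i) * l)) \<in> tensor_null s V"
proof -
  let ?S = "\<Sum>i<n. s (co v i) (e i)"
  have "Poly_Mapping.single ?S l - (\<Sum>i<n. Poly_Mapping.single (s (co v i) (e i)) l) \<in> tensor_null s V"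
    by (intro tensor_null_single_sum scale_mem e_mem)
  moreover have "(\<Sum>i<n. Poly_Mapping.single (s (co v i) (e i)) l
      - Poly_Mapping.single (e i) (to_ac (co v i) * l)) \<in> tensor_null s V"
    by (intro tensor_null_sum tensor_null.balanced e_mem) simp
  ultimately have "Poly_Mapping.single ?S l - (\<Sum>i<n. Poly_Mapping.single (s (co v i) (e i)) l)
     + (\<Sum>i<n. Poly_Mapping.single (s (co v i) (e i)) l
      - Poly_Mapping.single (e i) (to_ac (co v i) * l)) \<in> tensor_null s V"
    by (rule tensor_null_add)
  moreover have "Poly_Mapping.single ?S l - (\<Sum>i<n. Poly_Mapping.single (s (co v i) (e i)) l)
     + (\<Sum>i<n. Poly_Mapping.single (s (co v i) (e i)) l
      - Poly_Mapping.single (e i) (to_ac (co v i) * l))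
     = Poly_Mapping.single ?S l - (\<Sum>i<n. Poly_Mapping.single (e i) (to_ac (co v i) * l))"
    by (simp only: sum_subtractf) simp
  ultimately show ?thesis unfolding expand[OF v, symmetric] by simp
qed

text \<open>Modulo the relations every pure tensor is rewritten over the basis e; collecting the
  terms of each basis vector gives a normal form.\<close>

lemma tensor_null_expand:
  assumes "Poly_Mapping.keys x \<subseteq> V"
  shows "x - (\<Sum>i<n. Poly_Mapping.single (e i) (tensor_coord x i)) \<in> tensor_null s V"
proof -
  let ?K = "Poly_Mapping.keys x" and ?l = "Poly_Mapping.lookup x"
  have "(\<Sum>v\<in>?K. Poly_Mapping.single v (?l v)
      - (\<Sum>i<n. Poly_Mapping.single (e i) (to_ac (co v i) * ?l v))) \<in> tensor_null s V"
    using assms by (intro tensor_null_sum tensor_null_single_expand) auto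
  moreover have "(\<Sum>v\<in>?K. \<Sum>i<n. Poly_Mapping.single (e i) (to_ac (co v i) * ?l v))
      = (\<Sum>i<n. Poly_Mapping.single (e i) (tensor_coord x i))"
    unfolding tensor_coord_def single_sum by (rule sum.swap)
  ultimately show ?thesis
    unfolding sum_subtractf poly_mapping_sum_single[of x, symmetric] by simp
qed

text \<open>The relations have vanishing coordinates, and conversely the normal form is determined
  by the coordinates. This identifies V \<otimes> L with L^n.\<close>

lemma tensor_null_iff:
  assumes "Poly_Mapping.keys x \<subseteq> V"
  shows "x \<in> tensor_null s V \<longleftrightarrow> (\<forall>i<n. tensor_coord x i = 0)"
proof
  assume z: "\<forall>i<n. tensor_coord x i = 0"
  have "(\<Sum>i<n. Poly_Mapping.single (e i) (tensor_coord x i)) = 0" using z by simp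
  with tensor_null_expand[OF assms] show "x \<in> tensor_null s V" by simp
qed (simp add: tensor_coord_null)

lemma tensor_coord_mem:
  assumes "Poly_Mapping.keys x \<subseteq> V" shows "tensor_coord x \<in> coord_space n"
  unfolding coord_space_def
proof (intro CollectI allI impI)
  fix i assume "n \<le> i"
  then have "co v i = 0" if "v \<in> Poly_Mapping.keys x" for v
    using co_mem[of v] assms that by (auto simp: coord_space_def)
  then show "tensor_coord x i = 0" by (simp add: tensor_coord_def)
qed

lemma tensor_coord_scale:
  "tensor_coord (Poly_Mapping.map (\<lambda>l. \<mu> * l) x) i = \<mu> * tensor_coord x i"
  unfolding tensor_coord_superset[OF finite_keys keys_scale_map] lookup_scale_map
  by (simp add: tensor_coord_def sum_distrib_left mult.left_commute)

text \<open>Under the identification with L^n, \<open>\<alpha> \<otimes> id\<close> is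
  multiplication by A with its entries read in the closure.\<close>

lemma ac_eigenvalue_iff_eigenvalue_of:
  assumes \<alpha>: "\<And>v. v \<in> V \<Longrightarrow> \<alpha> v \<in> V" "\<And>v. v \<in> V \<Longrightarrow> co (\<alpha> v) = mvec n n A (co v)"
  shows "ac_eigenvalue s V \<alpha> \<mu> \<longleftrightarrow> eigenvalue_of n (\<lambda>i j. to_ac (A i j)) \<mu>"
proof -
  let ?M = "\<lambda>i j. to_ac (A i j)"
  have map: "tensor_coord (tensor_map \<alpha> x) = mvec n n ?M (tensor_coord x)"
    if x: "Poly_Mapping.keys x \<subseteq> V" for x
  proof
    fix i
    let ?K = "Poly_Mapping.keys x" and ?l = "Poly_Mapping.lookup x"
    have "tensor_coord (tensor_map \<alpha> x) i = (\<Sum>v\<in>?K. to_ac (mvec n n A (co v) i) * ?l v)"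
      unfolding tensor_map_def tensor_coord_sum tensor_coord_single
      using x \<alpha>(2) by (intro sum.cong) auto
    also have "\<dots> = mvec n n ?M (tensor_coord x) i"
    proof (cases "i < n")
      case True
      have "(\<Sum>v\<in>?K. to_ac (mvec n n A (co v) i) * ?l v)
          = (\<Sum>v\<in>?K. \<Sum>j<n. to_ac (A i j) * (to_ac (co v j) * ?l v))"
        using True by (simp only: mvec_def if_True to_ac_sum to_ac_mult sum_distrib_right mult.assoc)
      also have "\<dots> = (\<Sum>j<n. \<Sum>v\<in>?K. to_ac (A i j) * (to_ac (co v j) * ?l v))" by (rule sum.swap)
      finally show ?thesis
        using True by (simp only: mvec_def if_True tensor_coord_def sum_distrib_left)
    qed (simp add: mvec_def)
    finally show "tensor_coord (tensor_map \<alpha> x) i = mvec n n ?M (tensor_coord x) i" .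
  qed
  have keys_map: "Poly_Mapping.keys (tensor_map \<alpha> x - Poly_Mapping.map (\<lambda>l. \<mu> * l) x) \<subseteq> V"
    if x: "Poly_Mapping.keys x \<subseteq> V" for x
  proof -
    have "Poly_Mapping.keys (tensor_map \<alpha> x)
        \<subseteq> (\<Union>v\<in>Poly_Mapping.keys x. Poly_Mapping.keys (Poly_Mapping.single (\<alpha> v) (Poly_Mapping.lookup x v)))"
      unfolding tensor_map_def by (rule keys_sum)
    also have "\<dots> \<subseteq> V" using x \<alpha>(1) by (auto split: if_splits)
    finally show ?thesis
      using keys_diff[of "tensor_map \<alpha> x" "Poly_Mapping.map (\<lambda>l. \<mu> * l) x"] keys_scale_map[of \<mu> x] x
      by blast
  qed
  have eig: "tensor_map \<alpha> x - Poly_Mapping.map (\<lambda>l. \<mu> * l) x \<in> tensor_null s V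
      \<longleftrightarrow> mvec n n ?M (tensor_coord x) = (\<lambda>i. \<mu> * tensor_coord x i)"
    if x: "Poly_Mapping.keys x \<subseteq> V" for x
  proof -
    have "tensor_map \<alpha> x - Poly_Mapping.map (\<lambda>l. \<mu> * l) x \<in> tensor_null s V
      \<longleftrightarrow> (\<forall>i<n. mvec n n ?M (tensor_coord x) i = \<mu> * tensor_coord x i)"
      unfolding tensor_null_iff[OF keys_map[OF x]] tensor_coord_diff tensor_coord_scale map[OF x] by simp
    also have "\<dots> \<longleftrightarrow> mvec n n ?M (tensor_coord x) = (\<lambda>i. \<mu> * tensor_coord x i)"
      using coord_space_eqI[of "mvec n n ?M (tensor_coord x)" n "\<lambda>i. \<mu> * tensor_coord x i"]
        coord_space_scale[OF tensor_coord_mem[OF x], of \<mu>] by (auto simp: fun_eq_iff)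
    finally show ?thesis .
  qed
  have nz: "x \<notin> tensor_null s V \<longleftrightarrow> tensor_coord x \<noteq> (\<lambda>_. 0)" if x: "Poly_Mapping.keys x \<subseteq> V" for x
    unfolding tensor_null_iff[OF x]
    using coord_space_eqI[OF tensor_coord_mem[OF x] zero_in_coord_space] by (auto simp: fun_eq_iff)
  show ?thesis
  proof
    assume "ac_eigenvalue s V \<alpha> \<mu>"
    then obtain x where x: "Poly_Mapping.keys x \<subseteq> V" "x \<notin> tensor_null s V"
      "tensor_map \<alpha> x - Poly_Mapping.map (\<lambda>l. \<mu> * l) x \<in> tensor_null s V"
      unfolding ac_eigenvalue_def by blast
    then show "eigenvalue_of n ?M \<mu>"
      unfolding eigenvalue_of_def using eig[OF x(1)] nz[OF x(1)] tensor_coord_mem[OF x(1)]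
      by (intro bexI[of _ "tensor_coord x"]) auto
  next
    assume "eigenvalue_of n ?M \<mu>"
    then obtain y where y: "y \<in> coord_space n" "y \<noteq> (\<lambda>_. 0)" "mvec n n ?M y = (\<lambda>i. \<mu> * y i)"
      unfolding eigenvalue_of_def by blast
    \<comment> \<open>The sum of the tensors e_i \<otimes> y_i, which has coordinate vector
      y.\<close>
    define x where "x = (\<Sum>i<n. Poly_Mapping.single (e i) (y i))"
    have "Poly_Mapping.keys x \<subseteq> (\<Union>i\<in>{..<n}. Poly_Mapping.keys (Poly_Mapping.single (e i) (y i)))"
      unfolding x_def by (rule keys_sum)
    also have "\<dots> \<subseteq> V" using e_mem by (auto split: if_splits)
    finally have x: "Poly_Mapping.keys x \<subseteq> V" .
    have "tensor_coord x j = y j" for j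
    proof -
      have "tensor_coord x j = (\<Sum>i<n. y i * unit_vec i j)"
        unfolding x_def tensor_coord_sum tensor_coord_single
        by (intro sum.cong) (auto simp: co_e unit_vec_def)
      then show ?thesis using y(1) by (auto simp: sum_unit_vec coord_space_def)
    qed
    then have "tensor_coord x = y" by (rule ext)
    with x y eig[OF x] nz[OF x] show "ac_eigenvalue s V \<alpha> \<mu>" unfolding ac_eigenvalue_def by blast
  qed
qed

end

section \<open>Charts and tangent spaces\<close>

text \<open>A box around a in the product topology constrains z only in the coordinates below n,
  since beyond them both z and a vanish; a minimum of finitely many radii remains.\<close>

lemma open_coordinate_ball:
  fixes W :: "(nat \<Rightarrow> 'k::complete_ultrametric_field) set"
  assumes W: "open W" and a: "a \<in> W" "a \<in> coord_space n"
  shows "\<exists>r>0. \<forall>z\<in>coord_space n. vdist n z a < r \<longrightarrow> z \<in> W"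
proof -
  have "openin (product_topology (\<lambda>_. euclidean) UNIV) W" using W unfolding open_fun_def .
  from product_topology_open_contains_basis[OF this a(1)] obtain V where
    V: "a \<in> (\<Pi>\<^sub>E i\<in>UNIV. V i)" "\<And>i. openin euclidean (V i)" "(\<Pi>\<^sub>E i\<in>UNIV. V i) \<subseteq> W" by blast
  have op: "open (V i)" and aV: "a i \<in> V i" for i using V(1) V(2)[of i] by (auto simp: PiE_iff)
  have "\<exists>r>0. \<forall>y. dist y (a i) < r \<longrightarrow> y \<in> V i" for i using op aV unfolding open_dist by blast
  then obtain r where r: "\<And>i. 0 < r i" "\<And>i y. dist y (a i) < r i \<Longrightarrow> y \<in> V i" by metis
  define R where "R = Min (insert 1 (r ` {..<n}))"
  have R: "0 < R" "\<And>i. i < n \<Longrightarrow> R \<le> r i" using r(1) by (auto simp: R_def)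
  have "z \<in> W" if z: "z \<in> coord_space n" "vdist n z a < R" for z
  proof -
    have "z i \<in> V i" for i
    proof (cases "i < n")
      case True
      then have "av (z i - a i) < r i" using z(2) av_le_vdist[OF True, of z a] R(2)[OF True] by linarith
      then show ?thesis using r(2) by (simp add: dist_av)
    next
      case False
      then have "z i = a i" using z(1) a(2) by (simp add: coord_space_def)
      then show ?thesis using aV by simp
    qed
    then show ?thesis using V(3) by (auto simp: PiE_iff)
  qed
  with R(1) show ?thesis by blast
qed

lemma open_vdist_ball:
  fixes a :: "nat \<Rightarrow> 'k::complete_ultrametric_field"
  assumes "0 < r" shows "open {z. vdist n z a < r}"
proof -
  have "{z. vdist n z a < r} = (\<Inter>i\<in>{..<n}. (\<lambda>z. z i) -` ball (a i) r)"
    using assms by (auto simp: vdist_less_iff dist_av av_minus_commute)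
  moreover have "open ((\<lambda>z. z i) -` ball (a i) r)" for i
    by (intro open_vimage open_ball continuous_on_product_coordinates)
  ultimately show ?thesis by auto
qed

lemma differential_chain:
  fixes g h k :: "(nat \<Rightarrow> 'k::complete_ultrametric_field) \<Rightarrow> nat \<Rightarrow> 'k"
  assumes g: "strictly_diff n m g a A" and h: "strictly_diff m l h (g a) B"
    and a: "a \<in> coord_space n" and u: "u \<in> coord_space n"
    and k: "0 < r" "\<And>x. x \<in> coord_space n \<Longrightarrow> vdist n x a < r \<Longrightarrow> k x = h (g x)"
  shows "differential k a u = differential h (g a) (differential g a u)"
proof -
  have ga: "g a \<in> coord_space m"
    by (rule strictly_diffE[OF g]) (use a in \<open>metis vdist_self\<close>)
  have "strictly_diff n l k a (mmult m B A)"
    by (rule strictly_diff_cong[OF strictly_diff_compose[OF g h a] k])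
  then have "differential k a u = mvec m l B (mvec n m A u)"
    by (simp add: differential_eq_mvec[OF _ a u] mvec_mmult)
  then show ?thesis
    unfolding differential_eq_mvec[OF g a u] by (simp add: differential_eq_mvec[OF h ga])
qed

locale analytic_fixed_point =
  fixes \<A> :: "('m::topological_space, 'k::complete_ultrametric_field) chart set"
    and M\<^sub>0 :: "'m set" and f :: "'m \<Rightarrow> 'm" and p :: 'm
  assumes atlas: "analytic_atlas \<A>" and open_M0: "open M\<^sub>0" and analytic: "analytic_map \<A> M\<^sub>0 f"
    and p_mem: "p \<in> M\<^sub>0" and f_p: "f p = p"
begin

definition transition :: "('m, 'k) chart \<Rightarrow> ('m, 'k) chart \<Rightarrow> (nat \<Rightarrow> 'k) \<Rightarrow> nat \<Rightarrow> 'k" where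
  "transition \<phi> \<psi> = chart_map \<psi> \<circ> chart_inv \<phi>"

definition local_rep :: "('m, 'k) chart \<Rightarrow> ('m, 'k) chart \<Rightarrow> (nat \<Rightarrow> 'k) \<Rightarrow> nat \<Rightarrow> 'k" where
  "local_rep \<phi> \<psi> = chart_map \<psi> \<circ> f \<circ> chart_inv \<phi>"

lemma charts_atD:
  assumes "\<phi> \<in> charts_at \<A> p"
  shows "\<phi> \<in> \<A>" "p \<in> chart_dom \<phi>" "is_chart \<phi>" "open (chart_dom \<phi>)"
  using assms atlas unfolding charts_at_def analytic_atlas_def is_chart_def by auto

lemma ex_chart_at: "\<exists>\<phi>. \<phi> \<in> charts_at \<A> p"
  using atlas unfolding analytic_atlas_def charts_at_def by blast

lemma chart_inv_map:
  assumes "\<phi> \<in> charts_at \<A> p" "x \<in> chart_dom \<phi>" shows "chart_inv \<phi> (chart_map \<phi> x) = x"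
  using charts_atD(3)[OF assms(1)] assms(2) unfolding is_chart_def homeomorphism_def by blast

lemma chart_map_mem:
  assumes "\<phi> \<in> charts_at \<A> p" "x \<in> chart_dom \<phi>"
  shows "chart_map \<phi> x \<in> coord_space (chart_dim \<phi>)"
  using charts_atD(3)[OF assms(1)] assms(2) openin_imp_subset unfolding is_chart_def by blast

text \<open>Chart images are relatively open and charts are open onto them, so small coordinate
  balls consist of images of points near p.\<close>

lemma chart_ball:
  assumes \<phi>: "\<phi> \<in> charts_at \<A> p" and S: "open S" "p \<in> S"
  shows "\<exists>r>0. \<forall>z\<in>coord_space (chart_dim \<phi>). vdist (chart_dim \<phi>) z (chart_map \<phi> p) < r
    \<longrightarrow> (\<exists>x\<in>S \<inter> chart_dom \<phi>. z = chart_map \<phi> x)"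
proof -
  let ?C = "coord_space (chart_dim \<phi>)" and ?D = "chart_dom \<phi>"
  have hom: "homeomorphism ?D (chart_map \<phi> ` ?D) (chart_map \<phi>) (chart_inv \<phi>)"
    and im: "openin (top_of_set ?C) (chart_map \<phi> ` ?D)"
    using charts_atD(3)[OF \<phi>] unfolding is_chart_def by auto
  have "openin (top_of_set ?D) (?D \<inter> S)" using S(1) by (rule openin_open_Int)
  from homeomorphism_imp_open_map[OF hom this]
  have "openin (top_of_set (chart_map \<phi> ` ?D)) (chart_map \<phi> ` (?D \<inter> S))" .
  then have "openin (top_of_set ?C) (chart_map \<phi> ` (?D \<inter> S))" using im by (rule openin_trans)
  then obtain W where W: "open W" "chart_map \<phi> ` (?D \<inter> S) = ?C \<inter> W" unfolding openin_open by blast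
  have "chart_map \<phi> p \<in> ?C \<inter> W" using W(2) S(2) charts_atD(2)[OF \<phi>] by blast
  then obtain r where r: "r > 0" "\<forall>z\<in>?C. vdist (chart_dim \<phi>) z (chart_map \<phi> p) < r \<longrightarrow> z \<in> W"
    using open_coordinate_ball[OF W(1)] by blast
  have "\<exists>x\<in>S \<inter> ?D. z = chart_map \<phi> x" if "z \<in> ?C" "vdist (chart_dim \<phi>) z (chart_map \<phi> p) < r" for z
  proof -
    have "z \<in> chart_map \<phi> ` (?D \<inter> S)" using r(2) that W(2) by blast
    then show ?thesis by blast
  qed
  with r(1) show ?thesis by blast
qed

lemma chart_nbhd:
  assumes \<phi>: "\<phi> \<in> charts_at \<A> p" and r: "0 < r"
  shows "\<exists>S. open S \<and> p \<in> S \<and> S \<subseteq> {x \<in> chart_dom \<phi>. vdist (chart_dim \<phi>) (chart_map \<phi> x) (chart_map \<phi> p) < r}"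
proof -
  let ?B = "{z. vdist (chart_dim \<phi>) z (chart_map \<phi> p) < r}"
  have "continuous_on (chart_dom \<phi>) (chart_map \<phi>)"
    using charts_atD(3)[OF \<phi>] unfolding is_chart_def homeomorphism_def by blast
  then have "open (chart_map \<phi> -` ?B \<inter> chart_dom \<phi>)"
    using open_vdist_ball[OF r] continuous_on_open_vimage[OF charts_atD(4)[OF \<phi>]] by blast
  moreover have "p \<in> chart_map \<phi> -` ?B \<inter> chart_dom \<phi>" using charts_atD(2)[OF \<phi>] r by simp
  ultimately show ?thesis by (intro exI[of _ "chart_map \<phi> -` ?B \<inter> chart_dom \<phi>"]) auto
qed

lemma open_preimage: "open S \<Longrightarrow> open {x \<in> M\<^sub>0. f x \<in> S}"
proof -
  assume "open S"
  moreover have "continuous_on M\<^sub>0 f" using analytic unfolding analytic_map_def by blast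
  ultimately have "open (f -` S \<inter> M\<^sub>0)" using continuous_on_open_vimage[OF open_M0] by blast
  moreover have "f -` S \<inter> M\<^sub>0 = {x \<in> M\<^sub>0. f x \<in> S}" by auto
  ultimately show ?thesis by simp
qed

section \<open>Derivatives of coordinate representations and tangent vectors\<close>

lemma strictly_diff_transition:
  assumes "\<phi> \<in> charts_at \<A> p" "\<psi> \<in> charts_at \<A> p"
  shows "\<exists>J. strictly_diff (chart_dim \<phi>) (chart_dim \<psi>) (transition \<phi> \<psi>) (chart_map \<phi> p) J"
proof (rule analytic_between_strictly_diff)
  show "analytic_between (chart_dim \<phi>) (chart_dim \<psi>)
      (chart_map \<phi> ` (chart_dom \<phi> \<inter> chart_dom \<psi>)) (transition \<phi> \<psi>)"
    using atlas charts_atD(1)[OF assms(1)] charts_atD(1)[OF assms(2)]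
    unfolding analytic_atlas_def transition_def by blast
  show "chart_map \<phi> p \<in> chart_map \<phi> ` (chart_dom \<phi> \<inter> chart_dom \<psi>)"
    using charts_atD(2)[OF assms(1)] charts_atD(2)[OF assms(2)] by blast
qed

lemma strictly_diff_local_rep:
  assumes "\<phi> \<in> charts_at \<A> p" "\<psi> \<in> charts_at \<A> p"
  shows "\<exists>J. strictly_diff (chart_dim \<phi>) (chart_dim \<psi>) (local_rep \<phi> \<psi>) (chart_map \<phi> p) J"
proof (rule analytic_between_strictly_diff)
  show "analytic_between (chart_dim \<phi>) (chart_dim \<psi>)
      (chart_map \<phi> ` {x \<in> M\<^sub>0 \<inter> chart_dom \<phi>. f x \<in> chart_dom \<psi>}) (local_rep \<phi> \<psi>)"
    using analytic charts_atD(1)[OF assms(1)] charts_atD(1)[OF assms(2)]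
    unfolding analytic_map_def local_rep_def by blast
  show "chart_map \<phi> p \<in> chart_map \<phi> ` {x \<in> M\<^sub>0 \<inter> chart_dom \<phi>. f x \<in> chart_dom \<psi>}"
    using charts_atD(2)[OF assms(1)] charts_atD(2)[OF assms(2)] p_mem f_p by auto
qed

lemma transition_p:
  assumes "\<phi> \<in> charts_at \<A> p" shows "transition \<phi> \<psi> (chart_map \<phi> p) = chart_map \<psi> p"
  using chart_inv_map[OF assms charts_atD(2)[OF assms]] by (simp add: transition_def)

lemma local_rep_p:
  assumes "\<phi> \<in> charts_at \<A> p" shows "local_rep \<phi> \<psi> (chart_map \<phi> p) = chart_map \<psi> p"
  using chart_inv_map[OF assms charts_atD(2)[OF assms]] by (simp add: local_rep_def f_p)

text \<open>The common shape of the three chain rules below: the factorisation holds in the chart on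
  a neighbourhood S of p, and derivatives see no more than that.\<close>

lemma chain_aux:
  assumes \<phi>: "\<phi> \<in> charts_at \<A> p" and a: "g (chart_map \<phi> p) = b"
    and g: "strictly_diff (chart_dim \<phi>) m g (chart_map \<phi> p) A" and h: "strictly_diff m l h b B"
    and u: "u \<in> coord_space (chart_dim \<phi>)" and S: "open S" "p \<in> S"
    and k: "\<And>x. x \<in> S \<Longrightarrow> x \<in> chart_dom \<phi> \<Longrightarrow> k (chart_map \<phi> x) = h (g (chart_map \<phi> x))"
  shows "differential k (chart_map \<phi> p) u = differential h b (differential g (chart_map \<phi> p) u)"
proof -
  have pm: "chart_map \<phi> p \<in> coord_space (chart_dim \<phi>)" using chart_map_mem[OF \<phi> charts_atD(2)[OF \<phi>]] .
  obtain r where r: "r > 0" "\<forall>z\<in>coord_space (chart_dim \<phi>). vdist (chart_dim \<phi>) z (chart_map \<phi> p) < r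
      \<longrightarrow> (\<exists>x\<in>S \<inter> chart_dom \<phi>. z = chart_map \<phi> x)"
    using chart_ball[OF \<phi> S] by blast
  have eq: "k z = h (g z)"
    if "z \<in> coord_space (chart_dim \<phi>)" "vdist (chart_dim \<phi>) z (chart_map \<phi> p) < r" for z
    using r(2) that k by blast
  have h': "strictly_diff m l h (g (chart_map \<phi> p)) B" using h a by simp
  show ?thesis unfolding a[symmetric] by (rule differential_chain[OF g h' pm u r(1)]) (rule eq)
qed

lemma transition_chain:
  assumes \<phi>: "\<phi> \<in> charts_at \<A> p" and \<psi>: "\<psi> \<in> charts_at \<A> p" and \<theta>: "\<theta> \<in> charts_at \<A> p"
    and u: "u \<in> coord_space (chart_dim \<phi>)"
  shows "differential (transition \<phi> \<theta>) (chart_map \<phi> p) u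
    = differential (transition \<psi> \<theta>) (chart_map \<psi> p) (differential (transition \<phi> \<psi>) (chart_map \<phi> p) u)"
proof -
  obtain J J' where J: "strictly_diff (chart_dim \<phi>) (chart_dim \<psi>) (transition \<phi> \<psi>) (chart_map \<phi> p) J"
    "strictly_diff (chart_dim \<psi>) (chart_dim \<theta>) (transition \<psi> \<theta>) (chart_map \<psi> p) J'"
    using strictly_diff_transition \<phi> \<psi> \<theta> by blast
  show ?thesis
    by (rule chain_aux[OF \<phi> transition_p[OF \<phi>] J u charts_atD(4)[OF \<psi>] charts_atD(2)[OF \<psi>]])
      (simp add: transition_def chart_inv_map[OF \<phi>] chart_inv_map[OF \<psi>])
qed

lemma local_rep_chain_right:
  assumes \<phi>: "\<phi> \<in> charts_at \<A> p" and \<psi>: "\<psi> \<in> charts_at \<A> p" and \<theta>: "\<theta> \<in> charts_at \<A> p"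
    and u: "u \<in> coord_space (chart_dim \<phi>)"
  shows "differential (local_rep \<phi> \<theta>) (chart_map \<phi> p) u
    = differential (local_rep \<psi> \<theta>) (chart_map \<psi> p) (differential (transition \<phi> \<psi>) (chart_map \<phi> p) u)"
proof -
  obtain J J' where J: "strictly_diff (chart_dim \<phi>) (chart_dim \<psi>) (transition \<phi> \<psi>) (chart_map \<phi> p) J"
    "strictly_diff (chart_dim \<psi>) (chart_dim \<theta>) (local_rep \<psi> \<theta>) (chart_map \<psi> p) J'"
    using strictly_diff_transition strictly_diff_local_rep \<phi> \<psi> \<theta> by blast
  show ?thesis
    by (rule chain_aux[OF \<phi> transition_p[OF \<phi>] J u charts_atD(4)[OF \<psi>] charts_atD(2)[OF \<psi>]])
      (simp add: transition_def local_rep_def chart_inv_map[OF \<phi>] chart_inv_map[OF \<psi>])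
qed

lemma local_rep_chain_left:
  assumes \<phi>: "\<phi> \<in> charts_at \<A> p" and \<psi>: "\<psi> \<in> charts_at \<A> p" and \<theta>: "\<theta> \<in> charts_at \<A> p"
    and u: "u \<in> coord_space (chart_dim \<phi>)"
  shows "differential (local_rep \<phi> \<theta>) (chart_map \<phi> p) u
    = differential (transition \<psi> \<theta>) (chart_map \<psi> p) (differential (local_rep \<phi> \<psi>) (chart_map \<phi> p) u)"
proof -
  obtain J J' where J: "strictly_diff (chart_dim \<phi>) (chart_dim \<psi>) (local_rep \<phi> \<psi>) (chart_map \<phi> p) J"
    "strictly_diff (chart_dim \<psi>) (chart_dim \<theta>) (transition \<psi> \<theta>) (chart_map \<psi> p) J'"
    using strictly_diff_transition strictly_diff_local_rep \<phi> \<psi> \<theta> by blast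
  have S: "open {x \<in> M\<^sub>0. f x \<in> chart_dom \<psi>}" "p \<in> {x \<in> M\<^sub>0. f x \<in> chart_dom \<psi>}"
    using open_preimage[OF charts_atD(4)[OF \<psi>]] charts_atD(2)[OF \<psi>] p_mem f_p by auto
  show ?thesis
    by (rule chain_aux[OF \<phi> local_rep_p[OF \<phi>] J u S])
      (simp add: transition_def local_rep_def chart_inv_map[OF \<phi>] chart_inv_map[OF \<psi>])
qed

lemma transition_self:
  assumes \<phi>: "\<phi> \<in> charts_at \<A> p" and u: "u \<in> coord_space (chart_dim \<phi>)"
  shows "differential (transition \<phi> \<phi>) (chart_map \<phi> p) u = u"
proof -
  let ?n = "chart_dim \<phi>"
  have pm: "chart_map \<phi> p \<in> coord_space ?n" using chart_map_mem[OF \<phi> charts_atD(2)[OF \<phi>]] .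
  obtain r where r: "r > 0" "\<forall>z\<in>coord_space ?n. vdist ?n z (chart_map \<phi> p) < r
      \<longrightarrow> (\<exists>x\<in>UNIV \<inter> chart_dom \<phi>. z = chart_map \<phi> x)"
    using chart_ball[OF \<phi>, of UNIV] by auto
  have "transition \<phi> \<phi> z = z" if z: "z \<in> coord_space ?n" "vdist ?n z (chart_map \<phi> p) < r" for z
  proof -
    obtain x where "x \<in> chart_dom \<phi>" "z = chart_map \<phi> x" using r(2) z by blast
    then show ?thesis by (simp add: transition_def chart_inv_map[OF \<phi>])
  qed
  then have "strictly_diff ?n ?n (transition \<phi> \<phi>) (chart_map \<phi> p) (\<lambda>i j. if i = j then 1 else 0)"
    by (intro strictly_diff_cong[OF strictly_diff_id r(1)])
  then have d: "differential (transition \<phi> \<phi>) (chart_map \<phi> p) u = mvec ?n ?n (\<lambda>i j. if i = j then 1 else 0) u"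
    by (rule differential_eq_mvec[OF _ pm u])
  have "(\<Sum>i<?n. (if j = i then 1 else 0) * u i) = (\<Sum>i<?n. if j = i then u i else 0)" for j
    by (intro sum.cong) auto
  then show ?thesis unfolding d
    by (intro coord_space_eqI[OF mvec_in_coord_space u]) (simp add: mvec_def)
qed

text \<open>Inverse to reading off the coordinates in \<phi>; it shows that a tangent vector amounts
  to its coordinates in one chart.\<close>

definition tangent_lift :: "('m, 'k) chart \<Rightarrow> (nat \<Rightarrow> 'k) \<Rightarrow> ('m, 'k) chart \<Rightarrow> nat \<Rightarrow> 'k" where
  "tangent_lift \<phi> u = (\<lambda>\<psi>. if \<psi> \<in> charts_at \<A> p
     then differential (transition \<phi> \<psi>) (chart_map \<phi> p) u else (\<lambda>_. 0))"

lemma differential_transition_mem: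
  assumes \<phi>: "\<phi> \<in> charts_at \<A> p" and \<psi>: "\<psi> \<in> charts_at \<A> p" and u: "u \<in> coord_space (chart_dim \<phi>)"
  shows "differential (transition \<phi> \<psi>) (chart_map \<phi> p) u \<in> coord_space (chart_dim \<psi>)"
proof -
  obtain J where J: "strictly_diff (chart_dim \<phi>) (chart_dim \<psi>) (transition \<phi> \<psi>) (chart_map \<phi> p) J"
    using strictly_diff_transition[OF \<phi> \<psi>] by blast
  show ?thesis
    unfolding differential_eq_mvec[OF J chart_map_mem[OF \<phi> charts_atD(2)[OF \<phi>]] u] by simp
qed

lemma tangent_lift_mem:
  assumes \<phi>: "\<phi> \<in> charts_at \<A> p" and u: "u \<in> coord_space (chart_dim \<phi>)"
  shows "tangent_lift \<phi> u \<in> tangent_space \<A> p"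
  unfolding tangent_space_def
proof (intro CollectI conjI ballI allI impI)
  show "tangent_lift \<phi> u \<psi> \<in> coord_space (chart_dim \<psi>)" if "\<psi> \<in> charts_at \<A> p" for \<psi>
    using differential_transition_mem[OF \<phi> that u] that by (simp add: tangent_lift_def)
  show "tangent_lift \<phi> u \<psi> = (\<lambda>_. 0)" if "\<psi> \<notin> charts_at \<A> p" for \<psi>
    using that by (simp add: tangent_lift_def)
  show "tangent_lift \<phi> u \<theta> = differential (chart_map \<theta> \<circ> chart_inv \<psi>) (chart_map \<psi> p) (tangent_lift \<phi> u \<psi>)"
    if "\<psi> \<in> charts_at \<A> p" "\<theta> \<in> charts_at \<A> p" for \<psi> \<theta>
    using transition_chain[OF \<phi> that u] that by (simp add: tangent_lift_def flip: transition_def)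
qed

lemma tangent_lift_self:
  assumes "\<phi> \<in> charts_at \<A> p" "u \<in> coord_space (chart_dim \<phi>)" shows "tangent_lift \<phi> u \<phi> = u"
  using transition_self[OF assms] assms(1) by (simp add: tangent_lift_def)

lemma tangent_spaceD:
  assumes v: "v \<in> tangent_space \<A> p" and \<phi>: "\<phi> \<in> charts_at \<A> p"
  shows "v \<phi> \<in> coord_space (chart_dim \<phi>)" "tangent_lift \<phi> (v \<phi>) = v"
proof -
  show "v \<phi> \<in> coord_space (chart_dim \<phi>)" using v \<phi> unfolding tangent_space_def by blast
  show "tangent_lift \<phi> (v \<phi>) = v"
  proof
    fix \<psi> show "tangent_lift \<phi> (v \<phi>) \<psi> = v \<psi>"
    proof (cases "\<psi> \<in> charts_at \<A> p")
      case True
      then have "v \<psi> = differential (chart_map \<psi> \<circ> chart_inv \<phi>) (chart_map \<phi> p) (v \<phi>)"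
        using v \<phi> unfolding tangent_space_def by blast
      then show ?thesis using True by (simp add: tangent_lift_def transition_def)
    next
      case False
      then show ?thesis using v unfolding tangent_space_def by (simp add: tangent_lift_def)
    qed
  qed
qed

lemma tangent_lift_linear:
  assumes \<phi>: "\<phi> \<in> charts_at \<A> p" and u: "u \<in> coord_space (chart_dim \<phi>)" and w: "w \<in> coord_space (chart_dim \<phi>)"
  shows "tangent_lift \<phi> u + tangent_lift \<phi> w = tangent_lift \<phi> (\<lambda>i. u i + w i)"
    and "tangent_scale c (tangent_lift \<phi> u) = tangent_lift \<phi> (\<lambda>i. c * u i)"
proof -
  have pm: "chart_map \<phi> p \<in> coord_space (chart_dim \<phi>)" using chart_map_mem[OF \<phi> charts_atD(2)[OF \<phi>]] .
  have "differential (transition \<phi> \<psi>) (chart_map \<phi> p) (\<lambda>i. u i + w i)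
      = (\<lambda>j. differential (transition \<phi> \<psi>) (chart_map \<phi> p) u j + differential (transition \<phi> \<psi>) (chart_map \<phi> p) w j)
    \<and> differential (transition \<phi> \<psi>) (chart_map \<phi> p) (\<lambda>i. c * u i)
      = (\<lambda>j. c * differential (transition \<phi> \<psi>) (chart_map \<phi> p) u j)" if \<psi>: "\<psi> \<in> charts_at \<A> p" for \<psi>
  proof -
    obtain J where J: "strictly_diff (chart_dim \<phi>) (chart_dim \<psi>) (transition \<phi> \<psi>) (chart_map \<phi> p) J"
      using strictly_diff_transition[OF \<phi> \<psi>] by blast
    show ?thesis
      unfolding differential_eq_mvec[OF J pm u] differential_eq_mvec[OF J pm w]
        differential_eq_mvec[OF J pm coord_space_add[OF u w]]
        differential_eq_mvec[OF J pm coord_space_scale[OF u]] mvec_add mvec_scale by simp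
  qed
  then show "tangent_lift \<phi> u + tangent_lift \<phi> w = tangent_lift \<phi> (\<lambda>i. u i + w i)"
    and "tangent_scale c (tangent_lift \<phi> u) = tangent_lift \<phi> (\<lambda>i. c * u i)"
    by (auto simp: tangent_lift_def tangent_scale_def fun_eq_iff)
qed

lemma coordinate_space_tangent:
  assumes \<phi>: "\<phi> \<in> charts_at \<A> p"
  shows "coordinate_space tangent_scale (tangent_space \<A> p) (chart_dim \<phi>) (\<lambda>v. v \<phi>)
    (\<lambda>i. tangent_lift \<phi> (unit_vec i))"
proof -
  let ?T = "tangent_space \<A> p" and ?n = "chart_dim \<phi>"
  have e_mem: "tangent_lift \<phi> (unit_vec i) \<in> ?T" if "i < ?n" for i
    using that by (intro tangent_lift_mem[OF \<phi>]) simp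
  have add_mem: "u + v \<in> ?T" if "u \<in> ?T" "v \<in> ?T" for u v
  proof -
    have "u + v = tangent_lift \<phi> (\<lambda>i. u \<phi> i + v \<phi> i)"
      using tangent_lift_linear(1)[OF \<phi> tangent_spaceD(1)[OF that(1) \<phi>] tangent_spaceD(1)[OF that(2) \<phi>]]
      by (simp add: tangent_spaceD(2)[OF that(1) \<phi>] tangent_spaceD(2)[OF that(2) \<phi>])
    then show ?thesis
      using tangent_lift_mem[OF \<phi> coord_space_add] tangent_spaceD(1)[OF _ \<phi>] that by metis
  qed
  have scale_mem: "tangent_scale c v \<in> ?T" if "v \<in> ?T" for c v
  proof -
    have "tangent_scale c v = tangent_lift \<phi> (\<lambda>i. c * v \<phi> i)"
      using tangent_lift_linear(2)[OF \<phi> tangent_spaceD(1)[OF that \<phi>] zero_in_coord_space]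
      by (simp add: tangent_spaceD(2)[OF that \<phi>])
    then show ?thesis
      using tangent_lift_mem[OF \<phi> coord_space_scale] tangent_spaceD(1)[OF that \<phi>] by metis
  qed
  have zero_mem: "0 \<in> ?T"
  proof -
    have "tangent_lift \<phi> (\<lambda>_. 0) \<in> ?T" by (intro tangent_lift_mem[OF \<phi>]) simp
    from scale_mem[OF this, of 0] show ?thesis by (simp add: tangent_scale_def zero_fun_def)
  qed
  have sum_mem: "(\<Sum>i\<in>I. F i) \<in> ?T" if "\<And>i. i \<in> I \<Longrightarrow> F i \<in> ?T" for I and F :: "nat \<Rightarrow> _"
    using that by (induction I rule: infinite_finite_induct) (auto intro: add_mem zero_mem)
  have sum_apply: "(\<Sum>i\<in>I. F i) \<phi> j = (\<Sum>i\<in>I. F i \<phi> j)"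
    for I j and F :: "nat \<Rightarrow> ('m, 'k) chart \<Rightarrow> nat \<Rightarrow> 'k"
    by (induction I rule: infinite_finite_induct) auto
  show ?thesis
  proof
    fix v assume v: "v \<in> ?T"
    let ?S = "\<Sum>i<?n. tangent_scale (v \<phi> i) (tangent_lift \<phi> (unit_vec i))"
    have S: "?S \<in> ?T" by (intro sum_mem scale_mem e_mem) simp
    have "?S \<phi> j = v \<phi> j" for j
    proof -
      have "?S \<phi> j = (\<Sum>i<?n. v \<phi> i * unit_vec i j)"
        unfolding sum_apply tangent_scale_def
        by (intro sum.cong) (simp_all add: tangent_lift_self[OF \<phi>])
      then show ?thesis
        using tangent_spaceD(1)[OF v \<phi>] by (auto simp: sum_unit_vec coord_space_def)
    qed
    then have "?S \<phi> = v \<phi>" by (rule ext)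
    \<comment> \<open>Tangent vectors that agree in one chart agree in all.\<close>
    then show "v = ?S" using tangent_spaceD(2)[OF v \<phi>] tangent_spaceD(2)[OF S \<phi>] by metis
  qed (use e_mem add_mem scale_mem zero_mem tangent_spaceD(1)[OF _ \<phi>] tangent_lift_self[OF \<phi>]
      in \<open>auto simp: tangent_scale_def\<close>)
qed

text \<open>The lift of the image computed in \<phi> satisfies the condition for every pair of
  charts by the chain rules on both sides, and its value in \<phi> alone determines it. This
  resolves the definite description.\<close>

lemma tangent_map_chart:
  assumes \<phi>: "\<phi> \<in> charts_at \<A> p" and v: "v \<in> tangent_space \<A> p"
  shows "tangent_map \<A> p f v \<in> tangent_space \<A> p"
    and "tangent_map \<A> p f v \<phi> = differential (local_rep \<phi> \<phi>) (chart_map \<phi> p) (v \<phi>)"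
proof -
  let ?P = "\<lambda>w. w \<in> tangent_space \<A> (f p) \<and>
     (\<forall>\<phi>\<in>charts_at \<A> p. \<forall>\<psi>\<in>charts_at \<A> (f p).
        w \<psi> = differential (chart_map \<psi> \<circ> f \<circ> chart_inv \<phi>) (chart_map \<phi> p) (v \<phi>))"
  define u where "u = differential (local_rep \<phi> \<phi>) (chart_map \<phi> p) (v \<phi>)"
  have vm: "v \<psi> \<in> coord_space (chart_dim \<psi>)" if "\<psi> \<in> charts_at \<A> p" for \<psi>
    using tangent_spaceD(1)[OF v that] .
  obtain J where J: "strictly_diff (chart_dim \<phi>) (chart_dim \<phi>) (local_rep \<phi> \<phi>) (chart_map \<phi> p) J"
    using strictly_diff_local_rep[OF \<phi> \<phi>] by blast
  have u: "u \<in> coord_space (chart_dim \<phi>)"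
    unfolding u_def differential_eq_mvec[OF J chart_map_mem[OF \<phi> charts_atD(2)[OF \<phi>]] vm[OF \<phi>]] by simp
  have w: "?P (tangent_lift \<phi> u)" unfolding f_p
  proof (intro conjI ballI)
    show "tangent_lift \<phi> u \<in> tangent_space \<A> p" by (rule tangent_lift_mem[OF \<phi> u])
    fix \<psi> \<theta> assume \<psi>: "\<psi> \<in> charts_at \<A> p" and \<theta>: "\<theta> \<in> charts_at \<A> p"
    have "v \<psi> = differential (transition \<phi> \<psi>) (chart_map \<phi> p) (v \<phi>)"
      using v \<phi> \<psi> unfolding tangent_space_def transition_def by blast
    then have "differential (local_rep \<psi> \<theta>) (chart_map \<psi> p) (v \<psi>)
        = differential (local_rep \<phi> \<theta>) (chart_map \<phi> p) (v \<phi>)"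
      using local_rep_chain_right[OF \<phi> \<psi> \<theta> vm[OF \<phi>]] by simp
    also have "\<dots> = tangent_lift \<phi> u \<theta>"
      using local_rep_chain_left[OF \<phi> \<phi> \<theta> vm[OF \<phi>]] \<theta> by (simp add: tangent_lift_def u_def)
    finally show "tangent_lift \<phi> u \<theta> = differential (chart_map \<theta> \<circ> f \<circ> chart_inv \<psi>) (chart_map \<psi> p) (v \<psi>)"
      by (simp add: local_rep_def)
  qed
  have "tangent_map \<A> p f v = tangent_lift \<phi> u"
    unfolding tangent_map_def
  proof (rule the_equality[of ?P, OF w])
    fix w' assume w': "?P w'"
    then have "w' \<phi> = u" using \<phi> unfolding f_p u_def local_rep_def by blast
    then show "w' = tangent_lift \<phi> u" using tangent_spaceD(2)[OF _ \<phi>, of w'] w' unfolding f_p by metis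
  qed
  then show "tangent_map \<A> p f v \<in> tangent_space \<A> p" "tangent_map \<A> p f v \<phi> = u"
    using tangent_lift_mem[OF \<phi> u] tangent_lift_self[OF \<phi> u] by simp_all
qed

end

section \<open>Invariant neighbourhoods\<close>

locale adapted_chart = analytic_fixed_point \<A> M\<^sub>0 f p +
    adapted_fixed_point "chart_dim \<phi>" A s r q C
      "analytic_fixed_point.local_rep f \<phi> \<phi>" "chart_map \<phi> p" \<rho> K
  for \<A> :: "('m::topological_space, 'k::complete_ultrametric_field) chart set"
    and M\<^sub>0 :: "'m set" and f :: "'m \<Rightarrow> 'm" and p :: 'm and \<phi> :: "('m, 'k) chart"
    and A :: "nat \<Rightarrow> nat \<Rightarrow> 'k" and s r q C \<rho> K +
  assumes \<phi>: "\<phi> \<in> charts_at \<A> p"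
begin

definition radius :: "'m \<Rightarrow> real" where
  "radius x = dq (chart_map \<phi> x) (chart_map \<phi> p)"

definition chart_q_ball :: "real \<Rightarrow> 'm set" where
  "chart_q_ball \<epsilon> = {x \<in> chart_dom \<phi>. radius x < \<epsilon>}"

definition rep_dom :: "'m set" where
  "rep_dom = M\<^sub>0 \<inter> chart_dom \<phi> \<inter> {x \<in> M\<^sub>0. f x \<in> chart_dom \<phi>}"

lemma radius_nonneg [simp]: "0 \<le> radius x"
  by (simp add: radius_def)

lemma map_mem: "x \<in> chart_dom \<phi> \<Longrightarrow> chart_map \<phi> x \<in> coord_space (chart_dim \<phi>)"
  by (rule chart_map_mem[OF \<phi>])

lemma map_inj: "x \<in> chart_dom \<phi> \<Longrightarrow> y \<in> chart_dom \<phi> \<Longrightarrow> chart_map \<phi> x = chart_map \<phi> y \<Longrightarrow> x = y"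
  using chart_inv_map[OF \<phi>] by metis

lemma p_dom: "p \<in> chart_dom \<phi>"
  by (rule charts_atD(2)[OF \<phi>])

lemma open_rep_dom: "open rep_dom" and p_rep_dom: "p \<in> rep_dom"
  unfolding rep_dom_def using open_M0 charts_atD(4)[OF \<phi>] open_preimage p_mem p_dom f_p by auto

lemma local_rep_map: "x \<in> chart_dom \<phi> \<Longrightarrow> local_rep \<phi> \<phi> (chart_map \<phi> x) = chart_map \<phi> (f x)"
  by (simp add: local_rep_def chart_inv_map[OF \<phi>])

lemma chart_q_nbhd: "0 < \<epsilon> \<Longrightarrow> \<exists>S. open S \<and> p \<in> S \<and> S \<subseteq> chart_q_ball \<epsilon>"
proof -
  assume \<epsilon>: "0 < \<epsilon>"
  obtain D where D: "0 \<le> D" "\<And>x. q x \<le> D * vnorm (chart_dim \<phi>) x" by (rule q_bound) blast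
  have "0 < \<epsilon> / (D + 1)" using \<epsilon> D by simp
  then obtain S where S: "open S" "p \<in> S"
    "S \<subseteq> {x \<in> chart_dom \<phi>. vdist (chart_dim \<phi>) (chart_map \<phi> x) (chart_map \<phi> p) < \<epsilon> / (D + 1)}"
    using chart_nbhd[OF \<phi>] by blast
  have "radius x < \<epsilon>" if x: "x \<in> S" for x
  proof -
    let ?v = "vdist (chart_dim \<phi>) (chart_map \<phi> x) (chart_map \<phi> p)"
    have "?v < \<epsilon> / (D + 1)" using S(3) x by blast
    then have "(D + 1) * ?v < \<epsilon>" using D by (simp add: field_simps)
    moreover have "radius x \<le> D * ?v" unfolding radius_def dq_def vdist_def by (rule D)
    moreover have "D * ?v \<le> (D + 1) * ?v" by (intro mult_right_mono) auto
    ultimately show ?thesis by linarith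
  qed
  with S show ?thesis unfolding chart_q_ball_def by blast
qed

text \<open>The second part says that the chart fills a whole q-ball. It turns points found in
  coordinates, such as cone points, into points of the manifold.\<close>

lemma chart_q_ball_subset:
  assumes S: "open S" "p \<in> S"
  shows "\<exists>\<epsilon>>0. chart_q_ball \<epsilon> \<subseteq> S \<and> (\<forall>z\<in>coord_space (chart_dim \<phi>). dq z (chart_map \<phi> p) < \<epsilon>
    \<longrightarrow> (\<exists>x\<in>S \<inter> chart_dom \<phi>. chart_map \<phi> x = z))"
proof -
  let ?n = "chart_dim \<phi>" and ?a = "chart_map \<phi> p"
  obtain R where R: "R > 0" "\<forall>z\<in>coord_space ?n. vdist ?n z ?a < R \<longrightarrow> (\<exists>x\<in>S \<inter> chart_dom \<phi>. z = chart_map \<phi> x)"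
    using chart_ball[OF \<phi> S] by blast
  define \<epsilon> where "\<epsilon> = R / (C + 1)"
  have \<epsilon>: "0 < \<epsilon>" using R(1) C_nonneg by (simp add: \<epsilon>_def)
  have main: "\<exists>x\<in>S \<inter> chart_dom \<phi>. chart_map \<phi> x = z" if z: "z \<in> coord_space ?n" "dq z ?a < \<epsilon>" for z
  proof -
    have "(C + 1) * dq z ?a < R" using z(2) C_nonneg by (simp add: \<epsilon>_def field_simps)
    moreover have "C * dq z ?a \<le> (C + 1) * dq z ?a" by (intro mult_right_mono) auto
    ultimately have "vdist ?n z ?a < R" using vdist_le_dq[of z ?a] by linarith
    then obtain x where "x \<in> S \<inter> chart_dom \<phi>" "z = chart_map \<phi> x" using R(2) z(1) by blast
    then show ?thesis by blast
  qed
  have "x \<in> S" if x: "x \<in> chart_q_ball \<epsilon>" for x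
  proof -
    have xd: "x \<in> chart_dom \<phi>" "dq (chart_map \<phi> x) ?a < \<epsilon>"
      using x by (auto simp: chart_q_ball_def radius_def)
    obtain y where "y \<in> S \<inter> chart_dom \<phi>" "chart_map \<phi> y = chart_map \<phi> x"
      using main[OF map_mem[OF xd(1)] xd(2)] by blast
    then show ?thesis using map_inj[of y x] xd(1) by auto
  qed
  then show ?thesis using \<epsilon> main by blast
qed

text \<open>For r at most 1 the radius does not increase under f. The bound b is left free:
  surjectivity calls for 1/2, the other applications use 1.\<close>

lemma invariant_ball:
  assumes P: "nbhd_in M\<^sub>0 p P" and r: "r \<le> 1" and b: "0 < b"
  shows "\<exists>\<epsilon>>0. \<epsilon> \<le> \<rho> \<and> K * \<epsilon> \<le> b \<and> nbhd_in M\<^sub>0 p (chart_q_ball \<epsilon>) \<and> chart_q_ball \<epsilon> \<subseteq> P \<and>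
    (\<forall>x\<in>chart_q_ball \<epsilon>. f x \<in> chart_q_ball \<epsilon> \<and> radius (f x) \<le> r * radius x) \<and>
    (\<forall>z\<in>coord_space (chart_dim \<phi>). dq z (chart_map \<phi> p) < \<epsilon> \<longrightarrow> (\<exists>x\<in>chart_q_ball \<epsilon>. chart_map \<phi> x = z))"
proof -
  let ?n = "chart_dim \<phi>" and ?a = "chart_map \<phi> p"
  define S where "S = interior P \<inter> rep_dom"
  have S: "open S" "p \<in> S" using P open_rep_dom p_rep_dom by (auto simp: S_def nbhd_in_def)
  obtain \<epsilon>1 where \<epsilon>1: "\<epsilon>1 > 0" "chart_q_ball \<epsilon>1 \<subseteq> S"
    "\<forall>z\<in>coord_space ?n. dq z ?a < \<epsilon>1 \<longrightarrow> (\<exists>x\<in>S \<inter> chart_dom \<phi>. chart_map \<phi> x = z)"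
    using chart_q_ball_subset[OF S] by blast
  \<comment> \<open>The last bound yields both \<open>K * \<epsilon> \<le> r\<close>, so that radii
    scale by r, and \<open>K * \<epsilon> \<le> b\<close>.\<close>
  define \<epsilon> where "\<epsilon> = min (min \<epsilon>1 \<rho>) (min r b / (K + 1))"
  have "0 < min r b / (K + 1)" using r_pos b K_nonneg by (simp add: add_nonneg_pos)
  then have \<epsilon>: "0 < \<epsilon>" "\<epsilon> \<le> \<epsilon>1" "\<epsilon> \<le> \<rho>" using \<epsilon>1 \<rho>_pos by (auto simp: \<epsilon>_def)
  have "\<epsilon> \<le> min r b / (K + 1)" by (simp add: \<epsilon>_def)
  then have "\<epsilon> * (K + 1) \<le> min r b" using K_nonneg by (simp add: pos_le_divide_eq add_nonneg_pos)
  then have K\<epsilon>: "K * \<epsilon> \<le> r" "K * \<epsilon> \<le> b" using \<epsilon>(1) by (simp_all add: algebra_simps)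
  have sub: "chart_q_ball \<epsilon> \<subseteq> S" using \<epsilon>(2) \<epsilon>1(2) unfolding chart_q_ball_def by auto
  have step: "f x \<in> chart_q_ball \<epsilon> \<and> radius (f x) \<le> r * radius x" if x: "x \<in> chart_q_ball \<epsilon>" for x
  proof -
    have xd: "x \<in> chart_dom \<phi>" "radius x < \<epsilon>" using x by (auto simp: chart_q_ball_def)
    have fx: "f x \<in> chart_dom \<phi>" using x sub unfolding S_def rep_dom_def by blast
    have "K * radius x \<le> K * \<epsilon>" using xd K_nonneg by (intro mult_left_mono) auto
    then have "dq (local_rep \<phi> \<phi> (chart_map \<phi> x)) ?a \<le> r * dq (chart_map \<phi> x) ?a"
      using xd \<epsilon> K\<epsilon> unfolding radius_def by (intro dq_g_fixed_le map_mem) auto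
    then have le: "radius (f x) \<le> r * radius x" unfolding local_rep_map[OF xd(1)] radius_def .
    moreover have "r * radius x \<le> radius x" using r r_pos by (intro mult_left_le_one_le) auto
    ultimately show ?thesis using xd fx by (simp add: chart_q_ball_def)
  qed
  obtain S' where "open S'" "p \<in> S'" "S' \<subseteq> chart_q_ball \<epsilon>" using chart_q_nbhd[OF \<epsilon>(1)] by blast
  then have "p \<in> interior (chart_q_ball \<epsilon>)" by (rule interiorI)
  moreover have "chart_q_ball \<epsilon> \<subseteq> M\<^sub>0" using sub unfolding S_def rep_dom_def by blast
  ultimately have nb: "nbhd_in M\<^sub>0 p (chart_q_ball \<epsilon>)" by (simp add: nbhd_in_def)
  have "chart_q_ball \<epsilon> \<subseteq> P" using sub interior_subset unfolding S_def by blast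
  moreover have "\<exists>x\<in>chart_q_ball \<epsilon>. chart_map \<phi> x = z"
    if z: "z \<in> coord_space ?n" "dq z ?a < \<epsilon>" for z
  proof -
    obtain x where "x \<in> S \<inter> chart_dom \<phi>" "chart_map \<phi> x = z" using \<epsilon>1(3) z \<epsilon>(2) by auto
    then show ?thesis using z(2) by (intro bexI[of _ x]) (auto simp: chart_q_ball_def radius_def)
  qed
  ultimately show ?thesis using \<epsilon> K\<epsilon> nb step by blast
qed

lemma ex_invariant_nbhd:
  assumes "r \<le> 1" "nbhd_in M\<^sub>0 p P"
  shows "\<exists>Q. nbhd_in M\<^sub>0 p Q \<and> Q \<subseteq> P \<and> f ` Q \<subseteq> Q"
proof -
  obtain \<epsilon> where "nbhd_in M\<^sub>0 p (chart_q_ball \<epsilon>)" "chart_q_ball \<epsilon> \<subseteq> P" "\<forall>x\<in>chart_q_ball \<epsilon>. f x \<in> chart_q_ball \<epsilon>"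
    using invariant_ball[OF assms(2,1) zero_less_one] by blast
  then show ?thesis by (intro exI[of _ "chart_q_ball \<epsilon>"]) auto
qed

lemma ex_fully_invariant_nbhd:
  assumes sr: "s = 1" "r = 1"
    and inv: "\<And>x. x \<in> coord_space (chart_dim \<phi>) \<Longrightarrow>
      mvec (chart_dim \<phi>) (chart_dim \<phi>) A (mvec (chart_dim \<phi>) (chart_dim \<phi>) A' x) = x"
    and P: "nbhd_in M\<^sub>0 p P"
  shows "\<exists>Q. nbhd_in M\<^sub>0 p Q \<and> Q \<subseteq> P \<and> f ` Q = Q"
proof -
  let ?n = "chart_dim \<phi>" and ?a = "chart_map \<phi> p"
  obtain \<epsilon> where \<epsilon>: "\<epsilon> > 0" "\<epsilon> \<le> \<rho>" "K * \<epsilon> \<le> 1 / 2" "nbhd_in M\<^sub>0 p (chart_q_ball \<epsilon>)" "chart_q_ball \<epsilon> \<subseteq> P"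
    "\<forall>x\<in>chart_q_ball \<epsilon>. f x \<in> chart_q_ball \<epsilon> \<and> radius (f x) \<le> r * radius x"
    "\<forall>z\<in>coord_space ?n. dq z ?a < \<epsilon> \<longrightarrow> (\<exists>x\<in>chart_q_ball \<epsilon>. chart_map \<phi> x = z)"
    using invariant_ball[OF P, of "1 / 2"] sr by auto
  have "y \<in> f ` chart_q_ball \<epsilon>" if y: "y \<in> chart_q_ball \<epsilon>" for y
  proof -
    have yd: "y \<in> chart_dom \<phi>" "dq (chart_map \<phi> y) ?a < \<epsilon>"
      using y by (auto simp: chart_q_ball_def radius_def)
    \<comment> \<open>The equation is solved in coordinates; the solution lies in the filled q-ball
      and so comes from the manifold.\<close>
    obtain z where z: "z \<in> coord_space ?n" "dq z ?a < \<epsilon>" "local_rep \<phi> \<phi> z = chart_map \<phi> y"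
      using g_surj_ball[OF sr inv \<epsilon>(2,3) map_mem[OF yd(1)] yd(2)] by blast
    obtain x where x: "x \<in> chart_q_ball \<epsilon>" "chart_map \<phi> x = z" using \<epsilon>(7) z by blast
    have "x \<in> chart_dom \<phi>" "f x \<in> chart_dom \<phi>" using x \<epsilon>(6) by (auto simp: chart_q_ball_def)
    moreover from this have "chart_map \<phi> (f x) = chart_map \<phi> y"
      using local_rep_map[of x] z(3) x(2) by simp
    ultimately have "f x = y" using yd(1) by (intro map_inj)
    with x(1) show ?thesis by blast
  qed
  with \<epsilon> show ?thesis by (intro exI[of _ "chart_q_ball \<epsilon>"]) auto
qed

text \<open>Radii shrink at least like \<open>r ^ k\<close> along orbits, so the invariant balls are
  attracted to p.\<close>

lemma attractive:
  assumes r: "r < 1" shows "uniformly_attractive M\<^sub>0 f p"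
  unfolding uniformly_attractive_def
proof (intro conjI allI impI f_p)
  fix P assume P: "nbhd_in M\<^sub>0 p P"
  obtain \<epsilon> where \<epsilon>: "nbhd_in M\<^sub>0 p (chart_q_ball \<epsilon>)" "chart_q_ball \<epsilon> \<subseteq> P"
    "\<forall>x\<in>chart_q_ball \<epsilon>. f x \<in> chart_q_ball \<epsilon> \<and> radius (f x) \<le> r * radius x"
    using invariant_ball[OF P less_imp_le[OF r] zero_less_one] by blast
  have "(\<lambda>n. (f ^^ n) x) \<longlonglongrightarrow> p" if x: "x \<in> chart_q_ball \<epsilon>" for x
  proof (rule topological_tendstoI)
    have orbit: "(f ^^ k) x \<in> chart_q_ball \<epsilon> \<and> radius ((f ^^ k) x) \<le> r ^ k * radius x" for k
    proof (induction k)
      case (Suc k)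
      then have "radius (f ((f ^^ k) x)) \<le> r * radius ((f ^^ k) x)" using \<epsilon>(3) by blast
      also have "\<dots> \<le> r * (r ^ k * radius x)" using Suc r_pos by (intro mult_left_mono) auto
      finally show ?case using Suc \<epsilon>(3) by simp
    qed (use x in simp)
    fix S :: "'m set" assume S: "open S" "p \<in> S"
    obtain \<delta> where \<delta>: "\<delta> > 0" "chart_q_ball \<delta> \<subseteq> S" using chart_q_ball_subset[OF S] by blast
    have "(\<lambda>k. r ^ k * radius x) \<longlonglongrightarrow> 0 * radius x"
      using r r_pos by (intro tendsto_mult_right LIMSEQ_power_zero) auto
    then have "eventually (\<lambda>k. r ^ k * radius x < \<delta>) sequentially"
      using \<delta>(1) by (intro order_tendstoD(2)) auto
    then show "eventually (\<lambda>k. (f ^^ k) x \<in> S) sequentially"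
    proof (rule eventually_mono)
      fix k assume "r ^ k * radius x < \<delta>"
      then have "(f ^^ k) x \<in> chart_q_ball \<delta>"
        using orbit[of k] unfolding chart_q_ball_def by auto
      then show "(f ^^ k) x \<in> S" using \<delta>(2) by blast
    qed
  qed
  with \<epsilon> show "\<exists>Q. nbhd_in M\<^sub>0 p Q \<and> Q \<subseteq> P \<and> f ` Q \<subseteq> Q \<and> (\<forall>x\<in>Q. (\<lambda>n. (f ^^ n) x) \<longlonglongrightarrow> p)"
    by (intro exI[of _ "chart_q_ball \<epsilon>"]) auto
qed

section \<open>Obstructions from eigenvalues of extremal absolute value\<close>

lemma small_nbhd:
  assumes "0 < \<delta>"
  shows "\<exists>P. nbhd_in M\<^sub>0 p P \<and> P \<subseteq> rep_dom \<and> P \<subseteq> chart_q_ball \<delta>"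
proof -
  obtain S where S: "open S" "p \<in> S" "S \<subseteq> chart_q_ball \<delta>" using chart_q_nbhd[OF assms] by blast
  have "open (S \<inter> rep_dom)" "p \<in> S \<inter> rep_dom" using S open_rep_dom p_rep_dom by auto
  moreover have "S \<inter> rep_dom \<subseteq> M\<^sub>0" unfolding rep_dom_def by blast
  ultimately have "nbhd_in M\<^sub>0 p (S \<inter> rep_dom)"
    unfolding nbhd_in_def by (metis interior_open)
  with S show ?thesis by blast
qed

lemma left_eigenvector:
  assumes "eigenvalue_of (chart_dim \<phi>) (\<lambda>i j. to_ac (A i j)) \<mu>"
  obtains v where "v \<in> coord_space (chart_dim \<phi>)" "v \<noteq> (\<lambda>_. 0)"
    "mvec (chart_dim \<phi>) (chart_dim \<phi>) (\<lambda>i j. to_ac (A j i)) v = (\<lambda>i. \<mu> * v i)"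
  using eigenvalue_of_transpose[OF assms] unfolding eigenvalue_of_def by blast

text \<open>P is so small that orbits inside an invariant Q never leave the region of the cone
  estimate, and Q, being a neighbourhood, contains a starting point in the cone.\<close>

lemma expanding_orbit:
  assumes ev: "eigenvalue_of (chart_dim \<phi>) (\<lambda>i j. to_ac (A i j)) \<mu>" and \<mu>: "ac_av \<mu> = r"
  shows "\<exists>v P \<delta>. nbhd_in M\<^sub>0 p P \<and> P \<subseteq> chart_q_ball \<delta> \<and>
    (\<forall>Q. nbhd_in M\<^sub>0 p Q \<longrightarrow> Q \<subseteq> P \<longrightarrow> f ` Q \<subseteq> Q \<longrightarrow>
      (\<exists>x\<in>Q. 0 < ev_size v (chart_map \<phi> x) \<and>
        (\<forall>k. ev_size v (chart_map \<phi> ((f ^^ k) x)) = r ^ k * ev_size v (chart_map \<phi> x))))"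
proof -
  let ?n = "chart_dim \<phi>" and ?a = "chart_map \<phi> p"
  obtain v where v: "v \<in> coord_space ?n" "v \<noteq> (\<lambda>_. 0)" "mvec ?n ?n (\<lambda>i j. to_ac (A j i)) v = (\<lambda>i. \<mu> * v i)"
    using ev by (rule left_eigenvector)
  obtain \<delta> where \<delta>: "\<delta> > 0" "\<forall>\<eta>>0. \<exists>z0\<in>coord_space ?n. dq z0 ?a < \<eta> \<and> 0 < ev_size v z0 \<and>
    (\<forall>z. z 0 = z0 \<longrightarrow> (\<forall>k. z k \<in> coord_space ?n \<and> dq (z k) ?a < \<delta> \<and> z (Suc k) = local_rep \<phi> \<phi> (z k)) \<longrightarrow>
      (\<forall>k. ev_size v (z k) = r ^ k * ev_size v z0))"
    using forward_cone[OF v \<mu>] by (elim exE conjE)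
  obtain P where P: "nbhd_in M\<^sub>0 p P" "P \<subseteq> rep_dom" "P \<subseteq> chart_q_ball \<delta>" using small_nbhd[OF \<delta>(1)] by blast
  have "\<exists>x\<in>Q. 0 < ev_size v (chart_map \<phi> x) \<and>
        (\<forall>k. ev_size v (chart_map \<phi> ((f ^^ k) x)) = r ^ k * ev_size v (chart_map \<phi> x))"
    if Q: "nbhd_in M\<^sub>0 p Q" "Q \<subseteq> P" "f ` Q \<subseteq> Q" for Q
  proof -
    have "open (interior Q)" "p \<in> interior Q" using Q(1) by (auto simp: nbhd_in_def)
    from chart_q_ball_subset[OF this] obtain \<eta> where \<eta>: "\<eta> > 0" "\<forall>z\<in>coord_space ?n. dq z ?a < \<eta>
      \<longrightarrow> (\<exists>x\<in>interior Q \<inter> chart_dom \<phi>. chart_map \<phi> x = z)" by blast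
    from \<delta>(2)[rule_format, OF \<eta>(1)] obtain z0 where z0: "z0 \<in> coord_space ?n" "dq z0 ?a < \<eta>" "0 < ev_size v z0"
      and grow: "\<forall>z. z 0 = z0 \<longrightarrow> (\<forall>k. z k \<in> coord_space ?n \<and> dq (z k) ?a < \<delta> \<and> z (Suc k) = local_rep \<phi> \<phi> (z k)) \<longrightarrow>
        (\<forall>k. ev_size v (z k) = r ^ k * ev_size v z0)" by (elim bexE conjE)
    obtain x where x: "x \<in> interior Q" "chart_map \<phi> x = z0" using \<eta>(2) z0(1,2) by blast
    then have xQ: "x \<in> Q" using interior_subset by blast
    have orbit: "(f ^^ k) x \<in> Q" for k using xQ Q(3) by (induction k) auto
    have dom: "(f ^^ k) x \<in> chart_dom \<phi>" "radius ((f ^^ k) x) < \<delta>" for k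
      using orbit[of k] Q(2) P(3) unfolding chart_q_ball_def by blast+
    define z where "z = (\<lambda>k. chart_map \<phi> ((f ^^ k) x))"
    have "z k \<in> coord_space ?n \<and> dq (z k) ?a < \<delta> \<and> z (Suc k) = local_rep \<phi> \<phi> (z k)" for k
      using map_mem[OF dom(1)] dom(2)[of k] local_rep_map[OF dom(1), of k] by (simp add: z_def radius_def)
    moreover have "z 0 = z0" using x(2) by (simp add: z_def)
    ultimately have "\<forall>k. ev_size v (z k) = r ^ k * ev_size v z0" using grow by blast
    with xQ z0(3) x(2) show ?thesis unfolding z_def by blast
  qed
  with P show ?thesis by blast
qed

lemma ev_size_le_radius: obtains E where "0 < E" "\<And>x. ev_size v (chart_map \<phi> x) \<le> E * radius x"
proof -
  obtain E where E: "0 \<le> E" "\<And>x. ac_av (pairing (chart_dim \<phi>) v x) \<le> E * q x" by (rule ev_size_bound) blast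
  have "ev_size v (chart_map \<phi> x) \<le> (E + 1) * radius x" for x
  proof -
    have "ev_size v (chart_map \<phi> x) \<le> E * radius x" unfolding ev_size_def radius_def dq_def by (rule E)
    also have "\<dots> \<le> (E + 1) * radius x" by (intro mult_right_mono) auto
    finally show ?thesis .
  qed
  then show ?thesis using that[of "E + 1"] E(1) by simp
qed

text \<open>On P the form v is bounded, yet it grows like \<open>r ^ k\<close> along an orbit
  confined to Q.\<close>

lemma no_invariant_nbhds:
  assumes ev: "eigenvalue_of (chart_dim \<phi>) (\<lambda>i j. to_ac (A i j)) \<mu>" and \<mu>: "ac_av \<mu> = r" and r: "1 < r"
  shows "\<exists>P. nbhd_in M\<^sub>0 p P \<and> \<not> (\<exists>Q. nbhd_in M\<^sub>0 p Q \<and> Q \<subseteq> P \<and> f ` Q \<subseteq> Q)"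
proof -
  obtain v P \<delta> where P: "nbhd_in M\<^sub>0 p P" "P \<subseteq> chart_q_ball \<delta>"
    "\<And>Q. nbhd_in M\<^sub>0 p Q \<Longrightarrow> Q \<subseteq> P \<Longrightarrow> f ` Q \<subseteq> Q \<Longrightarrow>
      \<exists>x\<in>Q. 0 < ev_size v (chart_map \<phi> x) \<and>
        (\<forall>k. ev_size v (chart_map \<phi> ((f ^^ k) x)) = r ^ k * ev_size v (chart_map \<phi> x))"
    using expanding_orbit[OF ev \<mu>] by blast
  obtain E where E: "0 < E" "\<And>x. ev_size v (chart_map \<phi> x) \<le> E * radius x" by (rule ev_size_le_radius) blast
  have False if Q: "nbhd_in M\<^sub>0 p Q" "Q \<subseteq> P" "f ` Q \<subseteq> Q" for Q
  proof -
    obtain x where x: "x \<in> Q" "0 < ev_size v (chart_map \<phi> x)"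
      "\<And>k. ev_size v (chart_map \<phi> ((f ^^ k) x)) = r ^ k * ev_size v (chart_map \<phi> x)"
      using P(3)[OF Q] by blast
    have orbit: "(f ^^ k) x \<in> Q" for k using x(1) Q(3) by (induction k) auto
    have "r ^ k * ev_size v (chart_map \<phi> x) \<le> E * \<delta>" for k
    proof -
      have "radius ((f ^^ k) x) \<le> \<delta>" using orbit[of k] Q(2) P(2) unfolding chart_q_ball_def by auto
      then have "E * radius ((f ^^ k) x) \<le> E * \<delta>" using E(1) by simp
      then show ?thesis using E(2)[of "(f ^^ k) x"] x(3)[of k] by linarith
    qed
    then have "r ^ k \<le> E * \<delta> / ev_size v (chart_map \<phi> x)" for k using x(2) by (simp add: pos_le_divide_eq)
    moreover obtain k where "E * \<delta> / ev_size v (chart_map \<phi> x) < r ^ k" using real_arch_pow[OF r] by blast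
    ultimately show False by (meson not_le)
  qed
  with P(1) show ?thesis by blast
qed

text \<open>For r at least 1 the size of v never falls below its initial value along this orbit,
  while convergence to p would make it tend to 0. The case r = 1 is included because the growth
  factor is exact.\<close>

lemma not_attractive:
  assumes ev: "eigenvalue_of (chart_dim \<phi>) (\<lambda>i j. to_ac (A i j)) \<mu>" and \<mu>: "ac_av \<mu> = r" and r: "1 \<le> r"
  shows "\<not> uniformly_attractive M\<^sub>0 f p"
proof
  assume att: "uniformly_attractive M\<^sub>0 f p"
  obtain v P \<delta> where P: "nbhd_in M\<^sub>0 p P" "P \<subseteq> chart_q_ball \<delta>"
    "\<And>Q. nbhd_in M\<^sub>0 p Q \<Longrightarrow> Q \<subseteq> P \<Longrightarrow> f ` Q \<subseteq> Q \<Longrightarrow>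
      \<exists>x\<in>Q. 0 < ev_size v (chart_map \<phi> x) \<and>
        (\<forall>k. ev_size v (chart_map \<phi> ((f ^^ k) x)) = r ^ k * ev_size v (chart_map \<phi> x))"
    using expanding_orbit[OF ev \<mu>] by blast
  obtain E where E: "0 < E" "\<And>x. ev_size v (chart_map \<phi> x) \<le> E * radius x" by (rule ev_size_le_radius) blast
  obtain Q where Q: "nbhd_in M\<^sub>0 p Q" "Q \<subseteq> P" "f ` Q \<subseteq> Q" "\<forall>x\<in>Q. (\<lambda>n. (f ^^ n) x) \<longlonglongrightarrow> p"
    using att P(1) unfolding uniformly_attractive_def by blast
  obtain x where x: "x \<in> Q" "0 < ev_size v (chart_map \<phi> x)"
    "\<And>k. ev_size v (chart_map \<phi> ((f ^^ k) x)) = r ^ k * ev_size v (chart_map \<phi> x)"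
    using P(3)[OF Q(1-3)] by blast
  let ?e = "ev_size v (chart_map \<phi> x)"
  have "0 < ?e / E" using x(2) E(1) by simp
  then obtain S where S: "open S" "p \<in> S" "S \<subseteq> chart_q_ball (?e / E)" using chart_q_nbhd by blast
  have "eventually (\<lambda>n. (f ^^ n) x \<in> S) sequentially"
    using Q(4) x(1) S(1,2) topological_tendstoD by blast
  then obtain k where "(f ^^ k) x \<in> S" by (auto simp: eventually_sequentially)
  then have "radius ((f ^^ k) x) < ?e / E" using S(3) unfolding chart_q_ball_def by blast
  then have "E * radius ((f ^^ k) x) < ?e" using E(1) by (simp add: pos_less_divide_eq mult.commute)
  then have "r ^ k * ?e < ?e" using E(2)[of "(f ^^ k) x"] x(3)[of k] by linarith
  moreover have "1 * ?e \<le> r ^ k * ?e" using r x(2) by (intro mult_right_mono one_le_power) auto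
  ultimately show False by linarith
qed

text \<open>If f maps Q onto itself, every point has a backward orbit in Q; along one starting in
  the cone v grows like the inverse of \<open>s ^ k\<close>, although it is bounded on P.\<close>

lemma no_fully_invariant_nbhds:
  assumes ev: "eigenvalue_of (chart_dim \<phi>) (\<lambda>i j. to_ac (A i j)) \<mu>" and \<mu>: "ac_av \<mu> = s" and s: "s < 1"
  shows "\<exists>P. nbhd_in M\<^sub>0 p P \<and> \<not> (\<exists>Q. nbhd_in M\<^sub>0 p Q \<and> Q \<subseteq> P \<and> f ` Q = Q)"
proof -
  let ?n = "chart_dim \<phi>" and ?a = "chart_map \<phi> p"
  obtain v where v: "v \<in> coord_space ?n" "v \<noteq> (\<lambda>_. 0)" "mvec ?n ?n (\<lambda>i j. to_ac (A j i)) v = (\<lambda>i. \<mu> * v i)"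
    using ev by (rule left_eigenvector)
  obtain \<delta> where \<delta>: "\<delta> > 0" "\<forall>\<eta>>0. \<exists>z0\<in>coord_space ?n. dq z0 ?a < \<eta> \<and> 0 < ev_size v z0 \<and>
    (\<forall>z. z 0 = z0 \<longrightarrow> (\<forall>k. z k \<in> coord_space ?n \<and> dq (z k) ?a < \<delta> \<and> local_rep \<phi> \<phi> (z (Suc k)) = z k) \<longrightarrow>
      (\<forall>k. s ^ k * ev_size v (z k) = ev_size v z0))"
    using backward_cone[OF v \<mu>] by (elim exE conjE)
  obtain P where P: "nbhd_in M\<^sub>0 p P" "P \<subseteq> rep_dom" "P \<subseteq> chart_q_ball \<delta>" using small_nbhd[OF \<delta>(1)] by blast
  obtain E where E: "0 < E" "\<And>x. ev_size v (chart_map \<phi> x) \<le> E * radius x" by (rule ev_size_le_radius) blast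
  have False if Q: "nbhd_in M\<^sub>0 p Q" "Q \<subseteq> P" "f ` Q = Q" for Q
  proof -
    have "open (interior Q)" "p \<in> interior Q" using Q(1) by (auto simp: nbhd_in_def)
    from chart_q_ball_subset[OF this] obtain \<eta> where \<eta>: "\<eta> > 0" "\<forall>z\<in>coord_space ?n. dq z ?a < \<eta>
      \<longrightarrow> (\<exists>x\<in>interior Q \<inter> chart_dom \<phi>. chart_map \<phi> x = z)" by blast
    from \<delta>(2)[rule_format, OF \<eta>(1)] obtain z0 where z0: "z0 \<in> coord_space ?n" "dq z0 ?a < \<eta>" "0 < ev_size v z0"
      and grow: "\<forall>z. z 0 = z0 \<longrightarrow> (\<forall>k. z k \<in> coord_space ?n \<and> dq (z k) ?a < \<delta> \<and> local_rep \<phi> \<phi> (z (Suc k)) = z k) \<longrightarrow>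
        (\<forall>k. s ^ k * ev_size v (z k) = ev_size v z0)" by (elim bexE conjE)
    obtain x where x: "x \<in> interior Q" "chart_map \<phi> x = z0" using \<eta>(2) z0(1,2) by blast
    then have xQ: "x \<in> Q" using interior_subset by blast
    have "\<forall>y\<in>Q. \<exists>w\<in>Q. f w = y" using Q(3) by (metis imageE)
    \<comment> \<open>A section of f over Q. As f may fail to be injective, one backward orbit is
      selected.\<close>
    then obtain h where h: "\<forall>y\<in>Q. h y \<in> Q \<and> f (h y) = y" by metis
    have orbit: "(h ^^ k) x \<in> Q" for k using xQ h by (induction k) auto
    have dom: "(h ^^ k) x \<in> chart_dom \<phi>" "radius ((h ^^ k) x) < \<delta>" for k
      using orbit[of k] Q(2) P(3) unfolding chart_q_ball_def by blast+
    define z where "z = (\<lambda>k. chart_map \<phi> ((h ^^ k) x))"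
    have preimage: "f ((h ^^ Suc k) x) = (h ^^ k) x" for k using h orbit[of k] by simp
    have "z k \<in> coord_space ?n \<and> dq (z k) ?a < \<delta> \<and> local_rep \<phi> \<phi> (z (Suc k)) = z k" for k
      unfolding z_def local_rep_map[OF dom(1)] preimage
      using map_mem[OF dom(1)[of k]] dom(2)[of k] by (simp add: radius_def)
    moreover have "z 0 = z0" using x(2) by (simp add: z_def)
    ultimately have ev: "s ^ k * ev_size v (z k) = ev_size v z0" for k using grow by blast
    have "ev_size v z0 \<le> s ^ k * (E * \<delta>)" for k
    proof -
      have "ev_size v (z k) \<le> E * radius ((h ^^ k) x)" unfolding z_def by (rule E)
      also have "\<dots> \<le> E * \<delta>" using E(1) dom(2)[of k] by (intro mult_left_mono) auto
      finally have "s ^ k * ev_size v (z k) \<le> s ^ k * (E * \<delta>)" using s_pos by (intro mult_left_mono) auto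
      then show ?thesis unfolding ev .
    qed
    moreover have "(\<lambda>k. s ^ k * (E * \<delta>)) \<longlonglongrightarrow> 0 * (E * \<delta>)"
      using s s_pos by (intro tendsto_mult_right LIMSEQ_power_zero) auto
    ultimately have "ev_size v z0 \<le> 0 * (E * \<delta>)" by (intro LIMSEQ_le_const) auto
    with z0(3) show False by simp
  qed
  with P(1) show ?thesis by blast
qed

end

section \<open>Adapted charts and invertibility of the derivative\<close>

context analytic_fixed_point
begin

lemma ex_adapted_chart:
  assumes \<phi>: "\<phi> \<in> charts_at \<A> p"
    and A: "strictly_diff (chart_dim \<phi>) (chart_dim \<phi>) (local_rep \<phi> \<phi>) (chart_map \<phi> p) A"
    and s: "0 < s" "0 < r"
    and ev: "\<And>\<mu>. eigenvalue_of (chart_dim \<phi>) (\<lambda>i j. to_ac (A i j)) \<mu> \<Longrightarrow> s \<le> ac_av \<mu> \<and> ac_av \<mu> \<le> r"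
  shows "\<exists>q C \<rho> K. adapted_chart \<A> M\<^sub>0 f p \<phi> A s r q C \<rho> K"
proof -
  obtain q C \<rho> K where
    "adapted_fixed_point (chart_dim \<phi>) A s r q C (local_rep \<phi> \<phi>) (chart_map \<phi> p) \<rho> K"
    using ex_adapted_fixed_point[OF s ev A chart_map_mem[OF \<phi> charts_atD(2)[OF \<phi>]] local_rep_p[OF \<phi>]]
    by blast
  then have "adapted_chart \<A> M\<^sub>0 f p \<phi> A s r q C \<rho> K"
    using \<phi> analytic_fixed_point_axioms by (intro adapted_chart.intro adapted_chart_axioms.intro)
  then show ?thesis by blast
qed

text \<open>The columns of A' are preimages of the unit vectors, supplied by surjectivity of the
  tangent map.\<close>

lemma derivative_inverse:
  assumes \<phi>: "\<phi> \<in> charts_at \<A> p"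
    and bij: "bij_betw (tangent_map \<A> p f) (tangent_space \<A> p) (tangent_space \<A> p)"
    and A: "\<And>v. v \<in> tangent_space \<A> p \<Longrightarrow> tangent_map \<A> p f v \<phi> = mvec (chart_dim \<phi>) (chart_dim \<phi>) A (v \<phi>)"
  shows "\<exists>A'. \<forall>x\<in>coord_space (chart_dim \<phi>).
    mvec (chart_dim \<phi>) (chart_dim \<phi>) A (mvec (chart_dim \<phi>) (chart_dim \<phi>) A' x) = x"
proof -
  let ?n = "chart_dim \<phi>"
  have "\<exists>y. y \<in> coord_space ?n \<and> mvec ?n ?n A y = unit_vec j" if j: "j < ?n" for j
  proof -
    have u: "unit_vec j \<in> coord_space ?n" using j by simp
    obtain v where v: "v \<in> tangent_space \<A> p" "tangent_map \<A> p f v = tangent_lift \<phi> (unit_vec j)"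
      using bij_betw_imp_surj_on[OF bij] tangent_lift_mem[OF \<phi> u] by (metis imageE)
    then have "mvec ?n ?n A (v \<phi>) = unit_vec j"
      using A[OF v(1)] tangent_lift_self[OF \<phi> u] by simp
    then show ?thesis using tangent_spaceD(1)[OF v(1) \<phi>] by blast
  qed
  then obtain y where y: "\<And>j. j < ?n \<Longrightarrow> mvec ?n ?n A (y j) = unit_vec j" by metis
  have "mvec ?n ?n A (mvec ?n ?n (\<lambda>i j. y j i) x) = x" if x: "x \<in> coord_space ?n" for x
  proof -
    have "mvec ?n ?n A (mvec ?n ?n (\<lambda>i j. y j i) x) = mvec ?n ?n A (\<lambda>i. \<Sum>j<?n. x j * y j i)"
      by (intro mvec_cong) (simp add: mvec_def mult.commute)
    also have "\<dots> = (\<lambda>i. \<Sum>j<?n. x j * mvec ?n ?n A (y j) i)" unfolding mvec_sum mvec_scale ..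
    also have "\<dots> = (\<lambda>i. \<Sum>j<?n. x j * unit_vec j i)" using y by (intro ext sum.cong) auto
    also have "\<dots> = x" using x unfolding sum_unit_vec by (auto simp: coord_space_def)
    finally show ?thesis .
  qed
  then show ?thesis by blast
qed

end

text \<open>A left eigenvector for 0 vanishes on the image of A, which by the right inverse contains
  all unit vectors. Only vectors over K are inserted into the form, so A' stays a matrix over
  K.\<close>

lemma eigenvalue_nonzero:
  fixes A :: "nat \<Rightarrow> nat \<Rightarrow> 'k::complete_ultrametric_field"
  assumes inv: "\<And>x. x \<in> coord_space n \<Longrightarrow> mvec n n A (mvec n n A' x) = x"
    and ev: "eigenvalue_of n (\<lambda>i j. to_ac (A i j)) \<mu>"
  shows "\<mu> \<noteq> 0"
proof
  assume \<mu>: "\<mu> = 0"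
  obtain v where v: "v \<in> coord_space n" "v \<noteq> (\<lambda>_. 0)" "mvec n n (\<lambda>i j. to_ac (A j i)) v = (\<lambda>i. \<mu> * v i)"
    using eigenvalue_of_transpose[OF ev] unfolding eigenvalue_of_def by blast
  have zero: "pairing n v (mvec n n A x) = 0" for x
    unfolding pairing_mvec v(3) \<mu> by (simp add: pairing_def)
  have "v j = 0" if j: "j < n" for j
  proof -
    have "pairing n v (unit_vec j) = 0" using zero[of "mvec n n A' (unit_vec j)"] inv[of "unit_vec j"] j by simp
    moreover have "pairing n v (unit_vec j) = (\<Sum>i<n. if i = j then v i else 0)"
      unfolding pairing_def by (intro sum.cong) (auto simp: unit_vec_def)
    ultimately show ?thesis using j by simp
  qed
  then have "v = (\<lambda>_. 0)" using v(1) by (intro coord_space_eqI) auto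
  with v(2) show False ..
qed

context analytic_fixed_point
begin

lemma eigenvalues_vs_invariant_nbhds:
  assumes bij: "bij_betw (tangent_map \<A> p f) (tangent_space \<A> p) (tangent_space \<A> p)"
  defines "R \<equiv> eigenvalue_avs tangent_scale (tangent_space \<A> p) (tangent_map \<A> p f)"
  shows "R \<subseteq> {0<..1} \<longleftrightarrow>
      (\<forall>P. nbhd_in M\<^sub>0 p P \<longrightarrow> (\<exists>Q. nbhd_in M\<^sub>0 p Q \<and> Q \<subseteq> P \<and> f ` Q \<subseteq> Q))" (is "?a1 \<longleftrightarrow> ?a2")
    and "R \<subseteq> {1} \<longleftrightarrow>
      (\<forall>P. nbhd_in M\<^sub>0 p P \<longrightarrow> (\<exists>Q. nbhd_in M\<^sub>0 p Q \<and> Q \<subseteq> P \<and> f ` Q = Q))" (is "?b1 \<longleftrightarrow> ?b2")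
    and "R \<subseteq> {0<..<1} \<longleftrightarrow> uniformly_attractive M\<^sub>0 f p" (is "?c1 \<longleftrightarrow> ?c2")
proof -
  obtain \<phi> where \<phi>: "\<phi> \<in> charts_at \<A> p" using ex_chart_at by blast
  let ?n = "chart_dim \<phi>" and ?T = "tangent_space \<A> p" and ?\<alpha> = "tangent_map \<A> p f"
  have pm: "chart_map \<phi> p \<in> coord_space ?n" using chart_map_mem[OF \<phi> charts_atD(2)[OF \<phi>]] .
  obtain A where A: "strictly_diff ?n ?n (local_rep \<phi> \<phi>) (chart_map \<phi> p) A"
    using strictly_diff_local_rep[OF \<phi> \<phi>] by blast
  have \<alpha>: "?\<alpha> v \<in> ?T" "?\<alpha> v \<phi> = mvec ?n ?n A (v \<phi>)" if "v \<in> ?T" for v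
    using tangent_map_chart[OF \<phi> that] differential_eq_mvec[OF A pm tangent_spaceD(1)[OF that \<phi>]] by auto
  interpret coordinate_space tangent_scale ?T ?n "\<lambda>v. v \<phi>" "\<lambda>i. tangent_lift \<phi> (unit_vec i)"
    by (rule coordinate_space_tangent[OF \<phi>])
  define Ev where "Ev = {\<mu>. eigenvalue_of ?n (\<lambda>i j. to_ac (A i j)) \<mu>}"
  have "ac_eigenvalue tangent_scale ?T ?\<alpha> \<mu> \<longleftrightarrow> \<mu> \<in> Ev" for \<mu>
    unfolding Ev_def mem_Collect_eq by (rule ac_eigenvalue_iff_eigenvalue_of) (use \<alpha> in auto)
  then have "{\<mu>. ac_eigenvalue tangent_scale ?T ?\<alpha> \<mu>} = Ev" by blast
  then have R: "R = ac_av ` Ev" unfolding R_def eigenvalue_avs_def by simp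
  obtain A' where A': "\<And>x. x \<in> coord_space ?n \<Longrightarrow> mvec ?n ?n A (mvec ?n ?n A' x) = x"
    using derivative_inverse[OF \<phi> bij \<alpha>(2)] by blast
  have R_fin: "finite R" unfolding R Ev_def by (intro finite_imageI finite_eigenvalues)
  have R_pos: "0 < x" if "x \<in> R" for x
    using that eigenvalue_nonzero[OF A'] unfolding R Ev_def by auto
  have ev_R: "ac_av \<mu> \<in> R" if "eigenvalue_of ?n (\<lambda>i j. to_ac (A i j)) \<mu>" for \<mu>
    using that unfolding R Ev_def by blast
  have R_ev: "\<exists>\<mu>. eigenvalue_of ?n (\<lambda>i j. to_ac (A i j)) \<mu> \<and> ac_av \<mu> = x" if "x \<in> R" for x
    using that unfolding R Ev_def by blast
  \<comment> \<open>The inserted 1 handles empty R, that is dimension 0, and ensures that s differs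
    from 1 only if an eigenvalue of absolute value s < 1 exists.\<close>
  define s where "s = Min (insert 1 R)"
  \<comment> \<open>The inserted value has to be positive and below 1: otherwise r < 1 would not
    follow in the third equivalence. If r is at least 1, it belongs to an eigenvalue.\<close>
  define r where "r = Max (insert (1/2) R)"
  have s: "0 < s" "\<And>x. x \<in> R \<Longrightarrow> s \<le> x" "s \<le> 1" "s = 1 \<or> s \<in> R"
    using R_fin R_pos Min_in[of "insert 1 R"] by (auto simp: s_def)
  have r: "\<And>x. x \<in> R \<Longrightarrow> x \<le> r" "r = 1/2 \<or> r \<in> R"
    using R_fin Max_in[of "insert (1/2) R"] by (auto simp: r_def)
  have "0 < r" using r(2) R_pos by auto
  then obtain q C \<rho> K where "adapted_chart \<A> M\<^sub>0 f p \<phi> A s r q C \<rho> K"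
    using ex_adapted_chart[OF \<phi> A s(1), of r] s(2) r(1) ev_R by blast
  then interpret I: adapted_chart \<A> M\<^sub>0 f p \<phi> A s r q C \<rho> K .
  \<comment> \<open>Isolated because the second equivalence uses it again: f
    \<open>Q = Q implies f\<close> Q \<subseteq> Q.\<close>
  have a_dir: ?a1 if ?a2
  proof -
    have "r \<le> 1"
    proof (rule ccontr)
      assume "\<not> r \<le> 1"
      then have "1 < r" "r \<in> R" using r(2) by auto
      then obtain \<mu> where "eigenvalue_of ?n (\<lambda>i j. to_ac (A i j)) \<mu>" "ac_av \<mu> = r" using R_ev by blast
      from I.no_invariant_nbhds[OF this \<open>1 < r\<close>] that show False by blast
    qed
    then show ?a1 using r(1) R_pos by fastforce
  qed
  show "?a1 \<longleftrightarrow> ?a2"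
  proof
    assume ?a1
    then have "r \<le> 1" using r(2) by auto
    then show ?a2 using I.ex_invariant_nbhd by blast
  qed (rule a_dir)
  show "?b1 \<longleftrightarrow> ?b2"
  proof
    assume b1: ?b1
    \<comment> \<open>The norm is chosen anew with s = r = 1, so that A becomes an isometry; for
      empty R the earlier r would be 1/2.\<close>
    have "1 \<le> ac_av \<mu> \<and> ac_av \<mu> \<le> 1" if "eigenvalue_of ?n (\<lambda>i j. to_ac (A i j)) \<mu>" for \<mu>
      using ev_R[OF that] b1 by auto
    then obtain q C \<rho> K where "adapted_chart \<A> M\<^sub>0 f p \<phi> A 1 1 q C \<rho> K"
      using ex_adapted_chart[OF \<phi> A zero_less_one zero_less_one] by blast
    then interpret J: adapted_chart \<A> M\<^sub>0 f p \<phi> A 1 1 q C \<rho> K .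
    show ?b2 using J.ex_fully_invariant_nbhd[OF refl refl A'] by blast
  next
    assume b2: ?b2
    then have ?a2 by (metis order_refl)
    then have a1: ?a1 by (rule a_dir)
    have "s = 1"
    proof (rule ccontr)
      assume "s \<noteq> 1"
      then have "s < 1" "s \<in> R" using s(3,4) by auto
      then obtain \<mu> where "eigenvalue_of ?n (\<lambda>i j. to_ac (A i j)) \<mu>" "ac_av \<mu> = s" using R_ev by blast
      from I.no_fully_invariant_nbhds[OF this \<open>s < 1\<close>] b2 show False by blast
    qed
    then show ?b1 using s(2) a1 by fastforce
  qed
  show "?c1 \<longleftrightarrow> ?c2"
  proof
    assume ?c1
    then have "r < 1" using r(2) by auto
    then show ?c2 by (rule I.attractive)
  next
    assume c2: ?c2
    have "r < 1"
    proof (rule ccontr)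
      assume "\<not> r < 1"
      then have "1 \<le> r" "r \<in> R" using r(2) by auto
      then obtain \<mu> where "eigenvalue_of ?n (\<lambda>i j. to_ac (A i j)) \<mu>" "ac_av \<mu> = r" using R_ev by blast
      from I.not_attractive[OF this \<open>1 \<le> r\<close>] c2 show False by blast
    qed
    then show ?c1 using r(1) R_pos by fastforce
  qed
qed

end

theorem theoremB:
  fixes \<A> :: "('m::topological_space, 'k::complete_ultrametric_field) chart set"
    and M\<^sub>0 :: "'m set" and f :: "'m \<Rightarrow> 'm" and p :: 'm
  defines "T \<equiv> tangent_space \<A> p"
    and "\<alpha> \<equiv> tangent_map \<A> p f"
  defines "R \<equiv> eigenvalue_avs tangent_scale T \<alpha>"
  assumes "analytic_atlas \<A>"
    and "open M\<^sub>0"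
    and "analytic_map \<A> M\<^sub>0 f"
    and "p \<in> M\<^sub>0"
    and "f p = p"
    and "bij_betw \<alpha> T T"
  shows "(R \<subseteq> {0<..1} \<longleftrightarrow>
           (\<forall>P. nbhd_in M\<^sub>0 p P \<longrightarrow> (\<exists>Q. nbhd_in M\<^sub>0 p Q \<and> Q \<subseteq> P \<and> f ` Q \<subseteq> Q))) \<and>
         (R \<subseteq> {1} \<longleftrightarrow>
           (\<forall>P. nbhd_in M\<^sub>0 p P \<longrightarrow> (\<exists>Q. nbhd_in M\<^sub>0 p Q \<and> Q \<subseteq> P \<and> f ` Q = Q))) \<and>
         (R \<subseteq> {0<..<1} \<longleftrightarrow> uniformly_attractive M\<^sub>0 f p)"
proof -
  interpret analytic_fixed_point \<A> M\<^sub>0 f p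
    using assms(4-8) by (rule analytic_fixed_point.intro)
  show ?thesis
    using eigenvalues_vs_invariant_nbhds[OF assms(9)[unfolded T_def \<alpha>_def]] unfolding R_def T_def \<alpha>_def by blast
qed

end
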